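(* Let $k$ be a field, let $\mathcal{G}$ be a finite simple graph with vertices $v_1,\ldots,v_n$, let $S=k[T_1,\ldots,T_n]$ and $R=S/I(\mathcal{G})$, where $I(\mathcal{G})$ is the edge ideal of $\mathcal{G}$. Assume that $R$ is not a complete intersection. If $\mathcal{G}$ is claw-free, then there exist a positive integer $b$ and a real number $\rho>1$ such that $$\varepsilon_i(R)\sim\frac{b\rho^i}{i},$$ that is, $\lim_{i\to\infty}\dfrac{\varepsilon_i(R)}{b\rho^i/i}=1$.
   Context: The polynomial ring $S=k[T_1,\ldots,T_n]$ is standard graded ($\deg T_j=1$). Edge ideal: $I(\mathcal{G})=(T_iT_j \mid v_iv_j\text{ is an edge of }\mathcal{G})\subseteq S$. Claw-free: a claw is a graph with four vertices $v_1,v_2,v_3,v_4$ and edges $\{v_1,v_2\},\{v_1,v_3\},\{v_1,v_4\}$. A simple graph is claw-free if no claw appears as an induced subgraph. Complete intersection: $R=S/I$ is a complete intersection if $I$ is generated by a (possibly empty) $S$-regular sequence. Deviations: for $R=S/I$ with $I\subseteq(T_1,\ldots,T_n)^2$ a homogeneous ideal, put $\beta_i^R(k)=\dim_k \mathrm{Tor}_i^R(k,k)$ and let $P_k^R(z)=\sum_{i\geqslant 0}\beta_i^R(k)z^i$ be the Poincaré series of $k$ over $R$. The deviations $\varepsilon_i=\varepsilon_i(R)$, $i\geqslant 1$, are the uniquely determined integers such that $$P_k^R(z)=\prod_{i=1}^\infty \frac{(1+z^{2i-1})^{\varepsilon_{2i-1}}}{(1-z^{2i})^{\varepsilon_{2i}}}$$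 as formal power series. *)

theory Defs
  imports
    "HOL-Algebra.QuotRing"
    "HOL-Algebra.Module"
    "HOL-Algebra.Algebraic_Closure_Type"
    "HOL-Library.Poly_Mapping"
    "HOL-Library.Function_Algebras"
    "HOL-Computational_Algebra.Formal_Power_Series"
    "HOL-Analysis.Infinite_Products"
begin

text \<open>
  A finite graph is an adjacency relation on a finite type of vertices, and the variables
  of the polynomial ring are indexed by the vertices.
\<close>

definition claw_free :: "('v \<Rightarrow> 'v \<Rightarrow> bool) \<Rightarrow> bool" where
  "claw_free E \<longleftrightarrow>
     \<not> (\<exists>a b c d. distinct [a, b, c, d] \<and> E a b \<and> E a c \<and> E a d \<and>
          \<not> E b c \<and> \<not> E b d \<and> \<not> E c d)"

type_synonym ('v, 'k) mpoly = "('v \<Rightarrow>\<^sub>0 nat) \<Rightarrow>\<^sub>0 'k"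

abbreviation mpoly_ring :: "('v, 'k::comm_ring_1) mpoly ring" where
  "mpoly_ring \<equiv> ring_of_type_algebra"

definition mvar :: "'v \<Rightarrow> ('v, 'k::comm_ring_1) mpoly" where
  "mvar v = Poly_Mapping.single (Poly_Mapping.single v 1) 1"

definition edge_ideal :: "('v \<Rightarrow> 'v \<Rightarrow> bool) \<Rightarrow> ('v, 'k::comm_ring_1) mpoly set" where
  "edge_ideal E = Idl\<^bsub>mpoly_ring\<^esub> {mvar u * mvar v | u v. E u v}"

definition regular_sequence :: "('a, 'b) ring_scheme \<Rightarrow> 'a list \<Rightarrow> bool" where
  "regular_sequence R xs \<longleftrightarrow>
     set xs \<subseteq> carrier R \<and>
     (\<forall>i<length xs. \<forall>y\<in>carrier R.
        (xs ! i) \<otimes>\<^bsub>R\<^esub> y \<in> Idl\<^bsub>R\<^esub> (set (take i xs)) \<longrightarrow> y \<in> Idl\<^bsub>R\<^esub> (set (take i xs))) \<and>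
     Idl\<^bsub>R\<^esub> (set xs) \<noteq> carrier R"

text \<open>The quotient of the polynomial ring by \<open>I\<close> is a complete intersection.\<close>

definition complete_intersection :: "('v, 'k::comm_ring_1) mpoly set \<Rightarrow> bool" where
  "complete_intersection I \<longleftrightarrow>
     (\<exists>xs. regular_sequence mpoly_ring xs \<and> I = Idl\<^bsub>mpoly_ring\<^esub> (set xs))"

text \<open>
  The elements of the direct sum of \<open>n\<close> copies of a module \<open>N\<close> are sequences in \<open>N\<close> that
  vanish from index \<open>n\<close> on.  An \<open>m\<times>n\<close> matrix over the base ring acts on them from the left.
\<close>

definition free_power :: "('r, 'a, 'x) module_scheme \<Rightarrow> nat \<Rightarrow> (nat \<Rightarrow> 'a) set" where
  "free_power N n = {v. (\<forall>j<n. v j \<in> carrier N) \<and> (\<forall>j\<ge>n. v j = \<zero>\<^bsub>N\<^esub>)}"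

definition mat_app ::
  "('r, 'a, 'x) module_scheme \<Rightarrow> nat \<Rightarrow> nat \<Rightarrow> (nat \<Rightarrow> nat \<Rightarrow> 'r) \<Rightarrow> (nat \<Rightarrow> 'a) \<Rightarrow> nat \<Rightarrow> 'a" where
  "mat_app N m n A v =
     (\<lambda>i. if i < m then (\<Oplus>\<^bsub>N\<^esub>j\<in>{..<n}. A i j \<odot>\<^bsub>N\<^esub> v j) else \<zero>\<^bsub>N\<^esub>)"

definition self_module :: "('r, 'x) ring_scheme \<Rightarrow> ('r, 'r) module" where
  "self_module R =
     \<lparr>carrier = carrier R, monoid.mult = monoid.mult R, one = one R, zero = zero R,
      add = add R, module.smult = monoid.mult R\<rparr>"

text \<open>
  A complex of free modules of finite rank over a ring, augmented to a module: the module in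
  degree \<open>i\<close> is free of rank \<open>rk i\<close>; for \<open>i > 0\<close> the differential from degree \<open>i\<close> to degree
  \<open>i - 1\<close> is given by the \<open>rk (i - 1) \<times> rk i\<close> matrix \<open>dmat i\<close> (\<open>dmat 0\<close> is not used); and
  \<open>augm j\<close> is the image of the \<open>j\<close>-th basis vector of degree \<open>0\<close> under the augmentation.
\<close>

record ('r, 'm) free_cplx =
  rk :: "nat \<Rightarrow> nat"
  dmat :: "nat \<Rightarrow> nat \<Rightarrow> nat \<Rightarrow> 'r"
  augm :: "nat \<Rightarrow> 'm"

text \<open>
  Cycles and boundaries of the tensor product of \<open>F\<close> with \<open>N\<close>, where the tensor product of a
  free module of rank \<open>n\<close> with \<open>N\<close> is identified with the direct sum of \<open>n\<close> copies of \<open>N\<close>.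
  For \<open>N = self_module R\<close> this is \<open>F\<close> itself.
\<close>

definition differential ::
  "('r, 'a, 'x) module_scheme \<Rightarrow> ('r, 'm) free_cplx \<Rightarrow> nat \<Rightarrow> (nat \<Rightarrow> 'a) \<Rightarrow> nat \<Rightarrow> 'a" where
  "differential N F i = mat_app N (rk F (i - 1)) (rk F i) (dmat F i)"

definition cycles :: "('r, 'a, 'x) module_scheme \<Rightarrow> ('r, 'm) free_cplx \<Rightarrow> nat \<Rightarrow> (nat \<Rightarrow> 'a) set" where
  "cycles N F i =
     {v \<in> free_power N (rk F i). i > 0 \<longrightarrow> differential N F i v = (\<lambda>_. \<zero>\<^bsub>N\<^esub>)}"

definition boundaries :: "('r, 'a, 'x) module_scheme \<Rightarrow> ('r, 'm) free_cplx \<Rightarrow> nat \<Rightarrow> (nat \<Rightarrow> 'a) set" where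
  "boundaries N F i = differential N F (Suc i) ` free_power N (rk F (Suc i))"

definition augmentation :: "('r, 'm, 'x) module_scheme \<Rightarrow> ('r, 'm) free_cplx \<Rightarrow> (nat \<Rightarrow> 'r) \<Rightarrow> 'm" where
  "augmentation M F v = (\<Oplus>\<^bsub>M\<^esub>j\<in>{..<rk F 0}. v j \<odot>\<^bsub>M\<^esub> augm F j)"

definition free_resolution ::
  "('r, 'y) ring_scheme \<Rightarrow> ('r, 'm, 'x) module_scheme \<Rightarrow> ('r, 'm) free_cplx \<Rightarrow> bool" where
  "free_resolution R M F \<longleftrightarrow>
     (\<forall>i>0. \<forall>a<rk F (i - 1). \<forall>b<rk F i. dmat F i a b \<in> carrier R) \<and>
     (\<forall>a<rk F 0. augm F a \<in> carrier M) \<and>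
     augmentation M F ` free_power (self_module R) (rk F 0) = carrier M \<and>
     {v \<in> free_power (self_module R) (rk F 0). augmentation M F v = \<zero>\<^bsub>M\<^esub>}
       = boundaries (self_module R) F 0 \<and>
     (\<forall>i>0. cycles (self_module R) F i = boundaries (self_module R) F i)"

text \<open>
  The field \<open>k\<close> as a module over the quotient of the polynomial ring by an ideal contained in
  \<open>(T\<^sub>1, \<dots>, T\<^sub>n)\<close>: a residue class acts as the common constant coefficient of its members.
\<close>

definition residue_module :: "(('v, 'k::field) mpoly set, 'k) module" where
  "residue_module =
     \<lparr>carrier = UNIV, monoid.mult = (*), one = 1, zero = 0, add = (+),
      module.smult = (\<lambda>x c. the_elem ((\<lambda>f. Poly_Mapping.lookup f 0) ` x) * c)\<rparr>"

abbreviation (input) vdim :: "(nat \<Rightarrow> 'k::field) set \<Rightarrow> nat" where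
  "vdim \<equiv> vector_space.dim (\<lambda>c v j. c * v j)"

text \<open>
  For \<open>R\<close> the quotient of the polynomial ring by \<open>I\<close>, \<open>betti I i\<close> is the dimension of
  \<open>Tor\<^sub>i(k, k)\<close> over \<open>R\<close>, i.e. of the \<open>i\<close>-th homology of the tensor product with \<open>k\<close> of a
  free resolution of \<open>k\<close> over \<open>R\<close>.  Since \<open>R\<close> is Noetherian, there is a resolution by
  modules of finite rank.  The homology does not depend on the choice of the resolution.
\<close>

definition betti :: "('v, 'k::field) mpoly set \<Rightarrow> nat \<Rightarrow> nat" where
  "betti I i =
     (let F = (SOME F. free_resolution (mpoly_ring Quot I) (residue_module :: (_, 'k) module) F)
      in vdim (cycles (residue_module :: (_, 'k) module) F i)
         - vdim (boundaries (residue_module :: (_, 'k) module) F i))"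

definition poincare_series :: "('v, 'k::field) mpoly set \<Rightarrow> real fps" where
  "poincare_series I = Abs_fps (\<lambda>i. of_nat (betti I i))"

text \<open>
  The infinite product converges in the \<open>X\<close>-adic topology of \<open>real fps\<close>.  The factors are
  numbered from \<open>0\<close>, so the factor \<open>i\<close> involves the deviations \<open>2i+1\<close> and \<open>2i+2\<close>;
  the value at \<open>0\<close> is irrelevant.
\<close>

definition is_deviation_sequence :: "real fps \<Rightarrow> (nat \<Rightarrow> int) \<Rightarrow> bool" where
  "is_deviation_sequence P e \<longleftrightarrow>
     (\<lambda>i. ((1 + fps_X ^ (2 * i + 1)) powi e (2 * i + 1)) /
          ((1 - fps_X ^ (2 * i + 2)) powi e (2 * i + 2))) has_prod P"

definition deviation :: "('v, 'k::field) mpoly set \<Rightarrow> nat \<Rightarrow> int" where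
  "deviation I i = (THE d. \<exists>e. is_deviation_sequence (poincare_series I) e \<and> e i = d)"

end

theory Submission
  imports Defs
begin

text \<open>
  Let \<open>f(x) = \<Sum> x^|s|\<close>, summed over the independent sets \<open>s\<close> of the graph, be its independence
  polynomial.  The Hilbert series of \<open>R\<close> is \<open>f(z/(1-z))\<close>, and \<open>R\<close> is a Koszul algebra, so
  \<open>P(z) * f(-z/(1+z)) = 1\<close> for the Poincare series \<open>P\<close> of the residue field.  For a claw-free
  graph all zeros of \<open>f\<close> are real and negative, hence \<open>f = \<Prod>(1 + a\<^sub>j x)\<close> with \<open>a\<^sub>j > 0\<close> and
  \<open>P(z) = (1+z)^d / \<Prod>(1 - (a\<^sub>j - 1) z)\<close>.  Taking \<open>z P'/P\<close> on this side and on the product that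
  defines the deviations gives
  \<open>\<Sum>\<^bsub>k|n\<^esub> (-1)^(n-k) k e\<^sub>k = \<Sum>\<^sub>j (a\<^sub>j - 1)^n - (-1)^n d\<close>.
  The term \<open>k = n\<close> dominates on the left, so \<open>n e\<^sub>n\<close> is asymptotic to \<open>\<Sum>\<^sub>j (a\<^sub>j - 1)^n\<close>.  All
  \<open>a\<^sub>j - 1\<close> are larger than \<open>-1\<close>; as soon as one of them exceeds \<open>1\<close>, the largest one, \<open>\<rho>\<close>, is
  strictly larger in absolute value than every other value, and \<open>b\<close> is its multiplicity.  Finally, if
  \<open>R\<close> is not a complete intersection then some vertex has two neighbours, and the triangle or
  path that they span forces some \<open>a\<^sub>j \<ge> 5/2\<close>.

  Real-rootedness (\<open>claw_free_real_rooted\<close>) follows from a Christoffel-Darboux identity: in a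
  claw-free graph the components of the symmetric difference of two independent sets are paths
  and even cycles, and exchanging the two sides of one component evaluates
  \<open>x f'(x) f(y) - y f'(y) f(x)\<close> as \<open>x - y\<close> times a sum of terms \<open>(xy)^i h(x) h(y)\<close> with
  independence polynomials \<open>h\<close> of smaller graphs.  At a zero \<open>x\<close> with \<open>y\<close> its conjugate, all
  these terms are nonnegative, and unless \<open>x\<close> is real they sum to zero.

  The formula for \<open>P\<close> (\<open>poincare_series_edge_ideal\<close>) has three ingredients.  In \<open>R\<close> the colon of
  an ideal generated by variables by a further variable is again generated by variables
  (\<open>vars_ideal_colon\<close>).  Hence a module with generators whose successive colon ideals are generated
  by variables has a syzygy module of the same kind (\<open>linear_quotients_step\<close>), which yields a
  minimal resolution of the residue field whose basis elements are words in the vertices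
  (\<open>minimal_resolution_exists\<close>).  The comparison theorem for resolutions identifies the Betti
  numbers, whatever resolution they are computed from, with the numbers of these words
  (\<open>betti_eq_minimal_rank\<close>).  And the words are counted by a recursion that mirrors the recursion
  of the independence polynomial under deletion of a vertex.
\<close>

section \<open>Real-rootedness of the independence polynomial of a claw-free graph\<close>

definition indep_sets :: "('v \<Rightarrow> 'v \<Rightarrow> bool) \<Rightarrow> 'v set \<Rightarrow> 'v set set" where
  "indep_sets E A = {s. s \<subseteq> A \<and> (\<forall>u\<in>s. \<forall>v\<in>s. \<not> E u v)}"

text \<open>
  The argument ranges over real and complex numbers, over the variable of a polynomial ring, and
  over power series.
\<close>

definition indep_poly :: "('v \<Rightarrow> 'v \<Rightarrow> bool) \<Rightarrow> 'v set \<Rightarrow> 'a::comm_semiring_1 \<Rightarrow> 'a" where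
  "indep_poly E A x = (\<Sum>s\<in>indep_sets E A. x ^ card s)"

definition closed_nbhd :: "('v \<Rightarrow> 'v \<Rightarrow> bool) \<Rightarrow> 'v set \<Rightarrow> 'v set" where
  "closed_nbhd E C = C \<union> {v. \<exists>c\<in>C. E c v}"

lemma finite_indep_sets [simp]: "finite (indep_sets E (A :: 'v::finite set))"
  by (rule finite_subset[of _ "Pow A"]) (auto simp: indep_sets_def)

lemma indep_poly_empty [simp]: "indep_poly E {} x = 1"
proof -
  have "indep_sets E {} = {{}}" by (auto simp: indep_sets_def)
  then show ?thesis by (simp add: indep_poly_def)
qed

text \<open>
  An independent set that contains \<open>v\<close> consists of \<open>v\<close> and an independent set that avoids the
  closed neighbourhood of \<open>v\<close>.
\<close>

lemma indep_poly_remove: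
  fixes E :: "'v::finite \<Rightarrow> 'v \<Rightarrow> bool"
  assumes E: "symp E" "irreflp E" and v: "v \<in> A"
  shows "indep_poly E A x
       = indep_poly E (A - {v}) x + x * indep_poly E (A - closed_nbhd E {v}) x"
proof -
  have split: "indep_sets E A = indep_sets E (A - {v}) \<union> insert v ` indep_sets E (A - closed_nbhd E {v})"
    (is "_ = _ \<union> ?R")
  proof (intro subset_antisym subsetI)
    fix s assume s: "s \<in> indep_sets E A"
    show "s \<in> indep_sets E (A - {v}) \<union> ?R"
    proof (cases "v \<in> s")
      case True
      then have "s = insert v (s - {v})" by blast
      moreover have "s - {v} \<in> indep_sets E (A - closed_nbhd E {v})"
        using s True by (auto simp: indep_sets_def closed_nbhd_def)
      ultimately show ?thesis by blast
    qed (use s in \<open>auto simp: indep_sets_def\<close>)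
  next
    fix s assume "s \<in> indep_sets E (A - {v}) \<union> ?R"
    then show "s \<in> indep_sets E A"
      using v E by (auto simp: indep_sets_def closed_nbhd_def symp_def irreflp_def)
  qed
  have inj: "inj_on (insert v) (indep_sets E (A - closed_nbhd E {v}))"
    by (rule inj_onI) (auto simp: indep_sets_def closed_nbhd_def insert_eq_iff)
  have "indep_poly E A x = indep_poly E (A - {v}) x + (\<Sum>s\<in>?R. x ^ card s)"
    unfolding indep_poly_def split
    by (rule sum.union_disjoint) (auto simp: indep_sets_def)
  also have "(\<Sum>s\<in>?R. x ^ card s) = (\<Sum>s\<in>indep_sets E (A - closed_nbhd E {v}). x * x ^ card s)"
    unfolding sum.reindex[OF inj] o_def
  proof (rule sum.cong)
    fix s assume "s \<in> indep_sets E (A - closed_nbhd E {v})"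
    then have "v \<notin> s" by (auto simp: indep_sets_def closed_nbhd_def)
    then show "x ^ card (insert v s) = x * x ^ card s" by simp
  qed simp
  finally show ?thesis by (simp add: indep_poly_def sum_distrib_left)
qed

text \<open>
  Connectedness of the subgraph induced on \<open>C\<close>, expressed by cuts instead of walks: in this form
  it directly supplies the next edge when a connected set is exhausted vertex by vertex.
\<close>

definition joined :: "('v \<Rightarrow> 'v \<Rightarrow> bool) \<Rightarrow> 'v set \<Rightarrow> bool" where
  "joined E C \<longleftrightarrow> C \<noteq> {} \<and> (\<forall>S\<subseteq>C. S \<noteq> {} \<longrightarrow> S \<noteq> C \<longrightarrow> (\<exists>a\<in>S. \<exists>b\<in>C - S. E a b))"

definition components :: "('v \<Rightarrow> 'v \<Rightarrow> bool) \<Rightarrow> 'v set \<Rightarrow> 'v set set" where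
  "components E D = {C. C \<subseteq> D \<and> joined E C \<and> (\<forall>a\<in>C. \<forall>b\<in>D - C. \<not> E a b)}"

lemma components_disjoint:
  assumes "C \<in> components E D" "C' \<in> components E D" "C \<inter> C' \<noteq> {}"
  shows "C = C'"
proof -
  have sub: "C1 \<subseteq> C2" if C1: "C1 \<in> components E D" and C2: "C2 \<in> components E D" and "C1 \<inter> C2 \<noteq> {}" for C1 C2
  proof (rule ccontr)
    assume "\<not> C1 \<subseteq> C2"
    then have "C1 \<inter> C2 \<subseteq> C1" "C1 \<inter> C2 \<noteq> C1" by auto
    moreover have "joined E C1" using C1 by (simp add: components_def)
    ultimately have "\<exists>a\<in>C1 \<inter> C2. \<exists>b\<in>C1 - C1 \<inter> C2. E a b"
      using \<open>C1 \<inter> C2 \<noteq> {}\<close> by (simp add: joined_def)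
    then obtain a b where "a \<in> C1 \<inter> C2" "b \<in> C1 - C1 \<inter> C2" "E a b" by blast
    then show False using C1 C2 unfolding components_def by blast
  qed
  show ?thesis using sub[OF assms] sub[OF assms(2,1)] assms(3) by blast
qed

text \<open>
  The component of \<open>v\<close> is the least subset of \<open>D\<close> that contains \<open>v\<close> and that no edge leaves
  within \<open>D\<close>.
\<close>

lemma components_cover:
  assumes "symp E"
  shows "\<Union>(components E D) = D"
proof (intro subset_antisym subsetI)
  fix v assume v: "v \<in> D"
  define C where "C = \<Inter>{S. S \<subseteq> D \<and> v \<in> S \<and> (\<forall>a\<in>S. \<forall>b\<in>D - S. \<not> E a b)}"
  have D: "D \<in> {S. S \<subseteq> D \<and> v \<in> S \<and> (\<forall>a\<in>S. \<forall>b\<in>D - S. \<not> E a b)}" using v by auto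
  have C: "C \<subseteq> D" "v \<in> C" "\<forall>a\<in>C. \<forall>b\<in>D - C. \<not> E a b"
    using D unfolding C_def by blast+
  have min: "C \<subseteq> S" if "S \<subseteq> D" "v \<in> S" "\<forall>a\<in>S. \<forall>b\<in>D - S. \<not> E a b" for S
    using that unfolding C_def by blast
  have "joined E C"
    unfolding joined_def
  proof (intro conjI allI impI)
    show "C \<noteq> {}" using C by auto
    fix S assume S: "S \<subseteq> C" "S \<noteq> {}" "S \<noteq> C"
    show "\<exists>a\<in>S. \<exists>b\<in>C - S. E a b"
    proof (rule ccontr)
      assume no: "\<not> ?thesis"
      show False
      \<comment> \<open>A part of \<open>C\<close> without an edge to the rest of \<open>C\<close> has no edge to the rest of \<open>D\<close> either, and
          the same holds for its complement in \<open>C\<close>; one of the two contains \<open>v\<close>.\<close>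
      proof (cases "v \<in> S")
        case True
        have "C \<subseteq> S" using True S C no by (intro min) blast+
        then show False using S by blast
      next
        case False
        have "C \<subseteq> C - S" using False S C no \<open>symp E\<close> by (intro min) (auto dest: sympD)
        then show False using S by blast
      qed
    qed
  qed
  then show "v \<in> \<Union>(components E D)" using C by (auto simp: components_def)
qed (auto simp: components_def)

text \<open>
  Each new vertex of a growing connected part brings a new edge.
\<close>

lemma joined_edges:
  fixes C :: "'v::finite set"
  assumes C: "joined E C" and pq: "C = p \<union> q"
    and indep: "\<And>u v. u \<in> p \<Longrightarrow> v \<in> p \<Longrightarrow> \<not> E u v" "\<And>u v. u \<in> q \<Longrightarrow> v \<in> q \<Longrightarrow> \<not> E u v"
    and sym: "symp E"
  shows "card C \<le> Suc (card {(a, b). a \<in> p \<and> b \<in> q \<and> E a b})"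
proof -
  define e where "e S = {(a, b). a \<in> p \<inter> S \<and> b \<in> q \<inter> S \<and> E a b}" for S
  have fin: "finite (e S)" for S by (rule finite_subset[of _ "UNIV \<times> UNIV"]) auto
  have "\<exists>S\<subseteq>C. card S = Suc k \<and> k \<le> card (e S)" if "Suc k \<le> card C" for k
    using that
  proof (induction k)
    case 0
    obtain v where "v \<in> C" using C by (auto simp: joined_def)
    then show ?case by (intro exI[of _ "{v}"]) auto
  next
    case (Suc k)
    then obtain S where S: "S \<subseteq> C" "card S = Suc k" "k \<le> card (e S)" by auto
    have "S \<noteq> {}" "S \<noteq> C" using S Suc.prems by auto
    then obtain a b where ab: "a \<in> S" "b \<in> C - S" "E a b" using C S unfolding joined_def by blast
    define x where "x = (if a \<in> p then (a, b) else (b, a))"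
    have x: "x \<in> e (insert b S)" "x \<notin> e S"
      using ab S pq indep sym by (auto simp: x_def e_def dest: sympD)
    have "insert x (e S) \<subseteq> e (insert b S)" using x by (auto simp: e_def)
    then have "card (insert x (e S)) \<le> card (e (insert b S))" by (intro card_mono fin)
    then have "Suc k \<le> card (e (insert b S))" using x fin S by simp
    moreover have "card (insert b S) = Suc (Suc k)" using ab S by simp
    ultimately show ?case using ab S by (intro exI[of _ "insert b S"]) auto
  qed
  note grow = this
  have "card C > 0" using C by (auto simp: joined_def card_gt_0_iff)
  then obtain S where S: "S \<subseteq> C" "card S = card C" "card C - 1 \<le> card (e S)"
    using grow[of "card C - 1"] by auto
  have "S = C" using S by (simp add: card_subset_eq)
  moreover have "e C = {(a, b). a \<in> p \<and> b \<in> q \<and> E a b}" using pq by (auto simp: e_def)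
  ultimately show ?thesis using S by simp
qed

text \<open>
  A vertex of \<open>q\<close> with three neighbours in the independent set \<open>p\<close> would be the centre of a claw,
  so there are at most \<open>2|q|\<close> edges; connectedness requires at least \<open>|p| + |q| - 1\<close>.
\<close>

lemma joined_bipartite_balance:
  fixes p q :: "'v::finite set"
  assumes cf: "claw_free E" and sym: "symp E"
    and J: "joined E (p \<union> q)" and disj: "p \<inter> q = {}"
    and indep: "\<And>u v. u \<in> p \<Longrightarrow> v \<in> p \<Longrightarrow> \<not> E u v" "\<And>u v. u \<in> q \<Longrightarrow> v \<in> q \<Longrightarrow> \<not> E u v"
  shows "card p \<le> Suc (card q)"
proof -
  have two: "card {a\<in>p. E a b} \<le> 2" if b: "b \<in> q" for b
  proof (rule ccontr)
    assume "\<not> ?thesis"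
    then have "3 \<le> card {a\<in>p. E a b}" by simp
    then obtain T where T: "T \<subseteq> {a\<in>p. E a b}" "card T = 3"
      by (meson obtain_subset_with_card_n)
    then obtain x y z where "T = {x, y, z}" "x \<noteq> y" "y \<noteq> z" "x \<noteq> z"
      by (auto simp: card_3_iff)
    then have "distinct [b, x, y, z] \<and> E b x \<and> E b y \<and> E b z \<and> \<not> E x y \<and> \<not> E x z \<and> \<not> E y z"
      using T b disj indep sym by (auto dest: sympD)
    then show False using cf unfolding claw_free_def by blast
  qed
  have "{(a, b). a \<in> p \<and> b \<in> q \<and> E a b} = (\<Union>b\<in>q. (\<lambda>a. (a, b)) ` {a\<in>p. E a b})" by auto
  then have "card {(a, b). a \<in> p \<and> b \<in> q \<and> E a b} \<le> (\<Sum>b\<in>q. card ((\<lambda>a. (a, b)) ` {a\<in>p. E a b}))"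
    by (simp add: card_UN_le)
  also have "\<dots> \<le> (\<Sum>b\<in>q. 2)"
    by (intro sum_mono order_trans[OF card_image_le two]) auto
  finally have "card (p \<union> q) \<le> Suc (2 * card q)"
    using joined_edges[OF J refl indep sym] by simp
  moreover have "card (p \<union> q) = card p + card q" using disj by (simp add: card_Un_disjoint)
  ultimately show ?thesis by simp
qed


text \<open>
  The pairs of sets that two independent sets can cut out of one connected component of their
  symmetric difference.
\<close>

definition joined_pairs :: "('v \<Rightarrow> 'v \<Rightarrow> bool) \<Rightarrow> 'v set \<Rightarrow> ('v set \<times> 'v set) set" where
  "joined_pairs E A = {(p, q) \<in> indep_sets E A \<times> indep_sets E A. p \<inter> q = {} \<and> joined E (p \<union> q)}"

lemma card_diff_components:
  fixes s t :: "'v::finite set"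
  assumes "symp E"
  defines "D \<equiv> (s - t) \<union> (t - s)"
  shows "of_nat (card s) - of_nat (card t)
       = (\<Sum>C\<in>components E D. of_nat (card (s \<inter> C)) - of_nat (card (t \<inter> C)) :: 'a::comm_ring_1)"
proof -
  have fin: "finite (components E D)" by simp
  have part: "card (r \<inter> D) = (\<Sum>C\<in>components E D. card (r \<inter> C))" for r
  proof -
    have eq: "r \<inter> D = (\<Union>C\<in>components E D. r \<inter> C)" using components_cover[OF assms(1), of D] by blast
    show ?thesis
      unfolding eq using components_disjoint[of _ E D] by (intro card_UN_disjoint) (simp, simp, blast)
  qed
  have "s = (s \<inter> D) \<union> (s \<inter> t)" "t = (t \<inter> D) \<union> (s \<inter> t)" by (auto simp: D_def)
  moreover have "card (s \<inter> D \<union> s \<inter> t) = card (s \<inter> D) + card (s \<inter> t)"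
    "card (t \<inter> D \<union> s \<inter> t) = card (t \<inter> D) + card (s \<inter> t)"
    by (rule card_Un_disjoint; auto simp: D_def)+
  ultimately have "card s = card (s \<inter> D) + card (s \<inter> t)" "card t = card (t \<inter> D) + card (s \<inter> t)"
    by simp_all
  then have "of_nat (card s) - of_nat (card t) = (of_nat (card (s \<inter> D)) - of_nat (card (t \<inter> D)) :: 'a)"
    by simp
  then show ?thesis unfolding part by (simp add: sum_subtractf)
qed

text \<open>
  The weight \<open>|s| - |t|\<close> is the sum of the contributions of the components \<open>C\<close> of the symmetric
  difference of \<open>s\<close> and \<open>t\<close>.  For a fixed component, with \<open>p\<close> and \<open>q\<close> its intersections with \<open>s\<close> and
  \<open>t\<close>, what remains of \<open>s\<close> and \<open>t\<close> is an arbitrary pair of independent sets outside the closed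
  neighbourhood of \<open>C\<close>.
\<close>

lemma indep_pair_sum_by_components:
  fixes E :: "'v::finite \<Rightarrow> 'v \<Rightarrow> bool" and A :: "'v set" and x y :: "'a::comm_ring_1"
  assumes sym: "symp E"
  defines "R \<equiv> \<lambda>p q. A - closed_nbhd E (p \<union> q)"
  shows "(\<Sum>(s, t)\<in>indep_sets E A \<times> indep_sets E A.
            (of_nat (card s) - of_nat (card t)) * (x ^ card s * y ^ card t))
       = (\<Sum>(p, q)\<in>joined_pairs E A. (of_nat (card p) - of_nat (card q)) * (x ^ card p * y ^ card q)
            * (indep_poly E (R p q) x * indep_poly E (R p q) y))"
proof -
  define I where "I = indep_sets E A"
  define S1 where "S1 = Sigma (I \<times> I) (\<lambda>(s, t). components E ((s - t) \<union> (t - s)))"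
  define S2 where "S2 = Sigma (joined_pairs E A)
      (\<lambda>(p, q). indep_sets E (R p q) \<times> indep_sets E (R p q))"
  define w where "w = (\<lambda>((p :: 'v set, q :: 'v set), (s :: 'v set, t :: 'v set)). (of_nat (card p) - of_nat (card q)) * (x ^ card p * y ^ card q)
      * (x ^ card s * y ^ card t) :: 'a)"
  define w' where "w' = (\<lambda>((s :: 'v set, t :: 'v set), C).
      (of_nat (card (s \<inter> C)) - of_nat (card (t \<inter> C))) * (x ^ card s * y ^ card t) :: 'a)"
  define i where "i = (\<lambda>((p :: 'v set, q :: 'v set), (s, t)). ((p \<union> s, q \<union> t), p \<union> q))"
  define j where "j = (\<lambda>((s :: 'v set, t :: 'v set), C). ((s \<inter> C, t \<inter> C), (s - C, t - C)))"
  have "(\<Sum>(s, t)\<in>I \<times> I. (of_nat (card s) - of_nat (card t)) * (x ^ card s * y ^ card t))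
      = (\<Sum>st\<in>I \<times> I. \<Sum>C\<in>components E ((fst st - snd st) \<union> (snd st - fst st)).
          (of_nat (card (fst st \<inter> C)) - of_nat (card (snd st \<inter> C))) * (x ^ card (fst st) * y ^ card (snd st)))"
  proof (rule sum.cong)
    fix st assume "st \<in> I \<times> I"
    show "(case st of (s, t) \<Rightarrow> (of_nat (card s) - of_nat (card t)) * (x ^ card s * y ^ card t)) =
      (\<Sum>C\<in>components E ((fst st - snd st) \<union> (snd st - fst st)).
          (of_nat (card (fst st \<inter> C)) - of_nat (card (snd st \<inter> C))) * (x ^ card (fst st) * y ^ card (snd st)))"
      unfolding sum_distrib_right[symmetric] card_diff_components[OF sym, of "fst st" "snd st", symmetric]
      by (simp add: case_prod_unfold)
  qed simp
  also have "\<dots> = sum w' S1"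
    unfolding S1_def w'_def by (subst sum.Sigma) (auto simp: I_def case_prod_unfold)
  also have "\<dots> = sum w S2"
  proof (rule sum.reindex_bij_witness[where i = i and j = j])
    fix a assume "a \<in> S1"
    then obtain s t C where a: "a = ((s, t), C)" and s: "s \<in> I" and t: "t \<in> I"
      and C: "C \<in> components E ((s - t) \<union> (t - s))"
      by (auto simp: S1_def)
    have CD: "C \<subseteq> (s - t) \<union> (t - s)" and J: "joined E C"
      and out: "\<And>a b. a \<in> C \<Longrightarrow> b \<in> (s - t) \<union> (t - s) - C \<Longrightarrow> \<not> E a b"
      using C by (auto simp: components_def)
    have un: "s \<inter> C \<union> t \<inter> C = C" using CD by auto
    show "i (j a) = a" using un by (auto simp: a i_def j_def)
    have ind: "\<And>u v. u \<in> s \<Longrightarrow> v \<in> s \<Longrightarrow> \<not> E u v" "\<And>u v. u \<in> t \<Longrightarrow> v \<in> t \<Longrightarrow> \<not> E u v"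
      "s \<subseteq> A" "t \<subseteq> A"
      using s t by (auto simp: I_def indep_sets_def)
    \<comment> \<open>A common element of \<open>s\<close> and \<open>t\<close> has no neighbour in either set; any other element of
        \<open>s \<union> t\<close> outside \<open>C\<close> is separated from \<open>C\<close> because \<open>C\<close> is a component.\<close>
    have away: "\<not> E c u" if cu: "c \<in> C" "u \<in> s \<union> t" "u \<notin> C" for c u
    proof
      assume "E c u"
      consider "c \<in> s" "u \<in> s" | "c \<in> t" "u \<in> t" | "u \<in> (s - t) \<union> (t - s)"
        using cu CD by blast
      then show False using ind out[OF \<open>c \<in> C\<close>] \<open>E c u\<close> cu by cases auto
    qed
    show "j a \<in> S2"
      using away ind J un CD
      by (auto simp: a j_def S2_def joined_pairs_def indep_sets_def R_def closed_nbhd_def)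
    have "card s = card (s \<inter> C) + card (s - C)" "card t = card (t \<inter> C) + card (t - C)"
      by (metis card_Int_Diff finite)+
    then show "w (j a) = w' a"
      by (simp add: a j_def w_def w'_def power_add algebra_simps)
  next
    fix b assume "b \<in> S2"
    then obtain p q s t where b: "b = ((p, q), (s, t))" and K: "(p, q) \<in> joined_pairs E A"
      and s: "s \<in> indep_sets E (R p q)" and t: "t \<in> indep_sets E (R p q)"
      by (auto simp: S2_def)
    have pq: "p \<subseteq> A" "q \<subseteq> A" "p \<inter> q = {}" "joined E (p \<union> q)"
      "\<And>u v. u \<in> p \<Longrightarrow> v \<in> p \<Longrightarrow> \<not> E u v" "\<And>u v. u \<in> q \<Longrightarrow> v \<in> q \<Longrightarrow> \<not> E u v"
      using K by (auto simp: joined_pairs_def indep_sets_def)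
    have st: "s \<subseteq> A" "t \<subseteq> A" "s \<inter> (p \<union> q) = {}" "t \<inter> (p \<union> q) = {}"
      "\<And>u v. u \<in> s \<Longrightarrow> v \<in> s \<Longrightarrow> \<not> E u v" "\<And>u v. u \<in> t \<Longrightarrow> v \<in> t \<Longrightarrow> \<not> E u v"
      "\<And>c u. c \<in> p \<union> q \<Longrightarrow> u \<in> s \<union> t \<Longrightarrow> \<not> E c u"
      using s t by (auto simp: indep_sets_def R_def closed_nbhd_def)
    have st': "\<And>c u. c \<in> p \<union> q \<Longrightarrow> u \<in> s \<union> t \<Longrightarrow> \<not> E u c"
      using st(7) sym by (meson sympD)
    show "j (i b) = b" using pq(3) st(3,4) by (auto simp: b i_def j_def)
    have "p \<union> s \<in> I" "q \<union> t \<in> I"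
      using pq st st' by (auto simp: I_def indep_sets_def)
    moreover have "p \<union> q \<in> components E ((p \<union> s - (q \<union> t)) \<union> (q \<union> t - (p \<union> s)))"
      using pq(3,4) st(3,4,7) by (auto simp: components_def)
    ultimately show "i b \<in> S1"
      by (simp add: b i_def S1_def)
  qed
  also have "\<dots> = (\<Sum>(p, q)\<in>joined_pairs E A. (of_nat (card p) - of_nat (card q)) * (x ^ card p * y ^ card q)
            * (indep_poly E (R p q) x * indep_poly E (R p q) y))"
  proof -
    have "sum w S2 = (\<Sum>k\<in>joined_pairs E A.
        \<Sum>st\<in>indep_sets E (R (fst k) (snd k)) \<times> indep_sets E (R (fst k) (snd k)). w (k, st))"
      unfolding S2_def by (subst sum.Sigma) (auto simp: case_prod_unfold)
    also have "\<dots> = (\<Sum>(p, q)\<in>joined_pairs E A. (of_nat (card p) - of_nat (card q)) * (x ^ card p * y ^ card q)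
            * (indep_poly E (R p q) x * indep_poly E (R p q) y))"
    proof (rule sum.cong)
      fix k assume "k \<in> joined_pairs E A"
      obtain p q where k: "k = (p, q)" by (cases k)
      show "(\<Sum>st\<in>indep_sets E (R (fst k) (snd k)) \<times> indep_sets E (R (fst k) (snd k)). w (k, st))
          = (case k of (p, q) \<Rightarrow> (of_nat (card p) - of_nat (card q)) * (x ^ card p * y ^ card q)
              * (indep_poly E (R p q) x * indep_poly E (R p q) y))"
        unfolding k fst_conv snd_conv prod.case indep_poly_def sum_product sum.cartesian_product
        unfolding sum_distrib_left
        by (rule sum.cong) (auto simp: w_def)
    qed simp
    finally show ?thesis .
  qed
  finally show ?thesis by (simp add: I_def)
qed

text \<open>
  Pairing \<open>(p, q)\<close> with \<open>(q, p)\<close>, which is the reason for the factor \<open>2\<close>, combines the monomials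
  \<open>x^|p| y^|q|\<close> and \<open>x^|q| y^|p|\<close> with opposite signs.  By the balance of connected bipartite parts
  the two exponents differ by at most one, so that the difference is \<open>x - y\<close> times a power of \<open>xy\<close>.
  The sum on the left is \<open>x f'(x) f(y) - y f'(y) f(x)\<close> for the independence polynomial \<open>f\<close>.
\<close>

lemma claw_free_christoffel_darboux:
  fixes E :: "'v::finite \<Rightarrow> 'v \<Rightarrow> bool" and A :: "'v set" and x y :: complex
  assumes sym: "symp E" and cf: "claw_free E"
  defines "R \<equiv> \<lambda>p q. A - closed_nbhd E (p \<union> q)"
  shows "2 * (\<Sum>(s, t)\<in>indep_sets E A \<times> indep_sets E A.
            (of_nat (card s) - of_nat (card t)) * (x ^ card s * y ^ card t))
       = (x - y) * (\<Sum>(p, q)\<in>{(p, q) \<in> joined_pairs E A. card p \<noteq> card q}.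
            (x * y) ^ min (card p) (card q) * (indep_poly E (R p q) x * indep_poly E (R p q) y))"
proof -
  define g where "g p q = indep_poly E (R p q) x * indep_poly E (R p q) y" for p q
  define w where "w p q = (of_nat (card p) - of_nat (card q)) * (x ^ card p * y ^ card q) * g p q" for p q
  have gsym: "g q p = g p q" for p q by (simp add: g_def R_def Un_commute)
  have "(\<Sum>(p, q)\<in>joined_pairs E A. w p q) = (\<Sum>(p, q)\<in>joined_pairs E A. w q p)"
    by (rule sum.reindex_bij_witness[where i = "\<lambda>(a, b). (b, a)" and j = "\<lambda>(a, b). (b, a)"])
       (auto simp: joined_pairs_def Un_commute Int_commute)
  then have "2 * (\<Sum>(p, q)\<in>joined_pairs E A. w p q) = (\<Sum>(p, q)\<in>joined_pairs E A. w p q + w q p)"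
    by (simp add: case_prod_unfold sum.distrib)
  also have "\<dots> = (\<Sum>(p, q)\<in>joined_pairs E A. if card p \<noteq> card q
      then (x - y) * ((x * y) ^ min (card p) (card q) * g p q) else 0)"
  proof (rule sum.cong, safe)
    fix p q assume "(p, q) \<in> joined_pairs E A"
    then have "card p \<le> Suc (card q)" "card q \<le> Suc (card p)"
      using joined_bipartite_balance[OF cf sym, of p q] joined_bipartite_balance[OF cf sym, of q p]
      by (auto simp: joined_pairs_def indep_sets_def Un_commute Int_commute)
    then consider "card p = card q" | "card p = Suc (card q)" | "card q = Suc (card p)" by linarith
    then show "w p q + w q p = (if card p \<noteq> card q
      then (x - y) * ((x * y) ^ min (card p) (card q) * g p q) else 0)"
      unfolding w_def gsym[of p q] by cases (simp_all add: algebra_simps power_mult_distrib)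
  qed
  also have "\<dots> = (x - y) * (\<Sum>(p, q)\<in>{(p, q) \<in> joined_pairs E A. card p \<noteq> card q}.
            (x * y) ^ min (card p) (card q) * g p q)"
    unfolding sum_distrib_left
    by (rule sum.mono_neutral_cong_right) (auto split: if_splits)
  finally show ?thesis
    by (simp add: indep_pair_sum_by_components[OF sym] w_def g_def R_def)
qed

text \<open>
  For a zero \<open>x\<close> and \<open>y\<close> its conjugate, the left-hand side of the identity above vanishes, while the
  summands on its right-hand side are nonnegative.  If \<open>x\<close> is not real, all of them vanish; the
  summand of a one-vertex component \<open>v\<close> shows that \<open>x\<close> is a zero of the polynomial of the graph
  without the closed neighbourhood of \<open>v\<close>, which is claw-free and smaller.
\<close>

theorem claw_free_real_rooted:
  fixes E :: "'v::finite \<Rightarrow> 'v \<Rightarrow> bool" and x :: complex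
  assumes sym: "symp E" and irr: "irreflp E" and cf: "claw_free E" and root: "indep_poly E A x = 0"
  shows "x \<in> \<real>"
  using root
proof (induction "card A" arbitrary: A rule: less_induct)
  case less
  have "A \<noteq> {}" using less.prems by auto
  then obtain v where v: "v \<in> A" by blast
  define R where "R = (\<lambda>p q. A - closed_nbhd E (p \<union> q))"
  have cnj: "indep_poly E B (cnj x) = cnj (indep_poly E B x)" for B
    by (simp add: indep_poly_def)
  define g where "g = (\<lambda>(p, q). (norm x)\<^sup>2 ^ min (card p) (card q) * (norm (indep_poly E (R p q) x))\<^sup>2)"
  define K where "K = {(p, q) \<in> joined_pairs E A. card p \<noteq> card q}"
  show ?case
  proof (rule ccontr)
    assume nr: "x \<notin> \<real>"
    have "(\<Sum>(s, t)\<in>indep_sets E A \<times> indep_sets E A. of_nat (card s) * (x ^ card s * cnj x ^ card t))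
        = (\<Sum>s\<in>indep_sets E A. of_nat (card s) * x ^ card s) * indep_poly E A (cnj x)"
      "(\<Sum>(s, t)\<in>indep_sets E A \<times> indep_sets E A. of_nat (card t) * (x ^ card s * cnj x ^ card t))
        = indep_poly E A x * (\<Sum>t\<in>indep_sets E A. of_nat (card t) * cnj x ^ card t)"
      unfolding indep_poly_def sum_product sum.cartesian_product by (auto intro!: sum.cong)
    then have "0 = (\<Sum>(s, t)\<in>indep_sets E A \<times> indep_sets E A.
            (of_nat (card s) - of_nat (card t)) * (x ^ card s * cnj x ^ card t))"
      unfolding left_diff_distrib case_prod_unfold sum_subtractf using less.prems by (simp add: cnj)
    then have "(x - cnj x) * (\<Sum>(p, q)\<in>K.
        (x * cnj x) ^ min (card p) (card q) * (indep_poly E (R p q) x * indep_poly E (R p q) (cnj x))) = 0"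
      using claw_free_christoffel_darboux[OF sym cf, where A = A and x = x and y = "cnj x"]
      unfolding R_def K_def by simp
    moreover have "x - cnj x \<noteq> 0" using nr by (metis Reals_cnj_iff eq_iff_diff_eq_0)
    ultimately have "0 = (\<Sum>(p, q)\<in>K.
        (x * cnj x) ^ min (card p) (card q) * (indep_poly E (R p q) x * indep_poly E (R p q) (cnj x)))"
      by simp
    also have "\<dots> = (\<Sum>k\<in>K. complex_of_real (g k))"
      by (rule sum.cong) (auto simp: g_def cnj complex_norm_square[symmetric])
    finally have "sum g K = 0" by (metis of_real_sum of_real_eq_0_iff)
    moreover have "finite K" "\<And>k. k \<in> K \<Longrightarrow> g k \<ge> 0" by (auto simp: g_def)
    ultimately have zero: "\<And>k. k \<in> K \<Longrightarrow> g k = 0" by (simp add: sum_nonneg_eq_0_iff)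
    have "({v}, {}) \<in> K" using v irr
      by (auto simp: irreflp_def K_def joined_pairs_def indep_sets_def joined_def)
    then have "indep_poly E (R {v} {}) x = 0" using zero by (force simp: g_def)
    moreover have "card (R {v} {}) < card A"
      using v by (intro psubset_card_mono) (auto simp: R_def closed_nbhd_def)
    ultimately show False using less.hyps nr by blast
  qed
qed

section \<open>The linear factors of the independence polynomial\<close>

lemma poly_negative_roots_factorization:
  fixes p :: "complex poly"
  assumes "poly p 0 = 1" and "\<And>z. poly p z = 0 \<Longrightarrow> z \<in> \<real> \<and> Re z < 0"
  shows "\<exists>as. (\<forall>a\<in>set as. a > 0) \<and> p = (\<Prod>a\<leftarrow>as. [:1, complex_of_real a:])"
  using assms
proof (induction "degree p" arbitrary: p rule: less_induct)
  case less
  show ?case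
  proof (cases "degree p = 0")
    case True
    then obtain c where "p = [:c:]" by (metis degree_eq_zeroE)
    then have "p = 1" using less.prems(1) by simp
    then show ?thesis by (intro exI[of _ "[]"]) simp
  next
    case False
    then have "\<not> constant (poly p)" by (simp add: constant_degree)
    then obtain z where z: "poly p z = 0" using fundamental_theorem_of_algebra by blast
    then have zr: "z \<in> \<real>" "Re z < 0" using less.prems(2) by auto
    define r where "r = Re z"
    have zr': "z = of_real r" "r < 0" using zr by (auto simp: r_def)
    obtain q0 where "p = [:- z, 1:] * q0" using z by (metis dvd_def poly_eq_0_iff_dvd)
    moreover define q where "q = smult (- z) q0"
    ultimately have p: "p = [:1, complex_of_real (- 1 / r):] * q"
      using zr' by (simp add: smult_add_right field_simps)
    have "q \<noteq> 0" using p less.prems(1) by auto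
    then have "degree p = Suc (degree q)"
      using zr' unfolding p by (subst degree_mult_eq) auto
    moreover have "poly q 0 = 1" using less.prems(1) unfolding p by simp
    moreover have "poly p w = 0" if "poly q w = 0" for w using that by (simp add: p)
    ultimately obtain as where "\<forall>a\<in>set as. a > 0" "q = (\<Prod>a\<leftarrow>as. [:1, complex_of_real a:])"
      using less.hyps[of q] less.prems(2) by auto
    then show ?thesis using p zr' by (intro exI[of _ "- 1 / r # as"]) (auto simp: divide_neg_neg)
  qed
qed

lemma poly_indep_poly: "poly (indep_poly E A [:0, 1:]) x = indep_poly E A x"
  by (simp add: indep_poly_def poly_sum)

lemma indep_poly_ge_1:
  fixes E :: "'v::finite \<Rightarrow> 'v \<Rightarrow> bool" and x :: real
  assumes "x \<ge> 0"
  shows "indep_poly E A x \<ge> 1"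
proof -
  have "{} \<in> indep_sets E A" by (simp add: indep_sets_def)
  then have "x ^ card ({} :: 'v set) \<le> indep_poly E A x"
    unfolding indep_poly_def using assms by (intro member_le_sum) auto
  then show ?thesis by simp
qed

lemma indep_poly_of_real: "indep_poly E A (of_real x :: complex) = of_real (indep_poly E A x)"
  by (simp add: indep_poly_def)

text \<open>
  The polynomial is at least \<open>1\<close> on nonnegative reals, so its real zeros are negative.
\<close>

theorem claw_free_factorization:
  fixes E :: "'v::finite \<Rightarrow> 'v \<Rightarrow> bool"
  assumes E: "symp E" "irreflp E" "claw_free E"
  shows "\<exists>as. (\<forall>a\<in>set as. a > 0) \<and> indep_poly E A [:0, 1:] = (\<Prod>a\<leftarrow>as. [:1, a :: real:])"
proof -
  define p where "p = indep_poly E A ([:0, 1:] :: complex poly)"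
  have "z \<in> \<real> \<and> Re z < 0" if "poly p z = 0" for z
  proof -
    have z: "indep_poly E A z = 0" using that by (simp add: p_def poly_indep_poly)
    then have r: "z \<in> \<real>" using claw_free_real_rooted E by blast
    then have "z = of_real (Re z)" by simp
    then have "indep_poly E A (Re z) = 0" using z indep_poly_of_real by (metis of_real_eq_0_iff)
    then have "\<not> Re z \<ge> 0" using indep_poly_ge_1[of "Re z" E A] by force
    then show ?thesis using r by simp
  qed
  moreover have "poly p 0 = 1"
  proof -
    have "indep_poly E A (0 :: complex) = (\<Sum>s\<in>{{} :: 'v set}. 0 ^ card s)"
      unfolding indep_poly_def
      by (rule sum.mono_neutral_right) (auto simp: indep_sets_def)
    then show ?thesis by (simp add: p_def poly_indep_poly)
  qed
  ultimately obtain as where as: "\<forall>a\<in>set as. a > 0" "p = (\<Prod>a\<leftarrow>as. [:1, complex_of_real a:])"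
    using poly_negative_roots_factorization by blast
  have coeff: "coeff (\<Prod>a\<leftarrow>bs. [:1, complex_of_real a:]) n = of_real (coeff (\<Prod>a\<leftarrow>bs. [:1, a:]) n)" for bs n
    by (induction bs arbitrary: n) (auto simp: coeff_pCons split: nat.split)
  have X: "[:0, 1:] ^ k = (monom 1 k :: 'b::comm_ring_1 poly)" for k by (simp add: monom_altdef)
  have "coeff p n = of_real (coeff (indep_poly E A [:0, 1:]) n)" for n
    by (simp add: p_def indep_poly_def coeff_sum X if_distrib[of of_real] cong: if_cong)
  then have "indep_poly E A [:0, 1:] = (\<Prod>a\<leftarrow>as. [:1, a:])"
    unfolding as(2) coeff by (simp add: poly_eq_iff)
  then show ?thesis using as(1) by blast
qed

text \<open>
  The substitution of \<open>-z/(1+z)\<close> for \<open>x\<close> turns \<open>1 + a x\<close> into \<open>(1 - (a - 1) z) / (1 + z)\<close>.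
\<close>

lemma indep_poly_fps_factorization:
  fixes as :: "real list"
  assumes "indep_poly E A [:0, 1:] = (\<Prod>a\<leftarrow>as. [:1, a:])"
  shows "indep_poly E A (- fps_X * inverse (1 + fps_X)) * (1 + fps_X) ^ length as
       = (\<Prod>a\<leftarrow>as. 1 - fps_const (a - 1) * fps_X)"
proof -
  define x :: "real fps" where "x = - fps_X * inverse (1 + fps_X)"
  have x0: "fps_nth x 0 = 0" by (simp add: x_def)
  have unit: "inverse (1 + fps_X) * (1 + fps_X) = (1 :: real fps)"
    by (rule inverse_mult_eq_1) simp
  have X: "[:0, 1:] ^ k = (monom 1 k :: 'b::comm_ring_1 poly)" for k by (simp add: monom_altdef)
  have "indep_poly E A x = fps_of_poly (indep_poly E A [:0, 1:]) oo x"
    by (simp add: indep_poly_def fps_of_poly_sum fps_compose_sum_distrib X fps_of_poly_monom'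
        fps_X_power_compose[OF x0])
  also have "\<dots> = fps_of_poly (\<Prod>a\<leftarrow>as. [:1, a:]) oo x" by (simp add: assms)
  also have "\<dots> = (\<Prod>a\<leftarrow>as. 1 + fps_const a * x)"
  proof (induction as)
    case (Cons a as)
    have "fps_of_poly [:1, a:] = 1 + fps_const a * fps_X" by (simp add: fps_of_poly_pCons)
    then have "fps_of_poly [:1, a:] oo x = 1 + fps_const a * x"
      by (simp only: fps_compose_add_distrib fps_compose_mult_distrib[OF x0] fps_compose_1
          fps_const_compose fps_X_fps_compose_startby0[OF x0])
    then show ?case using Cons by (simp add: fps_of_poly_mult fps_compose_mult_distrib[OF x0] del: mult_pCons_left)
  qed simp
  finally have *: "indep_poly E A x = (\<Prod>a\<leftarrow>as. 1 + fps_const a * x)" .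
  have expand: "(1 + c * (- fps_X * j)) * (1 + fps_X) = 1 + fps_X - c * fps_X * (j * (1 + fps_X))"
    for c j :: "real fps"
    by (simp add: algebra_simps)
  have one: "(1 + fps_const a * x) * (1 + fps_X) = 1 - fps_const (a - 1) * fps_X" for a
  proof -
    have "(1 + fps_const a * x) * (1 + fps_X) = 1 + fps_X - fps_const a * fps_X * (inverse (1 + fps_X) * (1 + fps_X))"
      unfolding x_def by (rule expand)
    also have "\<dots> = 1 - (fps_const a - 1) * fps_X" unfolding unit by (simp add: algebra_simps)
    finally show ?thesis by (simp add: fps_const_sub[symmetric] del: fps_const_sub)
  qed
  have "(\<Prod>a\<leftarrow>bs. 1 + fps_const a * x) * (1 + fps_X) ^ length bs
       = (\<Prod>a\<leftarrow>bs. 1 - fps_const (a - 1) * fps_X)" for bs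
  proof (induction bs)
    case (Cons a bs)
    have "(\<Prod>a\<leftarrow>a # bs. 1 + fps_const a * x) * (1 + fps_X) ^ length (a # bs)
      = ((1 + fps_const a * x) * (1 + fps_X)) * ((\<Prod>a\<leftarrow>bs. 1 + fps_const a * x) * (1 + fps_X) ^ length bs)"
      by (simp only: list.map prod_list.Cons list.size power_Suc add_Suc_right add_0_right mult_ac)
    then show ?case by (simp only: Cons one list.map prod_list.Cons)
  qed simp
  then show ?thesis unfolding * x_def[symmetric] .
qed

text \<open>
  Deleting vertices moves the zero closest to \<open>0\<close> away from \<open>0\<close>.  At the largest zero \<open>r < 0\<close> of the
  polynomial of \<open>A - {v}\<close>, the polynomial of \<open>A\<close> minus the closed neighbourhood of \<open>v\<close> is still
  nonnegative by induction, so the deletion formula gives a value \<open>\<le> 0\<close> for the polynomial of \<open>A\<close>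
  at \<open>r\<close>.
\<close>

lemma indep_poly_pos_subset:
  fixes E :: "'v::finite \<Rightarrow> 'v \<Rightarrow> bool" and l :: real
  assumes E: "symp E" "irreflp E"
    and pos: "\<And>x. l \<le> x \<Longrightarrow> x \<le> 0 \<Longrightarrow> indep_poly E A x > 0" and "B \<subseteq> A"
  shows "l \<le> x \<Longrightarrow> x \<le> 0 \<Longrightarrow> indep_poly E B x > 0"
  using pos \<open>B \<subseteq> A\<close>
proof (induction "card A" arbitrary: A B l x rule: less_induct)
  case less
  show ?case
  proof (cases "B = A")
    case False
    then obtain v where v: "v \<in> A" "B \<subseteq> A - {v}" using less.prems by blast
    define f where "f C y = indep_poly E C y" for C and y :: real
    have cont: "continuous_on UNIV (f C)" for C
      unfolding f_def indep_poly_def by (intro continuous_intros)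
    have smaller: "card (A - {v}) < card A" using v by (intro psubset_card_mono) auto
    have "f (A - {v}) y > 0" if y: "l \<le> y" "y \<le> 0" for y
    proof (rule ccontr)
      assume neg: "\<not> ?thesis"
      define Z where "Z = {y..0} \<inter> {z. f (A - {v}) z \<le> 0}"
      have "closed {z. f (A - {v}) z \<le> 0}"
        using cont by (intro closed_Collect_le) auto
      then have "compact Z" unfolding Z_def by (intro compact_Int_closed) auto
      moreover have "y \<in> Z" using neg y by (auto simp: Z_def)
      ultimately obtain r where r: "r \<in> Z" and max: "\<And>z. z \<in> Z \<Longrightarrow> z \<le> r"
        using compact_attains_sup[of Z] by blast
      have "f (A - {v}) 0 > 0" using indep_poly_ge_1[of 0 E "A - {v}"] by (simp add: f_def)
      moreover have "r \<le> 0" "f (A - {v}) r \<le> 0" using r by (simp_all add: Z_def)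
      ultimately have r0: "r < 0" by (cases "r = 0") auto
      have "f (A - closed_nbhd E {v}) t \<ge> 0" if t: "r < t" "t \<le> 0" for t
      proof -
        have "f (A - {v}) z > 0" if "t \<le> z" "z \<le> 0" for z
          using max[of z] r t that by (force simp: Z_def)
        moreover have "A - closed_nbhd E {v} \<subseteq> A - {v}" by (auto simp: closed_nbhd_def)
        ultimately show ?thesis
          using less.hyps[OF smaller, of t t "A - closed_nbhd E {v}"] t by (force simp: f_def)
      qed
      then have "eventually (\<lambda>t. f (A - closed_nbhd E {v}) t \<ge> 0) (at_right r)"
        using r0 by (auto simp: eventually_at_right_field intro!: exI[of _ 0])
      moreover have "(f (A - closed_nbhd E {v}) \<longlongrightarrow> f (A - closed_nbhd E {v}) r) (at_right r)"
        using cont[of "A - closed_nbhd E {v}"]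
        by (auto simp: continuous_on_eq_continuous_at isCont_def intro: filterlim_at_split[THEN iffD1, THEN conjunct2])
      ultimately have "f (A - closed_nbhd E {v}) r \<ge> 0"
        by (intro tendsto_lowerbound) (auto simp: trivial_limit_at_right_real)
      then have "r * f (A - closed_nbhd E {v}) r \<le> 0" using r0 by (simp add: mult_le_0_iff)
      moreover have "f A r = f (A - {v}) r + r * f (A - closed_nbhd E {v}) r"
        unfolding f_def by (rule indep_poly_remove[OF E v(1)])
      ultimately have "f A r \<le> 0" using r by (simp add: Z_def)
      moreover have "f A r > 0" using less.prems(3)[of r] r y by (auto simp: f_def Z_def)
      ultimately show False by simp
    qed
    then show ?thesis using less.hyps[OF smaller _ _ _ v(2)] less.prems(1,2) by (auto simp: f_def)
  qed (use less.prems in auto)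
qed

text \<open>
  The two neighbours and \<open>v\<close> induce a triangle or a path, whose polynomials \<open>1 + 3x\<close> and
  \<open>1 + 3x + x^2\<close> are negative at \<open>-2/5\<close>.  Hence the polynomial of the whole graph is not positive
  throughout the interval from \<open>-2/5\<close> to \<open>0\<close>.
\<close>

lemma large_root_of_two_neighbours:
  fixes E :: "'v::finite \<Rightarrow> 'v \<Rightarrow> bool" and as :: "real list"
  assumes E: "symp E" "irreflp E"
    and fac: "indep_poly E UNIV [:0, 1:] = (\<Prod>a\<leftarrow>as. [:1, a:])"
    and v: "E v b" "E v c" "b \<noteq> c"
  shows "\<exists>a\<in>set as. a \<ge> 5/2"
proof (rule ccontr)
  assume "\<not> ?thesis"
  then have small: "\<And>a. a \<in> set as \<Longrightarrow> a < 5/2" by force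
  have "indep_poly E UNIV x > 0" if x: "-2/5 \<le> x" "x \<le> 0" for x :: real
  proof -
    have "1 + a * x > 0" if "a \<in> set as" for a
    proof (cases "a \<le> 0 \<or> x = 0")
      case True
      then show ?thesis using x by (auto simp: mult_nonpos_nonpos add_pos_nonneg)
    next
      case False
      then have "a * x > 5/2 * x" using small[OF that] x by (intro mult_strict_right_mono_neg) auto
      then show ?thesis using x by simp
    qed
    then have "0 < (\<Prod>a\<leftarrow>as. 1 + a * x)" by (induction as) auto
    also have "(\<Prod>a\<leftarrow>as. 1 + a * x) = poly (\<Prod>a\<leftarrow>as. [:1, a:]) x"
      by (induction as) (auto simp: algebra_simps)
    finally show ?thesis by (simp add: fac[symmetric] poly_indep_poly)
  qed
  then have pos: "indep_poly E {v, b, c} (-2/5 :: real) > 0"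
    using indep_poly_pos_subset[OF E, of "-2/5" UNIV "{v, b, c}" "-2/5"] by auto
  have ne: "v \<noteq> b" "v \<noteq> c" using v E by (auto simp: irreflp_def)
  have "{v, b, c} - {v} = {b, c}" "{v, b, c} - closed_nbhd E {v} = {}"
    "{b, c} - {b} = {c}" "{c} - {c} = {}" "{c} - closed_nbhd E {c} = {}"
    "{b, c} - closed_nbhd E {b} = (if E b c then {} else {c})"
    using v ne E by (auto simp: closed_nbhd_def irreflp_def)
  then have "indep_poly E {v, b, c} (-2/5 :: real) = (if E b c then -1/5 else -1/25)"
    using indep_poly_remove[OF E, of v "{v, b, c}" "-2/5 :: real"]
      indep_poly_remove[OF E, of b "{b, c}" "-2/5 :: real"]
      indep_poly_remove[OF E, of c "{c}" "-2/5 :: real"] by (auto split: if_splits)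
  then show False using pos by (auto split: if_splits)
qed

section \<open>Deviations of a power series and their growth\<close>

text \<open>
  The proper divisors of \<open>n\<close> are at most \<open>n/2\<close>, so their total contribution is of order \<open>\<rho>^(n/2)\<close>
  up to a polynomial factor.  This needs the a priori bound \<open>|t\<^sub>n| \<le> C n \<rho>^n\<close>, which goes through
  by induction because \<open>k \<rho>^k \<le> \<rho>^n\<close> for \<open>k \<le> n/2\<close>; here \<open>\<rho> \<ge> 3/2\<close> ensures \<open>k \<le> \<rho>^k\<close>.
\<close>

lemma divisor_sum_inversion_limit:
  fixes t :: "nat \<Rightarrow> real"
  assumes s: "\<And>n. n > 0 \<Longrightarrow> (\<Sum>k | k dvd n. (-1) ^ (n - k) * t k) = s n"
    and \<rho>: "\<rho> \<ge> 3/2" and lim: "(\<lambda>n. s n / \<rho> ^ n) \<longlonglongrightarrow> b"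
  shows "(\<lambda>n. t n / \<rho> ^ n) \<longlonglongrightarrow> b"
proof -
  define r where "r n = (\<Sum>k | k dvd n \<and> k \<noteq> n. (-1) ^ (n - k) * t k)" for n
  have t: "t n = s n - r n" if "n > 0" for n
  proof -
    have "{k. k dvd n} = insert n {k. k dvd n \<and> k \<noteq> n}" by auto
    moreover have "finite {k. k dvd n \<and> k \<noteq> n}" using that by simp
    ultimately show ?thesis using s[OF that] by (simp add: r_def)
  qed
  have sub: "{k. k dvd n \<and> k \<noteq> n} \<subseteq> {1..n div 2}" if n: "n > 0" for n :: nat
  proof safe
    fix k assume k: "k dvd n" "k \<noteq> n"
    then obtain j where j: "n = k * j" by auto
    then have "j \<ge> 2" using n k by (cases j; cases "j - 1") auto
    then have "k * 2 \<le> n" using j by simp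
    then show "k \<in> {1..n div 2}" using n k by (auto simp: Suc_le_eq dest: dvd_pos_nat)
  qed
  have rle: "\<bar>r n\<bar> \<le> (\<Sum>k\<in>{1..n div 2}. \<bar>t k\<bar>)" if n: "n > 0" for n
  proof -
    have "\<bar>r n\<bar> \<le> (\<Sum>k | k dvd n \<and> k \<noteq> n. \<bar>t k\<bar>)"
      unfolding r_def by (rule order_trans[OF sum_abs]) (simp add: abs_mult)
    also have "\<dots> \<le> (\<Sum>k\<in>{1..n div 2}. \<bar>t k\<bar>)" using sub[OF n] by (intro sum_mono2) auto
    finally show ?thesis .
  qed
  have klt: "real k \<le> \<rho> ^ k" for k
  proof -
    have "real k \<le> (3/2) ^ k"
    proof (induction k rule: less_induct)
      case (less k)
      consider "k = 0" | "k = 1" | "k = 2" | j where "k = Suc j" "j \<ge> 2"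
        by (cases k) force+
      then show ?case
      proof cases
        case 4
        then show ?thesis using less[of j] by simp
      qed (simp_all add: power2_eq_square)
    qed
    also have "\<dots> \<le> \<rho> ^ k" using \<rho> by (intro power_mono) auto
    finally show ?thesis .
  qed
  obtain C where C: "C > 0" "\<And>n. norm (s n / \<rho> ^ n) \<le> C"
    using convergent_imp_Bseq[OF convergentI[OF lim]] by (auto elim: BseqE)
  have sC: "\<bar>s n\<bar> \<le> C * \<rho> ^ n" for n
    using C(2)[of n] \<rho> by (simp add: abs_div field_simps)
  have tC: "\<bar>t n\<bar> \<le> C * real n * \<rho> ^ n" if "n > 0" for n
    using that
  proof (induction n rule: less_induct)
    case (less n)
    have "\<bar>t k\<bar> \<le> C * \<rho> ^ n" if k: "k \<in> {1..n div 2}" for k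
    proof -
      have "\<bar>t k\<bar> \<le> C * real k * \<rho> ^ k" using k less.prems by (intro less.IH) auto
      also have "\<dots> \<le> C * \<rho> ^ k * \<rho> ^ k" using klt[of k] C(1) \<rho> by (intro mult_right_mono mult_left_mono) auto
      also have "\<dots> = C * \<rho> ^ (k + k)" by (simp add: power_add)
      also have "\<dots> \<le> C * \<rho> ^ n" using k C(1) \<rho> by (intro mult_left_mono power_increasing) auto
      finally show ?thesis .
    qed
    then have "(\<Sum>k\<in>{1..n div 2}. \<bar>t k\<bar>) \<le> real (n div 2) * (C * \<rho> ^ n)"
      using sum_bounded_above[of "{1..n div 2}" "\<lambda>k. \<bar>t k\<bar>" "C * \<rho> ^ n"] by simp
    also have "real (n div 2) \<le> real (n - 1)" using less.prems by (intro of_nat_mono) linarith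
    then have "real (n div 2) * (C * \<rho> ^ n) \<le> real (n - 1) * (C * \<rho> ^ n)"
      using C(1) \<rho> by (intro mult_right_mono) auto
    finally have "\<bar>t n\<bar> \<le> C * \<rho> ^ n + real (n - 1) * (C * \<rho> ^ n)"
      using rle[OF less.prems] sC[of n] t[OF less.prems] by linarith
    then show ?case using less.prems by (simp add: of_nat_diff algebra_simps)
  qed
  \<comment> \<open>The fourth root makes \<open>(n x^n)^2\<close> equal to \<open>n^2 \<rho>^(-n/2)\<close>.\<close>
  define x where "x = 1 / sqrt (sqrt \<rho>)"
  have x: "0 < x" "x < 1" "x ^ 4 = 1 / \<rho>"
  proof -
    show "0 < x" "x < 1" using \<rho> by (simp_all add: x_def)
    have "x ^ 4 = (x\<^sup>2)\<^sup>2" by (simp flip: power_mult)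
    then show "x ^ 4 = 1 / \<rho>" using \<rho> by (simp add: x_def power_divide)
  qed
  have "\<bar>r n / \<rho> ^ n\<bar> \<le> C * (real n * x ^ n)\<^sup>2" if n: "n > 0" for n
  proof -
    have "\<bar>t k\<bar> \<le> C * real n * \<rho> ^ (n div 2)" if k: "k \<in> {1..n div 2}" for k
    proof -
      have "\<bar>t k\<bar> \<le> C * real k * \<rho> ^ k" using k by (intro tC) auto
      also have "\<dots> \<le> C * real n * \<rho> ^ (n div 2)"
        using k C(1) \<rho> by (intro mult_mono power_increasing) auto
      finally show ?thesis .
    qed
    then have "\<bar>r n\<bar> \<le> real (n div 2) * (C * real n * \<rho> ^ (n div 2))"
      using rle[OF n] sum_bounded_above[of "{1..n div 2}" "\<lambda>k. \<bar>t k\<bar>" "C * real n * \<rho> ^ (n div 2)"]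
      by simp
    also have "\<dots> \<le> real n * (C * real n * \<rho> ^ (n div 2))" using C(1) \<rho> by (intro mult_right_mono) auto
    finally have "\<bar>r n / \<rho> ^ n\<bar> \<le> real n * (C * real n * \<rho> ^ (n div 2)) / \<rho> ^ n"
      using \<rho> by (simp add: abs_div divide_right_mono)
    also have "\<dots> = C * (real n)\<^sup>2 * (\<rho> ^ (n div 2) / \<rho> ^ n)" by (simp add: power2_eq_square)
    also have "\<rho> ^ (n div 2) / \<rho> ^ n = (1 / \<rho>) ^ (n - n div 2)"
      using \<rho> by (simp add: power_diff power_one_over field_simps)
    also have "\<dots> = x ^ (4 * (n - n div 2))" by (simp add: x(3)[symmetric] power_mult)
    also have "C * (real n)\<^sup>2 * x ^ (4 * (n - n div 2)) \<le> C * (real n)\<^sup>2 * x ^ (n * 2)"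
      using x C(1) by (intro mult_left_mono power_decreasing) auto
    finally show ?thesis by (simp add: power_mult_distrib power_mult)
  qed
  moreover have "(\<lambda>n. C * (real n * x ^ n)\<^sup>2) \<longlonglongrightarrow> C * 0\<^sup>2"
    using x by (intro tendsto_intros powser_times_n_limit_0) auto
  moreover have "\<forall>\<^sub>F n in sequentially. norm (r n / \<rho> ^ n) \<le> C * (real n * x ^ n)\<^sup>2"
    using calculation(1) by (intro eventually_sequentiallyI[of 1]) simp
  ultimately have "(\<lambda>n. r n / \<rho> ^ n) \<longlonglongrightarrow> 0"
    using Lim_null_comparison[of "\<lambda>n. r n / \<rho> ^ n" "\<lambda>n. C * (real n * x ^ n)\<^sup>2"] by simp
  then have "(\<lambda>n. s n / \<rho> ^ n - r n / \<rho> ^ n) \<longlonglongrightarrow> b - 0" using lim by (intro tendsto_diff)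
  moreover have "eventually (\<lambda>n. s n / \<rho> ^ n - r n / \<rho> ^ n = t n / \<rho> ^ n) sequentially"
    by (intro eventually_sequentiallyI[of 1]) (simp add: t diff_divide_distrib)
  ultimately show ?thesis by (simp add: tendsto_cong)
qed

lemma power_sum_dominant:
  fixes cs :: "real list"
  assumes "\<And>c. c \<in> set cs \<Longrightarrow> \<bar>c\<bar> < \<rho> \<or> c = \<rho>" and "\<rho> > 0"
  shows "(\<lambda>n. (\<Sum>c\<leftarrow>cs. c ^ n) / \<rho> ^ n) \<longlonglongrightarrow> real (count_list cs \<rho>)"
  using assms(1)
proof (induction cs)
  case (Cons c cs)
  have "(\<lambda>n. (c / \<rho>) ^ n) \<longlonglongrightarrow> (if c = \<rho> then 1 else 0)"
  proof (cases "c = \<rho>")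
    case False
    then have "\<bar>c\<bar> < \<rho>" using Cons.prems[of c] by simp
    then have "norm (c / \<rho>) < 1" using assms(2) by (simp add: abs_div)
    then show ?thesis using LIMSEQ_power_zero[of "c / \<rho>"] False by simp
  qed (use assms(2) in simp)
  then have "(\<lambda>n. (c / \<rho>) ^ n + (\<Sum>c\<leftarrow>cs. c ^ n) / \<rho> ^ n) \<longlonglongrightarrow> (if c = \<rho> then 1 else 0) + real (count_list cs \<rho>)"
    using Cons by (intro tendsto_add) auto
  then show ?case using assms(2)
    by (cases "c = \<rho>") (simp_all add: add_divide_distrib power_divide add.commute)
qed simp

text \<open>
  The series \<open>1 + c X^k + \<dots>\<close>, where the dots stand for terms of order larger than \<open>k\<close>.
\<close>

definition one_plus_order :: "nat \<Rightarrow> real \<Rightarrow> real fps \<Rightarrow> bool" where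
  "one_plus_order k c f \<longleftrightarrow> (\<exists>g. f = 1 + fps_X ^ k * g \<and> fps_nth g 0 = c)"

lemma one_plus_order_mult:
  assumes "one_plus_order k c f" "one_plus_order k d g" "k > 0"
  shows "one_plus_order k (c + d) (f * g)"
proof -
  obtain f' g' where "f = 1 + fps_X ^ k * f'" "fps_nth f' 0 = c" "g = 1 + fps_X ^ k * g'" "fps_nth g' 0 = d"
    using assms by (auto simp: one_plus_order_def)
  then show ?thesis unfolding one_plus_order_def
    using assms(3) by (intro exI[of _ "f' + g' + fps_X ^ k * f' * g'"]) (simp add: algebra_simps)
qed

lemma one_plus_order_nth_0: "one_plus_order k c f \<Longrightarrow> k > 0 \<Longrightarrow> fps_nth f 0 = 1"
  by (auto simp: one_plus_order_def)

lemma one_plus_order_inverse: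
  assumes "one_plus_order k c f" "k > 0"
  shows "one_plus_order k (- c) (inverse f)"
proof -
  obtain g where g: "f = 1 + fps_X ^ k * g" "fps_nth g 0 = c"
    using assms by (auto simp: one_plus_order_def)
  have f0: "fps_nth f 0 = 1" by (rule one_plus_order_nth_0[OF assms])
  have "inverse f * f = 1" using f0 by (intro inverse_mult_eq_1) simp
  then have "inverse f + inverse f * (fps_X ^ k * g) = 1"
    by (subst (asm) (2) g(1)) (simp add: distrib_left)
  then have "inverse f = 1 + fps_X ^ k * (- (g * inverse f))"
    by (simp add: algebra_simps eq_diff_eq)
  moreover have "fps_nth (- (g * inverse f)) 0 = - c" using g f0 by simp
  ultimately show ?thesis unfolding one_plus_order_def by blast
qed

lemma one_plus_order_power:
  assumes "one_plus_order k c f" "k > 0"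
  shows "one_plus_order k (real n * c) (f ^ n)"
proof (induction n)
  case 0
  show ?case unfolding one_plus_order_def by (intro exI[of _ 0]) simp
next
  case (Suc n)
  show ?case using one_plus_order_mult[OF assms(1) Suc assms(2)] by (simp add: algebra_simps)
qed

lemma one_plus_order_power_int:
  assumes "one_plus_order k c f" "k > 0"
  shows "one_plus_order k (of_int m * c) (f powi m)"
proof (cases "m \<ge> 0")
  case True
  then show ?thesis using one_plus_order_power[OF assms, of "nat m"] by (simp add: power_int_def)
next
  case False
  then show ?thesis
    using one_plus_order_power[OF one_plus_order_inverse[OF assms] assms(2), of "nat (- m)"]
    by (simp add: power_int_def)
qed

text \<open>
  Both parities give a factor \<open>1 + m X^k + \<dots>\<close>: inverting the factors of even index absorbs the
  sign of \<open>1 - X^k\<close>.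
\<close>

definition deviation_factor :: "nat \<Rightarrow> int \<Rightarrow> real fps" where
  "deviation_factor k m = (if odd k then (1 + fps_X ^ k) powi m else inverse ((1 - fps_X ^ k) powi m))"

lemma deviation_factor_order: "k > 0 \<Longrightarrow> one_plus_order k (of_int m) (deviation_factor k m)"
proof -
  assume k: "k > 0"
  have "one_plus_order k 1 (1 + fps_X ^ k)" "one_plus_order k (-1) (1 - fps_X ^ k)"
    unfolding one_plus_order_def by (rule exI[of _ 1], simp) (rule exI[of _ "-1"], simp)
  from this[THEN one_plus_order_power_int, OF k] show ?thesis
    using one_plus_order_inverse[of k "- of_int m" "(1 - fps_X ^ k) powi m"] k
    by (auto simp: deviation_factor_def)
qed

definition fps_integral_coeffs :: "real fps \<Rightarrow> bool" where
  "fps_integral_coeffs f \<longleftrightarrow> (\<forall>n. fps_nth f n \<in> \<int>)"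

lemma fps_integral_coeffs_mult:
  "fps_integral_coeffs f \<Longrightarrow> fps_integral_coeffs g \<Longrightarrow> fps_integral_coeffs (f * g)"
  unfolding fps_integral_coeffs_def fps_mult_nth by (intro allI Ints_sum Ints_mult) simp_all

lemma fps_integral_coeffs_power: "fps_integral_coeffs f \<Longrightarrow> fps_integral_coeffs (f ^ n)"
  by (induction n) (auto intro: fps_integral_coeffs_mult simp: fps_integral_coeffs_def[of 1])

lemma fps_integral_coeffs_inverse:
  assumes "fps_integral_coeffs f" "fps_nth f 0 = 1"
  shows "fps_integral_coeffs (inverse f)"
proof -
  have "fps_nth (inverse f) n \<in> \<int>" for n
  proof (induction n rule: less_induct)
    case (less n)
    show ?case
    proof (cases n)
      case (Suc m)
      have "f * inverse f = 1" using assms(2) by (simp add: inverse_mult_eq_1')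
      then have "0 = fps_nth (f * inverse f) n" using Suc by simp
      also have "\<dots> = fps_nth (inverse f) n + (\<Sum>i=1..n. fps_nth f i * fps_nth (inverse f) (n - i))"
        unfolding fps_mult_nth by (subst sum.atLeast_Suc_atMost) (simp_all add: assms(2))
      finally have "fps_nth (inverse f) n = - (\<Sum>i=1..n. fps_nth f i * fps_nth (inverse f) (n - i))" by simp
      also have "\<dots> \<in> \<int>"
        using assms(1) by (auto intro!: Ints_minus Ints_sum Ints_mult less simp: fps_integral_coeffs_def)
      finally show ?thesis .
    qed (simp add: assms(2))
  qed
  then show ?thesis by (simp add: fps_integral_coeffs_def)
qed

lemma fps_integral_coeffs_power_int:
  "fps_integral_coeffs f \<Longrightarrow> fps_nth f 0 = 1 \<Longrightarrow> fps_integral_coeffs (f powi m)"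
  unfolding power_int_def by (simp add: fps_integral_coeffs_power fps_integral_coeffs_inverse)

lemma deviation_factor_integral: "k > 0 \<Longrightarrow> fps_integral_coeffs (deviation_factor k m)"
proof -
  assume k: "k > 0"
  have "fps_integral_coeffs (1 + fps_X ^ k)" "fps_integral_coeffs (1 - fps_X ^ k)"
    by (auto simp: fps_integral_coeffs_def)
  moreover have "fps_nth ((1 - fps_X ^ k) powi m) 0 = (1 :: real)"
    using k by (auto simp: power_int_def fps_power_zeroth zero_power)
  ultimately show ?thesis using k
    by (auto simp: deviation_factor_def intro!: fps_integral_coeffs_inverse fps_integral_coeffs_power_int)
qed

text \<open>
  Each factor of the infinite product combines an odd and the following even index, so the partial
  products are the finite products of the single factors up to an even index.
\<close>

lemma is_deviation_sequence_iff:
  assumes "P \<noteq> 0"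
  shows "is_deviation_sequence P e
     \<longleftrightarrow> (\<lambda>n. \<Prod>k=1..2*n+2. deviation_factor k (e k)) \<longlonglongrightarrow> P"
proof -
  have f: "((1 + fps_X ^ (2 * i + 1)) powi e (2 * i + 1)) / ((1 - fps_X ^ (2 * i + 2)) powi e (2 * i + 2))
     = deviation_factor (2 * i + 1) (e (2 * i + 1)) * deviation_factor (2 * i + 2) (e (2 * i + 2))" for i
  proof -
    have "fps_nth ((1 - fps_X ^ (2 * i + 2)) powi e (2 * i + 2)) 0 = (1 :: real)"
      by (auto simp: power_int_def fps_power_zeroth)
    then show ?thesis by (subst fps_divide_unit) (simp_all add: deviation_factor_def)
  qed
  have pr: "(\<Prod>i\<le>n. deviation_factor (2 * i + 1) (e (2 * i + 1)) * deviation_factor (2 * i + 2) (e (2 * i + 2)))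
     = (\<Prod>k=1..2*n+2. deviation_factor k (e k))" for n
  proof (induction n)
    case 0
    have "{1..2::nat} = {1, 2}" by auto
    then show ?case by simp
  next
    case (Suc n)
    have "{1..2 * Suc n + 2} = insert (2*n+4) (insert (2*n+3) {1..2*n+2})" by auto
    then show ?case unfolding prod.atMost_Suc Suc by (simp add: eval_nat_numeral mult_ac)
  qed
  show ?thesis
    unfolding is_deviation_sequence_def f has_prod_def raw_has_prod_def add_0_right pr
    using assms by blast
qed

text \<open>
  The exponent of the next factor is forced: it is the first coefficient in which \<open>P\<close> and the
  partial product still differ.  That coefficient is an integer whenever \<open>P\<close> has integral
  coefficients; the floor only changes its type.
\<close>

primrec deviation_approx :: "real fps \<Rightarrow> nat \<Rightarrow> real fps" where
  "deviation_approx P 0 = 1"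
| "deviation_approx P (Suc n) = deviation_approx P n
     * deviation_factor (Suc n) \<lfloor>fps_nth (P - deviation_approx P n) (Suc n)\<rfloor>"

lemma deviation_sequence_exists:
  assumes P: "fps_integral_coeffs P" "fps_nth P 0 = 1"
  shows "\<exists>e. is_deviation_sequence P e"
proof -
  define e where "e k = \<lfloor>fps_nth (P - deviation_approx P (k - 1)) k\<rfloor>" for k
  have Q: "deviation_approx P n = (\<Prod>k=1..n. deviation_factor k (e k))" for n
  proof (induction n)
    case (Suc n)
    have "{1..Suc n} = insert (Suc n) {1..n}" by auto
    then show ?case using Suc by (simp add: e_def mult.commute)
  qed simp
  have int: "fps_integral_coeffs (deviation_approx P n)" for n
    by (induction n) (auto intro!: fps_integral_coeffs_mult deviation_factor_integral
        simp: fps_integral_coeffs_def[of 1])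
  have agree: "fps_nth (deviation_approx P n) j = fps_nth P j" if "j \<le> n" for n j
    using that
  proof (induction n arbitrary: j)
    case (Suc n)
    define m where "m = \<lfloor>fps_nth (P - deviation_approx P n) (Suc n)\<rfloor>"
    have "fps_nth (P - deviation_approx P n) (Suc n) \<in> \<int>"
      using P(1) int by (auto simp: fps_integral_coeffs_def)
    then have m: "real_of_int m = fps_nth P (Suc n) - fps_nth (deviation_approx P n) (Suc n)"
      by (auto simp: m_def elim: Ints_cases)
    obtain g where g: "deviation_factor (Suc n) m = 1 + fps_X ^ Suc n * g" "fps_nth g 0 = of_int m"
      using deviation_factor_order[of "Suc n" m] by (auto simp: one_plus_order_def)
    have "deviation_approx P (Suc n) = deviation_approx P n + fps_X ^ Suc n * (g * deviation_approx P n)"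
      unfolding deviation_approx.simps m_def[symmetric] g(1) by (simp add: algebra_simps del: power_Suc)
    then have "fps_nth (deviation_approx P (Suc n)) j = fps_nth (deviation_approx P n) j
        + (if j < Suc n then 0 else fps_nth (g * deviation_approx P n) (j - Suc n))"
      by (simp add: fps_X_power_mult_nth del: power_Suc)
    moreover have "fps_nth (deviation_approx P n) 0 = 1" using Suc.IH[of 0] P(2) by simp
    ultimately show ?case using Suc m g(2) by (cases "j = Suc n") auto
  qed (simp add: P(2))
  have "(\<lambda>n. \<Prod>k=1..2*n+2. deviation_factor k (e k)) \<longlonglongrightarrow> P"
  proof (rule tendsto_fpsI)
    fix j
    show "\<forall>\<^sub>F n in sequentially. fps_nth (\<Prod>k=1..2*n+2. deviation_factor k (e k)) j = fps_nth P j"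
      unfolding Q[symmetric] by (intro eventually_sequentiallyI[of j] agree) simp
  qed
  moreover have "P \<noteq> 0" using P(2) by auto
  ultimately show ?thesis using is_deviation_sequence_iff by blast
qed


text \<open>
  The Euler operator \<open>X f'/f\<close>, which turns products into sums and, unlike \<open>f'/f\<close>, preserves the
  degree of a term.
\<close>

definition log_deriv :: "real fps \<Rightarrow> real fps" where
  "log_deriv f = fps_X * fps_deriv f * inverse f"

lemma log_deriv_mult:
  assumes "fps_nth f 0 = 1" "fps_nth g 0 = 1"
  shows "log_deriv (f * g) = log_deriv f + log_deriv g"
proof -
  have "inverse (f * g) = inverse f * inverse g" by (rule fps_inverse_mult)
  then have "log_deriv (f * g)
      = fps_X * fps_deriv f * inverse f * (g * inverse g) + fps_X * fps_deriv g * inverse g * (f * inverse f)"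
    unfolding log_deriv_def fps_deriv_mult by (simp add: algebra_simps)
  moreover have "f * inverse f = 1" "g * inverse g = 1" using assms by (simp_all add: inverse_mult_eq_1')
  ultimately show ?thesis by (simp add: log_deriv_def)
qed

lemma log_deriv_1 [simp]: "log_deriv 1 = 0"
  by (simp add: log_deriv_def)

lemma log_deriv_power:
  assumes "fps_nth f 0 = 1"
  shows "log_deriv (f ^ n) = of_nat n * log_deriv f"
proof (induction n)
  case (Suc n)
  have "fps_nth (f ^ n) 0 = 1" using assms by (simp add: fps_power_zeroth)
  then show ?case using Suc assms by (simp add: log_deriv_mult algebra_simps)
qed simp

lemma log_deriv_inverse:
  assumes "fps_nth f 0 = 1"
  shows "log_deriv (inverse f) = - log_deriv f"
proof -
  have "f * inverse f = 1" using assms by (simp add: inverse_mult_eq_1')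
  then have "log_deriv f + log_deriv (inverse f) = 0"
    using log_deriv_mult[OF assms, of "inverse f"] assms by simp
  then show ?thesis by (simp add: eq_neg_iff_add_eq_0 add.commute)
qed

lemma log_deriv_power_int:
  assumes "fps_nth f 0 = 1"
  shows "log_deriv (f powi m) = of_int m * log_deriv f"
  using assms
  by (cases "m \<ge> 0") (auto simp: power_int_def log_deriv_power log_deriv_inverse)

lemma log_deriv_prod:
  assumes "\<And>k. k \<in> A \<Longrightarrow> fps_nth (f k) 0 = 1"
  shows "log_deriv (\<Prod>k\<in>A. f k) = (\<Sum>k\<in>A. log_deriv (f k))"
  using assms
proof (induction A rule: infinite_finite_induct)
  case (insert k A)
  have "fps_nth (\<Prod>k\<in>A. f k) 0 = 1" using insert(1,4) by (induction A) auto
  then show ?case using insert by (simp add: log_deriv_mult)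
qed auto

text \<open>
  Geometric series in \<open>c X^k\<close>.
\<close>

lemma nth_inverse_one_minus_X_power:
  assumes "k > 0"
  shows "fps_nth (inverse (1 - fps_const c * fps_X ^ k :: real fps)) n = (if k dvd n then c ^ (n div k) else 0)"
proof -
  define g where "g = Abs_fps (\<lambda>n. if k dvd n then c ^ (n div k) else 0)"
  have "(1 - fps_const c * fps_X ^ k) * g = 1"
  proof (rule fps_ext)
    fix n
    have *: "fps_nth ((1 - fps_const c * fps_X ^ k) * g) n
        = fps_nth g n - c * (if n < k then 0 else fps_nth g (n - k))"
      by (simp add: left_diff_distrib mult.assoc fps_X_power_mult_nth)
    consider "n = 0" | "0 < n" "n < k" | "n \<ge> k" by linarith
    then show "fps_nth ((1 - fps_const c * fps_X ^ k) * g) n = fps_nth 1 n"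
    proof cases
      case 3
      have "n div k = Suc ((n - k) div k)" using 3 assms by (simp add: le_div_geq)
      moreover have "k dvd n \<longleftrightarrow> k dvd n - k" using 3 by (simp add: dvd_minus_self)
      ultimately show ?thesis using 3 assms unfolding * by (simp add: g_def)
    next
      case 2
      then have "\<not> k dvd n" by (auto dest: dvd_imp_le)
      then show ?thesis using 2 unfolding * by (simp add: g_def)
    qed (use assms in \<open>simp add: g_def\<close>)
  qed
  moreover have "fps_nth (1 - fps_const c * fps_X ^ k) 0 \<noteq> 0" using assms by simp
  ultimately have "inverse (1 - fps_const c * fps_X ^ k) = g" by (metis fps_inverse_unique)
  then show ?thesis by (simp add: g_def)
qed

lemma nth_log_deriv_one_minus:
  assumes "k > 0"
  shows "fps_nth (log_deriv (1 - fps_const c * fps_X ^ k)) n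
       = (if k dvd n \<and> n > 0 then - real k * c ^ (n div k) else 0)"
proof -
  have d: "fps_X * fps_deriv (1 - fps_const c * fps_X ^ k) = fps_const (- real k * c) * fps_X ^ k"
    using assms by (intro fps_ext) (auto simp: fps_mult_fps_X_deriv_shift fps_X_power_iff)
  have "log_deriv (1 - fps_const c * fps_X ^ k)
      = fps_const (- real k * c) * (fps_X ^ k * inverse (1 - fps_const c * fps_X ^ k))"
    unfolding log_deriv_def d by (simp add: mult.assoc)
  then have *: "fps_nth (log_deriv (1 - fps_const c * fps_X ^ k)) n
      = - real k * c * (if n < k then 0 else if k dvd n - k then c ^ ((n - k) div k) else 0)"
    by (simp add: fps_X_power_mult_nth nth_inverse_one_minus_X_power[OF assms])
  show ?thesis
  proof (cases "n < k")
    case True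
    then show ?thesis unfolding * by (auto dest: dvd_imp_le)
  next
    case False
    then have "n div k = Suc ((n - k) div k)" using assms by (simp add: le_div_geq)
    moreover have "k dvd n \<longleftrightarrow> k dvd n - k" using False by (simp add: dvd_minus_self)
    ultimately show ?thesis using False assms unfolding * by auto
  qed
qed

text \<open>
  For both parities the factor is a power of \<open>1 - (-X)^k\<close>.
\<close>

lemma nth_log_deriv_deviation_factor:
  assumes "k > 0" "n > 0"
  shows "fps_nth (log_deriv (deviation_factor k m)) n
       = (if k dvd n then (-1) ^ (n - k) * (real k * of_int m) else 0)"
proof (cases "odd k")
  case True
  have eq: "1 + fps_X ^ k = 1 - fps_const (-1) * (fps_X ^ k :: real fps)" by (simp flip: fps_const_neg)
  have "log_deriv (deviation_factor k m) = of_int m * log_deriv (1 + fps_X ^ k)"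
    using True assms by (simp add: deviation_factor_def log_deriv_power_int zero_power)
  then have "fps_nth (log_deriv (deviation_factor k m)) n = of_int m * fps_nth (log_deriv (1 + fps_X ^ k)) n"
    by (simp flip: fps_of_int)
  moreover have "(-1) ^ (n - k) = - ((-1) ^ (n div k) :: real)" if d: "k dvd n"
  proof -
    obtain j where j: "n = k * j" "j > 0" using d assms by (cases "n div k") auto
    have "n - k = k * (j - 1)" using j by (simp add: right_diff_distrib')
    moreover have "(-1) ^ (k * (j - 1)) = ((-1) ^ (j - 1) :: real)" using True by (simp add: power_mult)
    moreover have "(-1) ^ j = - ((-1) ^ (j - 1) :: real)" using j by (cases j) auto
    ultimately show ?thesis using j assms by simp
  qed
  ultimately show ?thesis using assms unfolding eq nth_log_deriv_one_minus[OF assms(1)] by auto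
next
  case False
  have eq: "1 - fps_X ^ k = 1 - fps_const 1 * (fps_X ^ k :: real fps)" by simp
  have z: "fps_nth ((1 - fps_X ^ k) powi m) 0 = (1::real)"
    using assms by (auto simp: power_int_def fps_power_zeroth zero_power)
  have "log_deriv (deviation_factor k m) = - (of_int m * log_deriv (1 - fps_X ^ k))"
    using False assms by (simp add: deviation_factor_def log_deriv_inverse[OF z] log_deriv_power_int zero_power)
  then have "fps_nth (log_deriv (deviation_factor k m)) n = - (of_int m * fps_nth (log_deriv (1 - fps_X ^ k)) n)"
    by (simp flip: fps_of_int)
  moreover have "even (n - k)" if "k dvd n" using that False by (metis dvd_diff_nat dvd_trans dvd_refl)
  ultimately show ?thesis using assms unfolding eq nth_log_deriv_one_minus[OF assms(1)] by auto
qed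

text \<open>
  If \<open>f\<close> and \<open>g\<close> agree up to degree \<open>n\<close>, then \<open>f = g (1 + X^(n+1) h)\<close> for some \<open>h\<close>, and the logarithmic
  derivative of the second factor starts in degree \<open>n + 1\<close>.
\<close>

lemma nth_log_deriv_cong:
  assumes "fps_nth f 0 = 1" "\<And>j. j \<le> n \<Longrightarrow> fps_nth f j = fps_nth g j"
  shows "fps_nth (log_deriv f) n = fps_nth (log_deriv g) n"
proof -
  have g0: "fps_nth g 0 = 1" using assms by force
  define h where "h = fps_shift (Suc n) (f - g)"
  have fg: "f = g + fps_X ^ Suc n * h"
  proof (rule fps_ext)
    fix j show "fps_nth f j = fps_nth (g + fps_X ^ Suc n * h) j"
      using assms(2)[of j] by (auto simp: h_def fps_X_power_mult_nth simp del: power_Suc)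
  qed
  define r where "r = 1 + fps_X ^ Suc n * (h * inverse g)"
  have "g * inverse g = 1" using g0 by (simp add: inverse_mult_eq_1')
  then have "f = g * r" unfolding r_def fg by (simp add: algebra_simps del: power_Suc)
  then have "log_deriv f = log_deriv g + log_deriv r"
    using g0 by (simp add: log_deriv_mult r_def)
  moreover have "fps_nth (log_deriv r) n = 0"
    unfolding log_deriv_def fps_mult_fps_X_deriv_shift fps_mult_nth
    by (rule sum.neutral) (auto simp: r_def fps_X_power_mult_nth simp del: power_Suc)
  ultimately show ?thesis by simp
qed

text \<open>
  Up to degree \<open>n\<close>, \<open>P\<close> agrees with a sufficiently long partial product.
\<close>

lemma deviation_divisor_sum:
  assumes P: "fps_nth P 0 = 1" and e: "is_deviation_sequence P e" and n: "n > 0"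
  shows "(\<Sum>k | k dvd n. (-1) ^ (n - k) * (real k * of_int (e k))) = fps_nth (log_deriv P) n"
proof -
  define Q where "Q N = (\<Prod>k=1..N. deviation_factor k (e k))" for N
  have "P \<noteq> 0" using P by auto
  then have "(\<lambda>N. Q (2*N+2)) \<longlonglongrightarrow> P" using e is_deviation_sequence_iff Q_def by simp
  then have "\<forall>j. \<forall>\<^sub>F N in sequentially. fps_nth (Q (2*N+2)) j = fps_nth P j"
    unfolding tendsto_fps_iff .
  then have "\<forall>\<^sub>F N in sequentially. \<forall>j\<in>{..n}. fps_nth (Q (2*N+2)) j = fps_nth P j"
    by (subst eventually_ball_finite_distrib) auto
  then have "\<forall>\<^sub>F N in sequentially. N \<ge> n \<and> (\<forall>j\<in>{..n}. fps_nth (Q (2*N+2)) j = fps_nth P j)"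
    by (intro eventually_conj eventually_ge_at_top)
  from eventually_happens'[OF sequentially_bot this]
  obtain N where N: "N \<ge> n" "\<forall>j\<in>{..n}. fps_nth (Q (2*N+2)) j = fps_nth P j" by blast
  have one: "fps_nth (deviation_factor k (e k)) 0 = 1" if "k > 0" for k
    using one_plus_order_nth_0[OF deviation_factor_order] that by blast
  have "fps_nth (log_deriv P) n = fps_nth (log_deriv (Q (2*N+2))) n"
    using N(2) P by (intro nth_log_deriv_cong) auto
  also have "\<dots> = (\<Sum>k=1..2*N+2. fps_nth (log_deriv (deviation_factor k (e k))) n)"
    unfolding Q_def by (subst log_deriv_prod) (auto intro: one simp: fps_sum_nth)
  also have "\<dots> = (\<Sum>k=1..2*N+2. if k dvd n then (-1) ^ (n - k) * (real k * of_int (e k)) else 0)"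
    using n by (intro sum.cong refl nth_log_deriv_deviation_factor) auto
  also have "\<dots> = (\<Sum>k | k dvd n. (-1) ^ (n - k) * (real k * of_int (e k)))"
  proof (rule sum.mono_neutral_cong_right)
    show "{k. k dvd n} \<subseteq> {1..2*N+2}"
    proof safe
      fix k assume "k dvd n"
      then have "k \<le> n" "k > 0" using n by (auto dest: dvd_imp_le intro: Nat.gr0I)
      then show "k \<in> {1..2*N+2}" using N(1) by simp
    qed
  qed auto
  finally show ?thesis by simp
qed

text \<open>
  The divisor sums form a triangular system of equations for the deviations.
\<close>

lemma deviation_unique:
  assumes P: "fps_nth P 0 = 1" and e: "is_deviation_sequence P e" and f: "is_deviation_sequence P f" and "n > 0"
  shows "e n = f n"
  using \<open>n > 0\<close>
proof (induction n rule: less_induct)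
  case (less n)
  have ins: "{k. k dvd n} = insert n {k. k dvd n \<and> k \<noteq> n}" by auto
  have fin: "finite {k. k dvd n \<and> k \<noteq> n}" using less.prems by simp
  have "(\<Sum>k | k dvd n \<and> k \<noteq> n. (-1) ^ (n - k) * (real k * of_int (e k)))
      = (\<Sum>k | k dvd n \<and> k \<noteq> n. (-1) ^ (n - k) * (real k * of_int (f k)))"
  proof (rule sum.cong, simp)
    fix k assume "k \<in> {k. k dvd n \<and> k \<noteq> n}"
    then have "k < n" "k > 0" using less.prems by (auto dest: dvd_imp_le dvd_pos_nat intro: le_neq_implies_less)
    then show "(-1) ^ (n - k) * (real k * of_int (e k)) = (-1) ^ (n - k) * (real k * of_int (f k))"
      using less.IH by simp
  qed
  moreover have "(\<Sum>k | k dvd n. (-1) ^ (n - k) * (real k * of_int (e k)))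
      = (\<Sum>k | k dvd n. (-1) ^ (n - k) * (real k * of_int (f k)))"
    using deviation_divisor_sum[OF P e less.prems] deviation_divisor_sum[OF P f less.prems] by simp
  ultimately show ?case using fin less.prems unfolding ins by simp
qed

text \<open>
  The logarithmic derivative of \<open>P = (1+X)^d / \<Prod>(1 - c X)\<close> has the coefficients
  \<open>\<Sum>c^n - (-1)^n d\<close>.  Since all \<open>c > -1\<close> and the largest of them is at least \<open>3/2\<close>, that one
  strictly dominates the absolute values of the others, and \<open>b\<close> counts how often it occurs.
\<close>

theorem deviation_asymptotics:
  fixes I :: "('v, 'k::field) mpoly set" and cs :: "real list"
  assumes fac: "poincare_series I * (\<Prod>c\<leftarrow>cs. 1 - fps_const c * fps_X) = (1 + fps_X) ^ d"
    and cs: "\<And>c. c \<in> set cs \<Longrightarrow> c > -1" and big: "\<exists>c\<in>set cs. c \<ge> 3/2"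
  shows "\<exists>(b::nat) (\<rho>::real). b > 0 \<and> \<rho> > 1 \<and>
    (\<lambda>i. real_of_int (deviation I i) / (real b * \<rho> ^ i / real i)) \<longlonglongrightarrow> 1"
proof -
  define P where "P = poincare_series I"
  have c0: "fps_nth (\<Prod>c\<leftarrow>cs. 1 - fps_const c * fps_X) 0 = (1::real)" for cs
    by (induction cs) auto
  have P0: "fps_nth P 0 = 1"
    using arg_cong[OF fac, of "\<lambda>f. fps_nth f 0"] c0[of cs] by (simp add: P_def fps_power_zeroth)
  have "fps_integral_coeffs P" by (simp add: P_def poincare_series_def fps_integral_coeffs_def)
  then obtain e where e: "is_deviation_sequence P e" using deviation_sequence_exists P0 by blast
  have dev: "deviation I n = e n" if "n > 0" for n
    unfolding deviation_def P_def[symmetric]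
  proof (rule the_equality)
    show "\<exists>f. is_deviation_sequence P f \<and> f n = e n" using e by blast
    show "m = e n" if "\<exists>f. is_deviation_sequence P f \<and> f n = m" for m
      using that deviation_unique[OF P0 _ e \<open>n > 0\<close>] by blast
  qed
  define \<rho> where "\<rho> = Max (set cs)"
  have \<rho>: "\<rho> \<in> set cs" "\<And>c. c \<in> set cs \<Longrightarrow> c \<le> \<rho>"     using big Max_in[of "set cs"] unfolding \<rho>_def by fastforce+
  have \<rho>32: "\<rho> \<ge> 3/2" using big \<rho>(2) by force
  define s where "s n = (\<Sum>c\<leftarrow>cs. c ^ n) - (-1) ^ n * real d" for n
  have LP: "log_deriv P + log_deriv (\<Prod>c\<leftarrow>cs. 1 - fps_const c * fps_X) = of_nat d * log_deriv (1 + fps_X)"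
    using arg_cong[OF fac, of log_deriv] P0 c0[of cs]
    by (simp add: log_deriv_mult log_deriv_power P_def[symmetric])
  have L1: "fps_nth (log_deriv (\<Prod>c\<leftarrow>cs. 1 - fps_const c * fps_X)) n = - (\<Sum>c\<leftarrow>cs. c ^ n)"
    if "n > 0" for n cs
  proof (induction cs)
    case (Cons c cs)
    then show ?case using nth_log_deriv_one_minus[of 1 c n] that c0[of cs] by (simp add: log_deriv_mult)
  qed simp
  have L2: "fps_nth (of_nat d * log_deriv (1 + fps_X)) n = - ((-1) ^ n * real d)" if "n > 0" for n
    using nth_log_deriv_one_minus[of 1 "-1" n] that by (simp flip: fps_of_nat fps_const_neg)
  have "fps_nth (log_deriv P) n = s n" if "n > 0" for n
    using arg_cong[OF LP, of "\<lambda>f. fps_nth f n"] L1[OF that, of cs] L2[OF that] by (simp add: s_def)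
  then have sums: "(\<Sum>k | k dvd n. (-1) ^ (n - k) * (real k * of_int (e k))) = s n" if "n > 0" for n
    using deviation_divisor_sum[OF P0 e that] that by simp
  define b where "b = count_list cs \<rho>"
  have "b > 0" using \<rho>(1) unfolding b_def by (metis count_list_0_iff gr0I)
  have "(\<lambda>n. (\<Sum>c\<leftarrow>cs. c ^ n) / \<rho> ^ n) \<longlonglongrightarrow> real b"
    unfolding b_def using \<rho>32
  proof (intro power_sum_dominant)
    fix c assume c: "c \<in> set cs"
    show "\<bar>c\<bar> < \<rho> \<or> c = \<rho>" using cs[OF c] \<rho>(2)[OF c] \<rho>32 by linarith
  qed simp
  moreover have "(\<lambda>n. real d * (- 1 / \<rho>) ^ n) \<longlonglongrightarrow> real d * 0"
    using \<rho>32 by (intro tendsto_intros LIMSEQ_power_zero) simp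
  ultimately have "(\<lambda>n. (\<Sum>c\<leftarrow>cs. c ^ n) / \<rho> ^ n - real d * (- 1 / \<rho>) ^ n) \<longlonglongrightarrow> real b - real d * 0"
    by (rule tendsto_diff)
  moreover have "s n / \<rho> ^ n = (\<Sum>c\<leftarrow>cs. c ^ n) / \<rho> ^ n - real d * (- 1 / \<rho>) ^ n" for n
    unfolding s_def diff_divide_distrib power_divide by simp
  ultimately have "(\<lambda>n. s n / \<rho> ^ n) \<longlonglongrightarrow> real b" by simp
  from divisor_sum_inversion_limit[OF sums \<rho>32 this]
  have "(\<lambda>n. real n * of_int (e n) / \<rho> ^ n) \<longlonglongrightarrow> real b" .
  then have "(\<lambda>n. real n * of_int (e n) / \<rho> ^ n / real b) \<longlonglongrightarrow> real b / real b"
    using \<open>b > 0\<close> by (intro tendsto_divide) auto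
  moreover have "\<forall>\<^sub>F n in sequentially. real n * of_int (e n) / \<rho> ^ n / real b
      = real_of_int (deviation I n) / (real b * \<rho> ^ n / real n)"
    using \<open>b > 0\<close> \<rho>32 by (intro eventually_sequentiallyI[of 1]) (simp add: dev field_simps)
  ultimately have "(\<lambda>n. real_of_int (deviation I n) / (real b * \<rho> ^ n / real n)) \<longlonglongrightarrow> 1"
    using \<open>b > 0\<close> by (simp add: tendsto_cong)
  then show ?thesis using \<open>b > 0\<close> \<rho>32 by (intro exI[of _ b] exI[of _ \<rho>]) auto
qed

section \<open>Monomial ideals determined by the supports of monomials\<close>

lemma keys_add_monomial: "Poly_Mapping.keys (a + b :: 'v \<Rightarrow>\<^sub>0 nat) = Poly_Mapping.keys a \<union> Poly_Mapping.keys b"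
  by (auto simp: in_keys_iff lookup_add)

lemma poly_mapping_sum_singles:
  "p = (\<Sum>t\<in>Poly_Mapping.keys p. Poly_Mapping.single t (Poly_Mapping.lookup p t))"
  by (rule poly_mapping_eqI)
     (simp add: lookup_sum lookup_single when_def in_keys_iff sum.delta)

lemma mpoly_times_sum_singles:
  fixes p q :: "('v, 'k::comm_ring_1) mpoly"
  shows "p * q = (\<Sum>s\<in>Poly_Mapping.keys p. \<Sum>t\<in>Poly_Mapping.keys q.
      Poly_Mapping.single (s + t) (Poly_Mapping.lookup p s * Poly_Mapping.lookup q t))"
proof -
  have "p * q = (\<Sum>s\<in>Poly_Mapping.keys p. Poly_Mapping.single s (Poly_Mapping.lookup p s))
     * (\<Sum>t\<in>Poly_Mapping.keys q. Poly_Mapping.single t (Poly_Mapping.lookup q t))"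
    by (simp flip: poly_mapping_sum_singles)
  then show ?thesis by (simp only: sum_product mult_single)
qed

lemma lookup_single_times:
  fixes p :: "('v, 'k::comm_ring_1) mpoly"
  shows "Poly_Mapping.lookup (Poly_Mapping.single a c * p) (a + m) = c * Poly_Mapping.lookup p m"
proof -
  have "Poly_Mapping.single a c * p
      = (\<Sum>t\<in>Poly_Mapping.keys p. Poly_Mapping.single (a + t) (c * Poly_Mapping.lookup p t))"
    by (subst poly_mapping_sum_singles[of p]) (simp only: sum_distrib_left mult_single)
  then show ?thesis
    by (simp add: lookup_sum lookup_single when_def in_keys_iff sum.delta)
qed

definition const_coeff :: "('v, 'k::comm_ring_1) mpoly \<Rightarrow> 'k" where
  "const_coeff p = Poly_Mapping.lookup p 0"

definition linear_coeff :: "'v \<Rightarrow> ('v, 'k::comm_ring_1) mpoly \<Rightarrow> 'k" where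
  "linear_coeff v p = Poly_Mapping.lookup p (Poly_Mapping.single v 1)"

lemma monomial_add_eq_0_iff: "a + b = (0 :: 'v \<Rightarrow>\<^sub>0 nat) \<longleftrightarrow> a = 0 \<and> b = 0"
  by (auto simp: poly_mapping_eq_iff fun_eq_iff lookup_add)

lemma monomial_add_eq_var_iff:
  "a + b = Poly_Mapping.single v (1 :: nat)
     \<longleftrightarrow> a = 0 \<and> b = Poly_Mapping.single v 1 \<or> a = Poly_Mapping.single v 1 \<and> b = 0"
proof
  assume *: "a + b = Poly_Mapping.single v 1"
  have *: "Poly_Mapping.lookup a w + Poly_Mapping.lookup b w = (if w = v then 1 else 0)" for w
    using arg_cong[OF *, of "\<lambda>p. Poly_Mapping.lookup p w"] by (simp add: lookup_add lookup_single when_def eq_commute)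
  show "a = 0 \<and> b = Poly_Mapping.single v 1 \<or> a = Poly_Mapping.single v 1 \<and> b = 0"
  proof (cases "Poly_Mapping.lookup a v = 0")
    case True
    have "Poly_Mapping.lookup a w = 0 \<and> Poly_Mapping.lookup b w = (if w = v then 1 else 0)" for w
      using *[of w] True by (cases "w = v") auto
    then show ?thesis by (auto simp: poly_mapping_eq_iff fun_eq_iff lookup_single when_def)
  next
    case False
    have "Poly_Mapping.lookup b w = 0 \<and> Poly_Mapping.lookup a w = (if w = v then 1 else 0)" for w
      using *[of w] *[of v] False by (cases "w = v") auto
    then show ?thesis by (auto simp: poly_mapping_eq_iff fun_eq_iff lookup_single when_def)
  qed
qed auto

lemma const_coeff_simps [simp]:
  "const_coeff 0 = 0" "const_coeff 1 = 1" "const_coeff (p + q) = const_coeff p + const_coeff q"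
  "const_coeff (p - q) = const_coeff p - const_coeff q" "const_coeff (- p) = - const_coeff p"
  by (simp_all add: const_coeff_def lookup_add lookup_minus)

lemma const_coeff_sum [simp]: "const_coeff (sum f A) = (\<Sum>x\<in>A. const_coeff (f x))"
  by (simp add: const_coeff_def lookup_sum)

text \<open>
  The contribution of one pair of monomials to a product of polynomials.
\<close>

lemma sum_keys_single_pair:
  "(\<Sum>s\<in>Poly_Mapping.keys p. \<Sum>t\<in>Poly_Mapping.keys q.
      if s = a \<and> t = b then Poly_Mapping.lookup p s * Poly_Mapping.lookup q t else 0)
    = Poly_Mapping.lookup p a * (Poly_Mapping.lookup q b :: 'k::comm_ring_1)"
proof -
  have "(\<Sum>t\<in>Poly_Mapping.keys q. if s = a \<and> t = b then Poly_Mapping.lookup p s * Poly_Mapping.lookup q t else 0)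
      = (if s = a then Poly_Mapping.lookup p a * Poly_Mapping.lookup q b else 0)" for s
    by (cases "s = a") (simp_all add: sum.delta in_keys_iff)
  then show ?thesis by (simp add: sum.delta in_keys_iff)
qed

lemma const_coeff_mult [simp]: "const_coeff (p * q) = const_coeff p * const_coeff q"
proof -
  have "const_coeff (p * q) = (\<Sum>s\<in>Poly_Mapping.keys p. \<Sum>t\<in>Poly_Mapping.keys q.
      if s = 0 \<and> t = 0 then Poly_Mapping.lookup p s * Poly_Mapping.lookup q t else 0)"
    unfolding const_coeff_def mpoly_times_sum_singles lookup_sum
    by (intro sum.cong) (auto simp: lookup_single when_def monomial_add_eq_0_iff)
  then show ?thesis unfolding const_coeff_def sum_keys_single_pair .
qed

lemma linear_coeff_simps [simp]:
  "linear_coeff v 0 = 0" "linear_coeff v (p + q) = linear_coeff v p + linear_coeff v q"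
  "linear_coeff v (p - q) = linear_coeff v p - linear_coeff v q"
  by (simp_all add: linear_coeff_def lookup_add lookup_minus)

lemma linear_coeff_sum [simp]: "linear_coeff v (sum f A) = (\<Sum>x\<in>A. linear_coeff v (f x))"
  by (simp add: linear_coeff_def lookup_sum)

text \<open>
  Leibniz rule: a monomial of degree one splits into two monomials only by making one of them
  trivial.
\<close>

lemma linear_coeff_mult [simp]:
  "linear_coeff v (p * q) = linear_coeff v p * const_coeff q + const_coeff p * linear_coeff v q"
proof -
  let ?v = "Poly_Mapping.single v (1::nat)"
  have v0: "?v \<noteq> 0" by (metis lookup_single_eq lookup_zero zero_neq_one)
  have "linear_coeff v (p * q) = (\<Sum>s\<in>Poly_Mapping.keys p. \<Sum>t\<in>Poly_Mapping.keys q.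
      (if s = 0 \<and> t = ?v then Poly_Mapping.lookup p s * Poly_Mapping.lookup q t else 0)
      + (if s = ?v \<and> t = 0 then Poly_Mapping.lookup p s * Poly_Mapping.lookup q t else 0))"
    unfolding linear_coeff_def mpoly_times_sum_singles lookup_sum
    using v0 monomial_add_eq_var_iff[of _ _ v]
    by (intro sum.cong refl) (auto simp: lookup_single when_def)
  then show ?thesis
    unfolding const_coeff_def linear_coeff_def sum.distrib sum_keys_single_pair by (simp add: algebra_simps)
qed

lemma const_coeff_mvar [simp]: "const_coeff (mvar v) = 0"
  and linear_coeff_mvar: "linear_coeff u (mvar v) = (if u = v then 1 else 0)"
proof -
  have "Poly_Mapping.single v (1::nat) \<noteq> 0" by (metis lookup_single_eq lookup_zero zero_neq_one)
  moreover have "Poly_Mapping.single v (1::nat) = Poly_Mapping.single u 1 \<longleftrightarrow> u = v"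
    by (metis lookup_single_eq lookup_single_not_eq zero_neq_one)
  ultimately show "const_coeff (mvar v) = 0" "linear_coeff u (mvar v) = (if u = v then 1 else 0)"
    by (auto simp: const_coeff_def linear_coeff_def mvar_def lookup_single when_def)
qed

text \<open>
  The ideals spanned by the monomials whose set of variables satisfies \<open>Q\<close>; it is an ideal if
  \<open>Q\<close> is monotone.  All ideals generated by squarefree monomials have this form, and operations on
  them become operations on set predicates.
\<close>

definition support_ideal :: "('v set \<Rightarrow> bool) \<Rightarrow> ('v, 'k::comm_ring_1) mpoly set" where
  "support_ideal Q = {p. \<forall>m\<in>Poly_Mapping.keys p. Q (Poly_Mapping.keys m)}"

lemma support_ideal_0 [simp]: "0 \<in> support_ideal Q"
  by (simp add: support_ideal_def)

lemma support_ideal_add: "p \<in> support_ideal Q \<Longrightarrow> q \<in> support_ideal Q \<Longrightarrow> p + q \<in> support_ideal Q"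
  using Poly_Mapping.keys_add[of p q] by (auto simp: support_ideal_def)

lemma support_ideal_mult:
  assumes "mono Q" "p \<in> support_ideal Q"
  shows "q * p \<in> support_ideal Q"
  unfolding support_ideal_def
proof safe
  fix m assume "m \<in> Poly_Mapping.keys (q * p)"
  then obtain a b where "m = a + b" "b \<in> Poly_Mapping.keys p" using keys_mult[of q p] by blast
  then show "Q (Poly_Mapping.keys m)"
    using assms monoD[OF assms(1), of "Poly_Mapping.keys b" "Poly_Mapping.keys m"]
    by (auto simp: support_ideal_def keys_add_monomial)
qed

lemma support_ideal_mono: "(\<And>S. Q S \<Longrightarrow> Q' S) \<Longrightarrow> support_ideal Q \<subseteq> support_ideal Q'"
  by (auto simp: support_ideal_def)

lemma keys_mvar_times:
  fixes p :: "('v, 'k::comm_ring_1) mpoly"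
  assumes "m \<in> Poly_Mapping.keys p"
  shows "Poly_Mapping.single v 1 + m \<in> Poly_Mapping.keys (mvar v * p)"
  using assms by (simp add: in_keys_iff mvar_def lookup_single_times)

lemma mvar_times_in_support_ideal:
  fixes p :: "('v, 'k::comm_ring_1) mpoly"
  assumes "mvar v * p \<in> support_ideal Q"
  shows "p \<in> support_ideal (\<lambda>S. Q (insert v S))"
  using assms keys_mvar_times[of _ p v] by (fastforce simp: support_ideal_def keys_add_monomial)

text \<open>
  Multiplication by a variable shifts the monomials of \<open>p\<close> injectively, without cancellation.
\<close>

lemma mvar_times_in_support_ideal_iff:
  fixes p :: "('v, 'k::comm_ring_1) mpoly"
  shows "mvar v * p \<in> support_ideal Q \<longleftrightarrow> p \<in> support_ideal (\<lambda>S. Q (insert v S))"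
proof
  assume p: "p \<in> support_ideal (\<lambda>S. Q (insert v S))"
  show "mvar v * p \<in> support_ideal Q"
    unfolding support_ideal_def
  proof safe
    fix m assume "m \<in> Poly_Mapping.keys (mvar v * p)"
    then obtain b where "m = Poly_Mapping.single v 1 + b" "b \<in> Poly_Mapping.keys p"
      using keys_mult[of "mvar v" p] by (auto simp: mvar_def split: if_splits)
    then show "Q (Poly_Mapping.keys m)" using p by (simp add: support_ideal_def keys_add_monomial)
  qed
qed (rule mvar_times_in_support_ideal)

lemma support_ideal_induct_monomial:
  assumes p: "p \<in> support_ideal Q"
    and "0 \<in> K" "\<And>p q. p \<in> K \<Longrightarrow> q \<in> K \<Longrightarrow> p + q \<in> K"
    and "\<And>m c. Q (Poly_Mapping.keys m) \<Longrightarrow> Poly_Mapping.single m c \<in> K"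
  shows "p \<in> K"
proof -
  have sum: "(\<Sum>t\<in>A. Poly_Mapping.single t (c t)) \<in> K"
    if "finite A" "\<And>t. t \<in> A \<Longrightarrow> Q (Poly_Mapping.keys t)" for A c
    using that by (induction A) (auto intro: assms)
  have "(\<Sum>t\<in>Poly_Mapping.keys p. Poly_Mapping.single t (Poly_Mapping.lookup p t)) \<in> K"
    using p by (intro sum) (auto simp: support_ideal_def)
  then show ?thesis by (simp flip: poly_mapping_sum_singles)
qed

lemma single_divisible_by_var:
  assumes "v \<in> Poly_Mapping.keys (m :: 'v \<Rightarrow>\<^sub>0 nat)"
  obtains m' where "Poly_Mapping.single m c = mvar v * Poly_Mapping.single m' (c :: 'k::comm_ring_1)"
    "m = Poly_Mapping.single v 1 + m'"
proof -
  define m' where "m' = m - Poly_Mapping.single v 1"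
  have "m = Poly_Mapping.single v 1 + m'"
    using assms by (intro poly_mapping_eqI) (auto simp: m'_def lookup_add lookup_minus lookup_single when_def in_keys_iff)
  then show ?thesis using that[of m'] by (simp add: mvar_def mult_single)
qed

lemma mpoly_ring_simps [simp]:
  "carrier (mpoly_ring :: ('v, 'k::comm_ring_1) mpoly ring) = UNIV"
  "x \<otimes>\<^bsub>mpoly_ring\<^esub> y = x * y" "x \<oplus>\<^bsub>mpoly_ring\<^esub> y = x + y"
  "\<one>\<^bsub>mpoly_ring\<^esub> = 1" "\<zero>\<^bsub>mpoly_ring\<^esub> = 0"
  by (simp_all add: ring_of_type_algebra_def)

lemma cring_mpoly_ring: "cring (mpoly_ring :: ('v, 'k::comm_ring_1) mpoly ring)"
  by (rule cring_from_type_algebra)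

lemma ideal_mpoly_ringI:
  fixes I :: "('v, 'k::comm_ring_1) mpoly set"
  assumes "0 \<in> I" "\<And>p q. p \<in> I \<Longrightarrow> q \<in> I \<Longrightarrow> p + q \<in> I" "\<And>p q. p \<in> I \<Longrightarrow> q * p \<in> I"
  shows "ideal I mpoly_ring"
proof (rule idealI)
  interpret cring "mpoly_ring :: ('v, 'k) mpoly ring" by (rule cring_mpoly_ring)
  show "ring (mpoly_ring :: ('v, 'k) mpoly ring)" by (rule ring_axioms)
  show "subgroup I (add_monoid mpoly_ring)"
  proof (rule add.subgroupI)
    fix p assume "p \<in> I"
    have "p \<oplus>\<^bsub>mpoly_ring\<^esub> (- p) = \<zero>\<^bsub>mpoly_ring\<^esub>" by simp
    then have "\<ominus>\<^bsub>mpoly_ring\<^esub> p = - p" by (metis UNIV_I minus_equality mpoly_ring_simps(1) a_comm)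
    then show "\<ominus>\<^bsub>mpoly_ring\<^esub> p \<in> I"
      using assms(3)[OF \<open>p \<in> I\<close>, of "-1"] by simp
  qed (use assms in auto)
qed (use assms in \<open>auto simp: mult.commute\<close>)

lemma Idl_edge_monomials:
  assumes ne: "\<And>u v. (u, v) \<in> R \<Longrightarrow> u \<noteq> v"
  shows "Idl\<^bsub>mpoly_ring\<^esub> ((\<lambda>(u, v). mvar u * mvar v) ` R)
     = (support_ideal (\<lambda>S. \<exists>(u, v)\<in>R. u \<in> S \<and> v \<in> S) :: ('v, 'k::comm_ring_1) mpoly set)"
    (is "Idl\<^bsub>_\<^esub> ?G = support_ideal ?Q")
proof (rule subset_antisym)
  interpret cring "mpoly_ring :: ('v, 'k) mpoly ring" by (rule cring_mpoly_ring)
  have mono: "mono ?Q" by (intro monoI) fastforce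
  have "ideal (support_ideal ?Q :: ('v, 'k) mpoly set) mpoly_ring"
    by (intro ideal_mpoly_ringI) (auto intro: support_ideal_add support_ideal_mult mono)
  moreover have "?G \<subseteq> (support_ideal ?Q :: ('v, 'k) mpoly set)"
    by (fastforce simp: support_ideal_def mvar_def mult_single keys_add_monomial split: if_splits)
  ultimately show "Idl\<^bsub>mpoly_ring\<^esub> ?G \<subseteq> (support_ideal ?Q :: ('v, 'k) mpoly set)"
    by (rule genideal_minimal)
  interpret I: ideal "Idl\<^bsub>mpoly_ring\<^esub> ?G" "mpoly_ring :: ('v, 'k) mpoly ring"
    by (rule genideal_ideal) simp
  show "support_ideal ?Q \<subseteq> (Idl\<^bsub>mpoly_ring\<^esub> ?G :: ('v, 'k) mpoly set)"
  proof
    fix p :: "('v, 'k) mpoly" assume "p \<in> support_ideal ?Q"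
    then show "p \<in> Idl\<^bsub>mpoly_ring\<^esub> ?G"
    proof (rule support_ideal_induct_monomial)
      show "0 \<in> (Idl\<^bsub>mpoly_ring\<^esub> ?G :: ('v, 'k) mpoly set)" using I.zero_closed by simp
      show "p + q \<in> Idl\<^bsub>mpoly_ring\<^esub> ?G" if "p \<in> Idl\<^bsub>mpoly_ring\<^esub> ?G" "q \<in> Idl\<^bsub>mpoly_ring\<^esub> ?G"
        for p q :: "('v, 'k) mpoly"
        using I.a_closed[OF that] by simp
      fix m :: "'v \<Rightarrow>\<^sub>0 nat" and c :: 'k assume "?Q (Poly_Mapping.keys m)"
      then obtain u v where uv: "(u, v) \<in> R" "u \<in> Poly_Mapping.keys m" "v \<in> Poly_Mapping.keys m" by auto
      obtain m' where m': "Poly_Mapping.single m c = mvar u * Poly_Mapping.single m' c"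
        "m = Poly_Mapping.single u 1 + m'" using single_divisible_by_var[OF uv(2)] .
      have "v \<in> Poly_Mapping.keys m'" using uv(3) ne[OF uv(1)] m'(2) by (auto simp: keys_add_monomial)
      then obtain m'' where "Poly_Mapping.single m' c = mvar v * Poly_Mapping.single m'' c"
        "m' = Poly_Mapping.single v 1 + m''" by (rule single_divisible_by_var)
      then have "Poly_Mapping.single m c = Poly_Mapping.single m'' c * (mvar u * mvar v)"
        using m'(1) by (simp only: mult_ac)
      moreover have "mvar u * mvar v \<in> (Idl\<^bsub>mpoly_ring\<^esub> ?G :: ('v, 'k) mpoly set)"
        using uv(1) genideal_self[of ?G] by auto
      ultimately show "Poly_Mapping.single m c \<in> Idl\<^bsub>mpoly_ring\<^esub> ?G"
        using I.I_l_closed[of "mvar u * mvar v" "Poly_Mapping.single m'' c"] by simp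
    qed
  qed
qed

definition has_edge :: "('v \<Rightarrow> 'v \<Rightarrow> bool) \<Rightarrow> 'v set \<Rightarrow> bool" where
  "has_edge E S \<longleftrightarrow> (\<exists>u\<in>S. \<exists>v\<in>S. E u v)"

lemma edge_ideal_eq:
  assumes "irreflp E"
  shows "edge_ideal E = (support_ideal (has_edge E) :: ('v, 'k::comm_ring_1) mpoly set)"
proof -
  have "{mvar u * mvar v | u v. E u v} = (\<lambda>(u, v). mvar u * mvar v :: ('v, 'k) mpoly) ` {(u, v). E u v}"
    by auto
  moreover have "has_edge E = (\<lambda>S. \<exists>(u, v)\<in>{(u, v). E u v}. u \<in> S \<and> v \<in> S)"
    by (auto simp: has_edge_def fun_eq_iff)
  moreover have "u \<noteq> v" if "(u, v) \<in> {(u, v). E u v}" for u v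
    using that assms by (auto simp: irreflp_def)
  ultimately show ?thesis
    using Idl_edge_monomials[of "{(u, v). E u v}"] unfolding edge_ideal_def by simp
qed


lemma mono_has_edge: "mono (has_edge E)"
  by (intro monoI) (auto simp: has_edge_def)

text \<open>
  The sum of the edge ideal and the ideal generated by the variables in \<open>A\<close>.
\<close>

definition vars_ideal :: "('v \<Rightarrow> 'v \<Rightarrow> bool) \<Rightarrow> 'v set \<Rightarrow> ('v, 'k::comm_ring_1) mpoly set" where
  "vars_ideal E A = support_ideal (\<lambda>S. has_edge E S \<or> S \<inter> A \<noteq> {})"

lemma mono_vars: "mono (\<lambda>S. has_edge E S \<or> S \<inter> A \<noteq> {})"
  by (intro monoI) (auto simp: has_edge_def)

text \<open>
  The family of ideals generated by variables in the quotient by the edge ideal is closed under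
  colon ideals by variables.  The whole resolution of the residue field rests on this property.
\<close>

lemma vars_ideal_colon:
  fixes r :: "('v, 'k::comm_ring_1) mpoly"
  assumes E: "symp E" "irreflp E" and "u \<notin> A" and r: "mvar u * r \<in> vars_ideal E A"
  shows "r \<in> vars_ideal E (A \<union> {w. E u w})"
proof -
  have "has_edge E S \<or> S \<inter> (A \<union> {w. E u w}) \<noteq> {}"
    if "has_edge E (insert u S) \<or> insert u S \<inter> A \<noteq> {}" for S
    using that assms(1-3) by (auto simp: has_edge_def irreflp_def dest: sympD)
  then have "support_ideal (\<lambda>S. has_edge E (insert u S) \<or> insert u S \<inter> A \<noteq> {})
      \<subseteq> (support_ideal (\<lambda>S. has_edge E S \<or> S \<inter> (A \<union> {w. E u w}) \<noteq> {}) :: ('v, 'k) mpoly set)"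
    by (rule support_ideal_mono)
  then show ?thesis
    using r unfolding vars_ideal_def mvar_times_in_support_ideal_iff by (rule subsetD)
qed

lemma mvar_mult_mvar_in_edge_ideal: "E u v \<Longrightarrow> mvar u * mvar v \<in> support_ideal (has_edge E)"
  unfolding mvar_times_in_support_ideal_iff
  by (auto simp: support_ideal_def mvar_def has_edge_def split: if_splits)

text \<open>
  Every monomial of \<open>p\<close> is in the edge ideal or divisible by a variable of \<open>A\<close>.
\<close>

lemma vars_ideal_combination:
  fixes p :: "('v, 'k::comm_ring_1) mpoly"
  assumes "finite A" "p \<in> vars_ideal E A"
  shows "\<exists>r. p - (\<Sum>u\<in>A. r u * mvar u) \<in> support_ideal (has_edge E)"
proof -
  let ?I = "support_ideal (has_edge E) :: ('v, 'k) mpoly set"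
  define K where "K = {p :: ('v, 'k) mpoly. \<exists>r. p - (\<Sum>u\<in>A. r u * mvar u) \<in> ?I}"
  have "p \<in> K"
    using assms(2) unfolding vars_ideal_def
  proof (rule support_ideal_induct_monomial)
    show "0 \<in> K" unfolding K_def by (auto intro!: exI[of _ "\<lambda>_. 0"])
  next
    fix p q assume "p \<in> K" "q \<in> K"
    then obtain r s where "p - (\<Sum>u\<in>A. r u * mvar u) \<in> ?I" "q - (\<Sum>u\<in>A. s u * mvar u) \<in> ?I"
      by (auto simp: K_def)
    from support_ideal_add[OF this]
    have "p + q - (\<Sum>u\<in>A. (r u + s u) * mvar u) \<in> ?I"
      by (simp add: sum.distrib algebra_simps)
    then show "p + q \<in> K" unfolding K_def by (auto intro!: exI[of _ "\<lambda>u. r u + s u"])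
  next
    fix m :: "'v \<Rightarrow>\<^sub>0 nat" and c :: 'k
    assume "has_edge E (Poly_Mapping.keys m) \<or> Poly_Mapping.keys m \<inter> A \<noteq> {}"
    then show "Poly_Mapping.single m c \<in> K"
    proof
      assume "has_edge E (Poly_Mapping.keys m)"
      then have "Poly_Mapping.single m c \<in> ?I" by (simp add: support_ideal_def)
      then show ?thesis unfolding K_def by (auto intro!: exI[of _ "\<lambda>_. 0"])
    next
      assume "Poly_Mapping.keys m \<inter> A \<noteq> {}"
      then obtain u where u: "u \<in> Poly_Mapping.keys m" "u \<in> A" by auto
      obtain m' where m': "Poly_Mapping.single m c = mvar u * Poly_Mapping.single m' c"
        using single_divisible_by_var[OF u(1)] by blast
      have "(\<Sum>w\<in>A. (if w = u then Poly_Mapping.single m' c else 0) * mvar w)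
          = (\<Sum>w\<in>A. if w = u then mvar u * Poly_Mapping.single m' c else 0)"
        by (rule sum.cong) (auto simp: mult.commute)
      also have "\<dots> = mvar u * Poly_Mapping.single m' c"
        using u(2) assms(1) by (simp add: sum.delta)
      finally have "(\<Sum>w\<in>A. (if w = u then Poly_Mapping.single m' c else 0) * mvar w)
          = mvar u * Poly_Mapping.single m' c" .
      then have "Poly_Mapping.single m c - (\<Sum>w\<in>A. (if w = u then Poly_Mapping.single m' c else 0) * mvar w) \<in> ?I"
        using m' by simp
      then show ?thesis unfolding K_def by (auto intro!: exI[of _ "\<lambda>w. if w = u then Poly_Mapping.single m' c else 0"])
    qed
  qed
  then show ?thesis by (simp add: K_def)
qed

lemma linear_coeff_edge_ideal:
  assumes "irreflp E" "p \<in> support_ideal (has_edge E)"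
  shows "linear_coeff v p = 0"
proof (rule ccontr)
  assume "linear_coeff v p \<noteq> 0"
  then have "Poly_Mapping.single v 1 \<in> Poly_Mapping.keys p" by (simp add: linear_coeff_def in_keys_iff)
  moreover have "\<forall>m\<in>Poly_Mapping.keys p. has_edge E (Poly_Mapping.keys m)"
    using assms(2) by (simp add: support_ideal_def)
  ultimately have "has_edge E (Poly_Mapping.keys (Poly_Mapping.single v (1::nat)))" by blast
  then show False using assms(1) by (auto simp: has_edge_def irreflp_def split: if_splits)
qed

lemma const_coeff_edge_ideal: "p \<in> support_ideal (has_edge E) \<Longrightarrow> const_coeff p = 0"
proof (rule ccontr)
  assume "p \<in> support_ideal (has_edge E)" "const_coeff p \<noteq> 0"
  then have "0 \<in> Poly_Mapping.keys p" "\<forall>m\<in>Poly_Mapping.keys p. has_edge E (Poly_Mapping.keys m)"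
    by (simp_all add: support_ideal_def const_coeff_def in_keys_iff)
  then have "has_edge E (Poly_Mapping.keys (0 :: _ \<Rightarrow>\<^sub>0 nat))" by blast
  then show False by (simp add: has_edge_def)
qed

lemma const_coeff_eq_0_iff: "const_coeff p = 0 \<longleftrightarrow> p \<in> vars_ideal E UNIV"
proof -
  have "has_edge E (Poly_Mapping.keys m) \<or> Poly_Mapping.keys m \<noteq> {} \<longleftrightarrow> m \<noteq> 0" for m :: "_ \<Rightarrow>\<^sub>0 nat"
    by (auto simp: has_edge_def)
  then show ?thesis
    by (auto simp: vars_ideal_def support_ideal_def const_coeff_def in_keys_iff)
qed

lemma finite_type_injection: "\<exists>f :: 'v::finite \<Rightarrow> nat. inj f \<and> (\<forall>v. f v < CARD('v))"
proof -
  obtain f where "bij_betw f (UNIV :: 'v set) {0..<CARD('v)}"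
    using ex_bij_betw_finite_nat[of "UNIV :: 'v set"] by auto
  then show ?thesis unfolding bij_betw_def by (metis UNIV_I atLeastLessThan_iff imageI)
qed

text \<open>
  If no vertex has two neighbours then the edge monomials involve pairwise disjoint sets of
  variables.  Multiplication by one of them does not affect the divisibility of a monomial by the
  others, so they form a regular sequence.
\<close>

theorem matching_complete_intersection:
  fixes E :: "'v::finite \<Rightarrow> 'v \<Rightarrow> bool"
  assumes E: "symp E" "irreflp E" and matching: "\<And>u v w. E u v \<Longrightarrow> E u w \<Longrightarrow> v = w"
  shows "complete_intersection (edge_ideal E :: ('v, 'k::comm_ring_1) mpoly set)"
proof -
  obtain f :: "'v \<Rightarrow> nat" where f: "inj f" using finite_type_injection by blast
  \<comment> \<open>The relation \<open>E\<close> holds for both orientations of an edge; the numbering \<open>f\<close> selects one of them.\<close>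
  define R where "R = {(u, v). E u v \<and> f u < f v}"
  obtain L where L: "set L = R" "distinct L" using finite_distinct_list[of R] by auto
  define g where "g = (\<lambda>(u, v). mvar u * mvar v :: ('v, 'k) mpoly)"
  define Q where "Q T = (\<lambda>S. \<exists>(u, v)\<in>T. u \<in> S \<and> v \<in> S)" for T :: "('v \<times> 'v) set"
  have Idl: "Idl\<^bsub>mpoly_ring\<^esub> (g ` T) = support_ideal (Q T)" if "T \<subseteq> R" for T
    unfolding g_def Q_def using that E by (intro Idl_edge_monomials) (auto simp: R_def irreflp_def)
  have "Q R S \<longleftrightarrow> has_edge E S" for S
  proof
    assume "has_edge E S"
    then obtain u v where uv: "E u v" "u \<in> S" "v \<in> S" by (auto simp: has_edge_def)
    then have "f u \<noteq> f v" using f E by (auto simp: irreflp_def dest: injD)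
    then have "(u, v) \<in> R \<or> (v, u) \<in> R" using uv E by (auto simp: R_def dest: sympD)
    then show "Q R S" using uv by (auto simp: Q_def)
  qed (auto simp: Q_def R_def has_edge_def)
  then have gen: "edge_ideal E = Idl\<^bsub>mpoly_ring\<^esub> (set (map g L))"
    using Idl[of R] by (simp add: L edge_ideal_eq[OF E(2)] support_ideal_def)
  have "regular_sequence mpoly_ring (map g L)"
    unfolding regular_sequence_def
  proof (intro conjI allI impI ballI)
    fix i y assume i: "i < length (map g L)"
      and y: "map g L ! i \<otimes>\<^bsub>mpoly_ring\<^esub> y \<in> Idl\<^bsub>mpoly_ring\<^esub> (set (take i (map g L)))"
    define T where "T = set (take i L)"
    have TR: "T \<subseteq> R" using L(1) by (auto simp: T_def dest: in_set_takeD)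
    have IT: "Idl\<^bsub>mpoly_ring\<^esub> (set (take i (map g L))) = support_ideal (Q T)"
      using Idl[OF TR] by (simp add: T_def take_map)
    obtain u v where uv: "L ! i = (u, v)" by (cases "L ! i")
    have uvR: "(u, v) \<in> R" using i L(1) uv by (metis length_map nth_mem)
    have nT: "(u, v) \<notin> T"
    proof
      assume "(u, v) \<in> T"
      then obtain j where "j < i" "L ! j = L ! i" using i uv by (auto simp: T_def in_set_conv_nth)
      then show False using i L(2) by (simp add: nth_eq_iff_index_eq)
    qed
    have "mvar u * (mvar v * y) \<in> support_ideal (Q T)"
      using y i unfolding IT by (simp add: uv g_def mult.assoc)
    then have "y \<in> support_ideal (\<lambda>S. Q T (insert u (insert v S)))"
      by (simp add: mvar_times_in_support_ideal_iff)
    moreover have "Q T S" if QT: "Q T (insert u (insert v S))" for S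
    proof -
      obtain a b where ab: "(a, b) \<in> T" "a \<in> insert u (insert v S)" "b \<in> insert u (insert v S)"
        using QT by (auto simp: Q_def)
      have abR: "E a b" "f a < f b" "E u v" "f u < f v" using ab(1) TR uvR by (auto simp: R_def)
      have "a \<noteq> u \<and> a \<noteq> v \<and> b \<noteq> u \<and> b \<noteq> v"
        using abR nT ab(1) matching E(1) by (metis sympD order_less_asym)
      then show ?thesis using ab by (auto simp: Q_def)
    qed
    then have "support_ideal (\<lambda>S. Q T (insert u (insert v S))) \<subseteq> (support_ideal (Q T) :: ('v, 'k) mpoly set)"
      by (rule support_ideal_mono)
    ultimately show "y \<in> Idl\<^bsub>mpoly_ring\<^esub> (set (take i (map g L)))"
      unfolding IT by blast
  next
    have "1 \<notin> (support_ideal (Q R) :: ('v, 'k) mpoly set)" by (auto simp: support_ideal_def Q_def)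
    then show "Idl\<^bsub>mpoly_ring\<^esub> (set (map g L)) \<noteq> carrier mpoly_ring"
      using Idl[of R] by (auto simp: L)
  qed simp
  then show ?thesis using gen unfolding complete_intersection_def by blast
qed

section \<open>Comparison of free resolutions over a quotient ring\<close>

text \<open>
  Modules over the quotient ring by \<open>I\<close> are described by representatives in the ring itself, with
  congruence modulo \<open>I\<close> in place of equality; \<open>\<epsilon>\<close> is the map to the residue field.  A free module
  with basis \<open>M\<close> consists of functions, only whose values on \<open>M\<close> matter.
\<close>

locale residue_ideal =
  fixes I :: "'a::comm_ring_1 set" and \<epsilon> :: "'a \<Rightarrow> 'k::field"
  assumes I_0: "0 \<in> I" and I_add: "a \<in> I \<Longrightarrow> b \<in> I \<Longrightarrow> a + b \<in> I"
    and I_mult: "a \<in> I \<Longrightarrow> c * a \<in> I"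
    and \<epsilon>_add: "\<epsilon> (a + b) = \<epsilon> a + \<epsilon> b" and \<epsilon>_mult: "\<epsilon> (a * b) = \<epsilon> a * \<epsilon> b"
    and \<epsilon>_1: "\<epsilon> 1 = 1" and \<epsilon>_I: "a \<in> I \<Longrightarrow> \<epsilon> a = 0"
begin

lemma I_uminus: "a \<in> I \<Longrightarrow> - a \<in> I"
  using I_mult[of a "-1"] by simp

lemma I_mult': "a \<in> I \<Longrightarrow> a * c \<in> I"
  using I_mult by (simp add: mult.commute)

lemma I_sum: "(\<And>x. x \<in> A \<Longrightarrow> f x \<in> I) \<Longrightarrow> sum f A \<in> I"
  by (induction A rule: infinite_finite_induct) (auto intro: I_0 I_add)

lemma I_trans: "a - b \<in> I \<Longrightarrow> b - c \<in> I \<Longrightarrow> a - c \<in> I"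
  using I_add[of "a - b" "b - c"] by simp

lemma I_sym: "a - b \<in> I \<Longrightarrow> b - a \<in> I"
  using I_uminus[of "a - b"] by simp

lemma I_cong: "a - b \<in> I \<Longrightarrow> b \<in> I \<Longrightarrow> a \<in> I"
  using I_add[of "a - b" b] by simp

lemma \<epsilon>_0 [simp]: "\<epsilon> 0 = 0"
  by (rule \<epsilon>_I[OF I_0])

lemma \<epsilon>_uminus [simp]: "\<epsilon> (- a) = - \<epsilon> a"
  using \<epsilon>_add[of a "- a"] by (simp add: eq_neg_iff_add_eq_0 add.commute)

lemma \<epsilon>_diff [simp]: "\<epsilon> (a - b) = \<epsilon> a - \<epsilon> b"
  using \<epsilon>_add[of a "- b"] by simp

lemma \<epsilon>_sum [simp]: "\<epsilon> (sum f A) = (\<Sum>x\<in>A. \<epsilon> (f x))"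
  by (induction A rule: infinite_finite_induct) (auto simp: \<epsilon>_add)

lemma \<epsilon>_cong: "a - b \<in> I \<Longrightarrow> \<epsilon> a = \<epsilon> b"
  using \<epsilon>_I[of "a - b"] by simp

text \<open>
  In the complex with basis \<open>M i\<close> in degree \<open>i\<close>, the coefficient of \<open>y\<close> in the differential of the
  basis element \<open>x\<close> of degree \<open>i\<close> is \<open>d i y x\<close>.  In degree \<open>0\<close> the augmentation to the residue
  field, given by \<open>g\<close>, takes the place of the differential.
\<close>

definition cyc :: "(nat \<Rightarrow> 'x set) \<Rightarrow> (nat \<Rightarrow> 'x \<Rightarrow> 'x \<Rightarrow> 'a) \<Rightarrow> ('x \<Rightarrow> 'k) \<Rightarrow> nat \<Rightarrow> ('x \<Rightarrow> 'a) \<Rightarrow> bool" where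
  "cyc M d g i v \<longleftrightarrow> (case i of 0 \<Rightarrow> (\<Sum>x\<in>M 0. \<epsilon> (v x) * g x) = 0
     | Suc j \<Rightarrow> \<forall>y\<in>M j. (\<Sum>x\<in>M i. d i y x * v x) \<in> I)"

text \<open>
  A resolution of the residue field by finite free modules over the quotient ring.
\<close>

definition is_resolution :: "(nat \<Rightarrow> 'x set) \<Rightarrow> (nat \<Rightarrow> 'x \<Rightarrow> 'x \<Rightarrow> 'a) \<Rightarrow> ('x \<Rightarrow> 'k) \<Rightarrow> bool" where
  "is_resolution M d g \<longleftrightarrow> (\<forall>i. finite (M i)) \<and> (\<forall>c. \<exists>v. (\<Sum>x\<in>M 0. \<epsilon> (v x) * g x) = c) \<and>
     (\<forall>i v. cyc M d g i v \<longleftrightarrow> (\<exists>w. \<forall>x\<in>M i. v x - (\<Sum>z\<in>M (Suc i). d (Suc i) x z * w z) \<in> I))"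

lemma resolution_column_cyc:
  assumes "is_resolution M d g" "z \<in> M (Suc i)"
  shows "cyc M d g i (\<lambda>x. d (Suc i) x z)"
proof -
  have "(\<Sum>z'\<in>M (Suc i). d (Suc i) x z' * (if z' = z then 1 else 0)) = d (Suc i) x z" for x
    using assms by (simp add: is_resolution_def if_distrib[of "\<lambda>a. _ * a"] sum.delta cong: if_cong)
  then have "\<exists>w. \<forall>x\<in>M i. d (Suc i) x z - (\<Sum>z'\<in>M (Suc i). d (Suc i) x z' * w z') \<in> I"
    by (intro exI[of _ "\<lambda>z'. if z' = z then 1 else 0"]) (simp add: I_0)
  then show ?thesis using assms by (auto simp: is_resolution_def)
qed

definition chain_map :: "(nat \<Rightarrow> 'x set) \<Rightarrow> (nat \<Rightarrow> 'x \<Rightarrow> 'x \<Rightarrow> 'a) \<Rightarrow> (nat \<Rightarrow> 'y set) \<Rightarrow> (nat \<Rightarrow> 'y \<Rightarrow> 'y \<Rightarrow> 'a)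
    \<Rightarrow> (nat \<Rightarrow> 'y \<Rightarrow> 'x \<Rightarrow> 'a) \<Rightarrow> bool" where
  "chain_map M d N e f \<longleftrightarrow> (\<forall>i. \<forall>x\<in>M (Suc i). \<forall>y\<in>N i.
     (\<Sum>y'\<in>N (Suc i). e (Suc i) y y' * f (Suc i) y' x) - (\<Sum>x'\<in>M i. f i y x' * d (Suc i) x' x) \<in> I)"

definition lifts :: "(nat \<Rightarrow> 'x set) \<Rightarrow> ('x \<Rightarrow> 'k) \<Rightarrow> (nat \<Rightarrow> 'y set) \<Rightarrow> ('y \<Rightarrow> 'k) \<Rightarrow> (nat \<Rightarrow> 'y \<Rightarrow> 'x \<Rightarrow> 'a) \<Rightarrow> bool" where
  "lifts M g N h f \<longleftrightarrow> (\<forall>x\<in>M 0. (\<Sum>y\<in>N 0. \<epsilon> (f 0 y x) * h y) = g x)"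

lemma sum_mat_assoc:
  "(\<Sum>y\<in>B. e y * (\<Sum>x\<in>A. f y x * v x)) = (\<Sum>x\<in>A. (\<Sum>y\<in>B. e y * f y x) * (v x :: 'b::comm_ring_1))"
  by (simp only: sum_distrib_left sum_distrib_right mult.assoc) (rule sum.swap)

text \<open>
  The comparison theorem.  A chain map is built degree by degree: the image of the differential of a
  basis element is a cycle, hence a boundary in the target.  For the induction the map constructed
  so far has to send all cycles to cycles, not only the differentials of basis elements.
\<close>

lemma chain_map_exists:
  assumes M: "is_resolution M d g" and N: "is_resolution N e h"
  shows "\<exists>f. chain_map M d N e f \<and> lifts M g N h f"
proof -
  define good where "good i F \<longleftrightarrow> (i = 0 \<longrightarrow> (\<forall>x\<in>M 0. (\<Sum>y\<in>N 0. \<epsilon> (F y x) * h y) = g x)) \<and>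
      (\<forall>v. cyc M d g i v \<longrightarrow> cyc N e h i (\<lambda>y. \<Sum>x\<in>M i. F y x * v x))"
    for i and F :: "'c \<Rightarrow> 'b \<Rightarrow> 'a"
  define step where "step i F F' \<longleftrightarrow> (\<forall>x\<in>M (Suc i). \<forall>y\<in>N i.
     (\<Sum>y'\<in>N (Suc i). e (Suc i) y y' * F' y' x) - (\<Sum>x'\<in>M i. F y x' * d (Suc i) x' x) \<in> I)"
    for i and F F' :: "'c \<Rightarrow> 'b \<Rightarrow> 'a"
  have "\<exists>F. good 0 F"
  proof -
    have "\<exists>v. (\<Sum>y\<in>N 0. \<epsilon> (v y) * h y) = c" for c using N by (auto simp: is_resolution_def)
    then obtain V where V: "\<And>c. (\<Sum>y\<in>N 0. \<epsilon> (V c y) * h y) = c" by metis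
    define F where "F = (\<lambda>y x. V (g x) y)"
    have "cyc N e h 0 (\<lambda>y. \<Sum>x\<in>M 0. F y x * v x)" if "cyc M d g 0 v" for v
    proof -
      have "(\<Sum>y\<in>N 0. \<epsilon> (\<Sum>x\<in>M 0. F y x * v x) * h y) = (\<Sum>y\<in>N 0. h y * (\<Sum>x\<in>M 0. \<epsilon> (F y x) * \<epsilon> (v x)))"
        by (simp add: \<epsilon>_mult mult.commute)
      also have "\<dots> = (\<Sum>x\<in>M 0. (\<Sum>y\<in>N 0. h y * \<epsilon> (F y x)) * \<epsilon> (v x))" by (rule sum_mat_assoc)
      also have "\<dots> = (\<Sum>x\<in>M 0. \<epsilon> (v x) * g x)"
        using V by (intro sum.cong) (simp_all add: F_def mult.commute)
      finally show ?thesis using that by (simp add: cyc_def)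
    qed
    then show ?thesis using V by (intro exI[of _ F]) (auto simp: good_def F_def)
  qed
  moreover have "\<exists>F'. good (Suc i) F' \<and> step i F F'" if F: "good i F" for i F
  proof -
    have "\<exists>w. \<forall>y\<in>N i. (\<Sum>x'\<in>M i. F y x' * d (Suc i) x' x) - (\<Sum>y'\<in>N (Suc i). e (Suc i) y y' * w y') \<in> I"
      if "x \<in> M (Suc i)" for x
    proof -
      have "cyc N e h i (\<lambda>y. \<Sum>x'\<in>M i. F y x' * d (Suc i) x' x)"
        using F resolution_column_cyc[OF M that] by (auto simp: good_def)
      then show ?thesis using N by (auto simp: is_resolution_def)
    qed
    then obtain W where W: "\<And>x y. x \<in> M (Suc i) \<Longrightarrow> y \<in> N i \<Longrightarrow>
        (\<Sum>x'\<in>M i. F y x' * d (Suc i) x' x) - (\<Sum>y'\<in>N (Suc i). e (Suc i) y y' * W x y') \<in> I" by metis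
    define F' where "F' = (\<lambda>y x. W x y)"
    have step: "step i F F'" using W I_sym by (auto simp: step_def F'_def)
    have "(\<Sum>y'\<in>N (Suc i). e (Suc i) y y' * (\<Sum>x\<in>M (Suc i). F' y' x * v x)) \<in> I"
      if v: "cyc M d g (Suc i) v" and y: "y \<in> N i" for v y
    proof -
      have "(\<Sum>x\<in>M (Suc i). ((\<Sum>y'\<in>N (Suc i). e (Suc i) y y' * F' y' x) - (\<Sum>x'\<in>M i. F y x' * d (Suc i) x' x)) * v x) \<in> I"
        using step y by (intro I_sum I_mult') (auto simp: step_def)
      then have "(\<Sum>y'\<in>N (Suc i). e (Suc i) y y' * (\<Sum>x\<in>M (Suc i). F' y' x * v x))
          - (\<Sum>x'\<in>M i. F y x' * (\<Sum>x\<in>M (Suc i). d (Suc i) x' x * v x)) \<in> I"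
        unfolding sum_mat_assoc by (simp add: left_diff_distrib sum_subtractf)
      moreover have "(\<Sum>x'\<in>M i. F y x' * (\<Sum>x\<in>M (Suc i). d (Suc i) x' x * v x)) \<in> I"
      proof (rule I_sum, rule I_mult)
        fix x' assume "x' \<in> M i"
        then show "(\<Sum>x\<in>M (Suc i). d (Suc i) x' x * v x) \<in> I" using v by (simp add: cyc_def)
      qed
      ultimately show ?thesis by (rule I_cong)
    qed
    then have "good (Suc i) F'" by (auto simp: good_def cyc_def)
    then show ?thesis using step by blast
  qed
  ultimately obtain f where "\<And>i. good i (f i)" "\<And>i. step i (f i) (f (Suc i))"
    using dependent_nat_choice[of good step] by metis
  then have "chain_map M d N e f \<and> lifts M g N h f"
    by (auto simp: chain_map_def lifts_def step_def good_def)
  then show ?thesis by blast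
qed

text \<open>
  Over the zero map of the residue field, the same induction as for the comparison theorem yields a
  homotopy \<open>s\<close>.  Its invariant is that on cycles of degree \<open>i\<close> the map \<open>f\<close> agrees with the
  differential of \<open>s\<close>, the other half of the homotopy being zero there.
\<close>

lemma chain_homotopy_exists:
  assumes M: "is_resolution M d g" and N: "is_resolution N e h"
    and f: "chain_map M d N e f" "lifts M (\<lambda>_. 0) N h f"
  shows "\<exists>s. (\<forall>x\<in>M 0. \<forall>y\<in>N 0. f 0 y x - (\<Sum>y'\<in>N 1. e 1 y y' * s 0 y' x) \<in> I) \<and>
    (\<forall>i. \<forall>x\<in>M (Suc i). \<forall>y\<in>N (Suc i). f (Suc i) y x
        - ((\<Sum>y'\<in>N (Suc (Suc i)). e (Suc (Suc i)) y y' * s (Suc i) y' x)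
            + (\<Sum>x'\<in>M i. s i y x' * d (Suc i) x' x)) \<in> I)"
proof -
  define good where "good i S \<longleftrightarrow>
      (i = 0 \<longrightarrow> (\<forall>x\<in>M 0. \<forall>y\<in>N 0. f 0 y x - (\<Sum>y'\<in>N 1. e 1 y y' * S y' x) \<in> I)) \<and>
      (\<forall>v. cyc M d g i v \<longrightarrow> (\<forall>y\<in>N i. (\<Sum>x\<in>M i. f i y x * v x)
          - (\<Sum>y'\<in>N (Suc i). e (Suc i) y y' * (\<Sum>x\<in>M i. S y' x * v x)) \<in> I))"
    for i and S :: "'c \<Rightarrow> 'b \<Rightarrow> 'a"
  \<comment> \<open>Choosing the images of a basis element \<open>x\<close> under the next map requires that \<open>f x - s (d x)\<close>
      is a cycle.\<close>
  define step where "step i S S' \<longleftrightarrow> (\<forall>x\<in>M (Suc i). \<forall>y\<in>N (Suc i). f (Suc i) y x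
        - ((\<Sum>y'\<in>N (Suc (Suc i)). e (Suc (Suc i)) y y' * S' y' x) + (\<Sum>x'\<in>M i. S y x' * d (Suc i) x' x)) \<in> I)"
    for i and S S' :: "'c \<Rightarrow> 'b \<Rightarrow> 'a"
  have "\<exists>S. good 0 S"
  proof -
    have "\<exists>w. \<forall>y\<in>N 0. f 0 y x - (\<Sum>y'\<in>N 1. e 1 y y' * w y') \<in> I" if "x \<in> M 0" for x
    proof -
      have "cyc N e h 0 (\<lambda>y. f 0 y x)" using f(2) that by (simp add: lifts_def cyc_def)
      then show ?thesis using N by (auto simp: is_resolution_def)
    qed
    then obtain W where W: "\<And>x y. x \<in> M 0 \<Longrightarrow> y \<in> N 0 \<Longrightarrow> f 0 y x - (\<Sum>y'\<in>N 1. e 1 y y' * W x y') \<in> I" by metis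
    have "(\<Sum>x\<in>M 0. f 0 y x * v x) - (\<Sum>y'\<in>N 1. e 1 y y' * (\<Sum>x\<in>M 0. W x y' * v x)) \<in> I" if "y \<in> N 0" for y v
    proof -
      have "(\<Sum>x\<in>M 0. (f 0 y x - (\<Sum>y'\<in>N 1. e 1 y y' * W x y')) * v x) \<in> I"
        using W that by (intro I_sum I_mult') auto
      then show ?thesis unfolding sum_mat_assoc by (simp add: left_diff_distrib sum_subtractf)
    qed
    then show ?thesis using W by (intro exI[of _ "\<lambda>y x. W x y"]) (auto simp: good_def)
  qed
  moreover have "\<exists>S'. good (Suc i) S' \<and> step i S S'" if S: "good i S" for i S
  proof -
    have "\<exists>w. \<forall>y\<in>N (Suc i). (f (Suc i) y x - (\<Sum>x'\<in>M i. S y x' * d (Suc i) x' x))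
        - (\<Sum>y'\<in>N (Suc (Suc i)). e (Suc (Suc i)) y y' * w y') \<in> I" if x: "x \<in> M (Suc i)" for x
    proof -
      have "(\<Sum>y'\<in>N (Suc i). e (Suc i) y y' * (f (Suc i) y' x - (\<Sum>x'\<in>M i. S y' x' * d (Suc i) x' x))) \<in> I"
        if y: "y \<in> N i" for y
      proof -
        have "(\<Sum>x'\<in>M i. f i y x' * d (Suc i) x' x)
            - (\<Sum>y'\<in>N (Suc i). e (Suc i) y y' * (\<Sum>x'\<in>M i. S y' x' * d (Suc i) x' x)) \<in> I"
          using S resolution_column_cyc[OF M x] y by (auto simp: good_def)
        moreover have "(\<Sum>y'\<in>N (Suc i). e (Suc i) y y' * f (Suc i) y' x)
            - (\<Sum>x'\<in>M i. f i y x' * d (Suc i) x' x) \<in> I"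
          using f(1) x y by (auto simp: chain_map_def)
        ultimately show ?thesis
          using I_trans by (simp add: right_diff_distrib sum_subtractf)
      qed
      then have "cyc N e h (Suc i) (\<lambda>y. f (Suc i) y x - (\<Sum>x'\<in>M i. S y x' * d (Suc i) x' x))"
        by (simp add: cyc_def)
      then show ?thesis using N by (auto simp: is_resolution_def)
    qed
    then obtain W where W: "\<And>x y. x \<in> M (Suc i) \<Longrightarrow> y \<in> N (Suc i) \<Longrightarrow>
        (f (Suc i) y x - (\<Sum>x'\<in>M i. S y x' * d (Suc i) x' x))
        - (\<Sum>y'\<in>N (Suc (Suc i)). e (Suc (Suc i)) y y' * W x y') \<in> I" by metis
    define S' where "S' = (\<lambda>y x. W x y)"
    have step: "step i S S'" using W by (auto simp: step_def S'_def algebra_simps)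
    have "(\<Sum>x\<in>M (Suc i). f (Suc i) y x * v x)
        - (\<Sum>y'\<in>N (Suc (Suc i)). e (Suc (Suc i)) y y' * (\<Sum>x\<in>M (Suc i). S' y' x * v x)) \<in> I"
      if v: "cyc M d g (Suc i) v" and y: "y \<in> N (Suc i)" for v y
    proof -
      have "(\<Sum>x\<in>M (Suc i). (f (Suc i) y x - ((\<Sum>y'\<in>N (Suc (Suc i)). e (Suc (Suc i)) y y' * S' y' x)
          + (\<Sum>x'\<in>M i. S y x' * d (Suc i) x' x))) * v x) \<in> I"
        using step y by (intro I_sum I_mult') (auto simp: step_def)
      then have "((\<Sum>x\<in>M (Suc i). f (Suc i) y x * v x)
        - (\<Sum>y'\<in>N (Suc (Suc i)). e (Suc (Suc i)) y y' * (\<Sum>x\<in>M (Suc i). S' y' x * v x)))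
        - (\<Sum>x'\<in>M i. S y x' * (\<Sum>x\<in>M (Suc i). d (Suc i) x' x * v x)) \<in> I"
        unfolding sum_mat_assoc by (simp add: left_diff_distrib distrib_right sum_subtractf sum.distrib algebra_simps)
      moreover have "(\<Sum>x'\<in>M i. S y x' * (\<Sum>x\<in>M (Suc i). d (Suc i) x' x * v x)) \<in> I"
      proof (rule I_sum, rule I_mult)
        fix x' assume "x' \<in> M i"
        then show "(\<Sum>x\<in>M (Suc i). d (Suc i) x' x * v x) \<in> I" using v by (simp add: cyc_def)
      qed
      ultimately show ?thesis by (rule I_cong)
    qed
    then have "good (Suc i) S'" by (auto simp: good_def)
    then show ?thesis using step by blast
  qed
  ultimately obtain s where "\<And>i. good i (s i)" "\<And>i. step i (s i) (s (Suc i))"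
    using dependent_nat_choice[of good step] by metis
  then show ?thesis unfolding good_def step_def by blast
qed


lemma chain_map_compose_minus_id:
  assumes f: "chain_map M d N e f" "lifts M g N h f" and k: "chain_map N e M d k" "lifts N h M g k"
    and fin: "\<And>i. finite (M i)"
  defines "c \<equiv> \<lambda>i y x. (\<Sum>z\<in>N i. k i y z * f i z x) - (if y = x then 1 else 0)"
  shows "chain_map M d M d c" "lifts M (\<lambda>_. 0) M g c"
proof -
  have delta: "(\<Sum>y\<in>M i. a y * (if y = x then 1 else 0)) = a x"
    "(\<Sum>y\<in>M i. (if x = y then 1 else 0) * a y) = a x" if "x \<in> M i" for a :: "'b \<Rightarrow> 'a" and x i
    using that fin[of i] by (simp_all add: if_distrib[of "\<lambda>b. _ * b"] if_distrib[of "\<lambda>b. b * _"] sum.delta sum.delta' cong: if_cong)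
  show "chain_map M d M d c"
    unfolding chain_map_def
  proof (intro allI ballI)
    fix i x y assume x: "x \<in> M (Suc i)" and y: "y \<in> M i"
    have 1: "(\<Sum>z\<in>N (Suc i). ((\<Sum>y'\<in>M (Suc i). d (Suc i) y y' * k (Suc i) y' z)
        - (\<Sum>z'\<in>N i. k i y z' * e (Suc i) z' z)) * f (Suc i) z x) \<in> I"
      using k(1) y by (intro I_sum I_mult') (auto simp: chain_map_def)
    have 2: "(\<Sum>z\<in>N i. k i y z * ((\<Sum>z'\<in>N (Suc i). e (Suc i) z z' * f (Suc i) z' x)
        - (\<Sum>x'\<in>M i. f i z x' * d (Suc i) x' x))) \<in> I"
      using f(1) x by (intro I_sum I_mult) (auto simp: chain_map_def)
    have "(\<Sum>y'\<in>M (Suc i). d (Suc i) y y' * (\<Sum>z\<in>N (Suc i). k (Suc i) y' z * f (Suc i) z x))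
        - (\<Sum>x'\<in>M i. (\<Sum>z\<in>N i. k i y z * f i z x') * d (Suc i) x' x) \<in> I"
      using I_add[OF 1 2]
      unfolding left_diff_distrib right_diff_distrib sum_subtractf sum_mat_assoc[symmetric]
      by (simp add: sum_mat_assoc)
    then show "(\<Sum>y'\<in>M (Suc i). d (Suc i) y y' * c (Suc i) y' x) - (\<Sum>x'\<in>M i. c i y x' * d (Suc i) x' x) \<in> I"
      using x y by (simp add: c_def left_diff_distrib right_diff_distrib sum_subtractf delta)
  qed
  show "lifts M (\<lambda>_. 0) M g c"
    unfolding lifts_def
  proof
    fix x assume x: "x \<in> M 0"
    have "(\<Sum>y\<in>M 0. \<epsilon> (\<Sum>z\<in>N 0. k 0 y z * f 0 z x) * g y)
        = (\<Sum>y\<in>M 0. g y * (\<Sum>z\<in>N 0. \<epsilon> (k 0 y z) * \<epsilon> (f 0 z x)))"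
      by (simp add: \<epsilon>_mult mult.commute)
    also have "\<dots> = (\<Sum>z\<in>N 0. (\<Sum>y\<in>M 0. g y * \<epsilon> (k 0 y z)) * \<epsilon> (f 0 z x))" by (rule sum_mat_assoc)
    also have "\<dots> = (\<Sum>z\<in>N 0. h z * \<epsilon> (f 0 z x))"
      using k(2) by (intro sum.cong) (auto simp: lifts_def mult.commute)
    also have "\<dots> = g x" using f(2) x by (simp add: lifts_def mult.commute)
    finally have "(\<Sum>y\<in>M 0. \<epsilon> (\<Sum>z\<in>N 0. k 0 y z * f 0 z x) * g y) = g x" .
    moreover have "(\<Sum>y\<in>M 0. (if y = x then 1 else 0) * g y) = g x"
      using x fin[of 0] by (simp add: if_distrib[of "\<lambda>b. b * _"] sum.delta cong: if_cong)
    moreover have "\<epsilon> (if y = x then 1 else 0) = (if y = x then 1 else 0)" for y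
      by (simp add: \<epsilon>_1)
    ultimately show "(\<Sum>y\<in>M 0. \<epsilon> (c 0 y x) * g y) = 0"
      by (simp add: c_def left_diff_distrib sum_subtractf del: \<epsilon>_sum)
  qed
qed

end

text \<open>
  The vectors \<open>b y\<close> span a complement of \<open>B\<close> in \<open>Z\<close>, with dual coordinates \<open>\<phi> y\<close> that vanish on \<open>B\<close>.
\<close>

lemma (in vector_space) dim_complement:
  fixes b :: "'y \<Rightarrow> 'b" and \<phi> :: "'y \<Rightarrow> 'b \<Rightarrow> 'a"
  assumes fin: "finite S" "B \<subseteq> span S" and sub: "subspace B" and Y: "finite N"
    and \<phi>: "\<And>y v w. \<phi> y (v + w) = \<phi> y v + \<phi> y w" "\<And>y c v. \<phi> y (scale c v) = c * \<phi> y v"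
    and B: "\<And>y v. y \<in> N \<Longrightarrow> v \<in> B \<Longrightarrow> \<phi> y v = 0"
    and dual: "\<And>y y'. y \<in> N \<Longrightarrow> y' \<in> N \<Longrightarrow> \<phi> y (b y') = (if y = y' then 1 else 0)"
    and Z: "subspace Z" "B \<subseteq> Z" "\<And>y. y \<in> N \<Longrightarrow> b y \<in> Z"
      "\<And>v. v \<in> Z \<Longrightarrow> v - (\<Sum>y\<in>N. scale (\<phi> y v) (b y)) \<in> B"
  shows "dim Z = dim B + card N"
proof -
  obtain C where C: "C \<subseteq> B" "independent C" "B \<subseteq> span C" using basis_exists[of B] by metis
  have finC: "finite C" using independent_span_bound[OF fin(1) C(2)] C(1) fin(2) by auto
  have spanC: "span C = B" using C sub by (metis span_minimal subset_antisym)
  have \<phi>0: "\<phi> y 0 = 0" for y using \<phi>(2)[of y 0 0] by simp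
  have kernel: "\<phi> y v = 0" if "v \<in> span A" "\<And>a. a \<in> A \<Longrightarrow> \<phi> y a = 0" for y v A
    using that by (induction rule: span_induct_alt) (auto simp: \<phi> \<phi>0)
  have "independent (C \<union> b ` N') \<and> card (C \<union> b ` N') = card C + card N'" if "N' \<subseteq> N" for N'
    using finite_subset[OF that Y] that
  proof (induction N')
    case (insert y N')
    have "\<phi> y a = 0" if "a \<in> C \<union> b ` N'" for a
      using that insert.prems insert.hyps C(1) B dual by auto
    then have "b y \<notin> span (C \<union> b ` N')"
      using kernel[of "b y" "C \<union> b ` N'" y] dual[of y y] insert.prems by auto
    note new = this
    have nin: "b y \<notin> C \<union> b ` N'" by (rule contrapos_nn[OF new]) (rule span_base)
    have IH: "independent (C \<union> b ` N')" "card (C \<union> b ` N') = card C + card N'"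
      using insert.IH insert.prems by simp_all
    have ins: "C \<union> b ` insert y N' = insert (b y) (C \<union> b ` N')" by simp
    have "independent (insert (b y) (C \<union> b ` N'))" by (rule independent_insertI[OF new IH(1)])
    moreover have "card (insert (b y) (C \<union> b ` N')) = Suc (card (C \<union> b ` N'))"
      using nin finC insert.hyps(1) by (intro card_insert_disjoint) auto
    ultimately show ?case unfolding ins using IH(2) insert.hyps by simp
  qed (use C in simp)
  from this[of N] have ind: "independent (C \<union> b ` N)" and card: "card (C \<union> b ` N) = card C + card N" by auto
  have "span (C \<union> b ` N) = Z"
  proof
    show "span (C \<union> b ` N) \<subseteq> Z" using Z C(1) by (intro span_minimal) auto
    show "Z \<subseteq> span (C \<union> b ` N)"
    proof
      fix v assume "v \<in> Z"
      then have "v - (\<Sum>y\<in>N. scale (\<phi> y v) (b y)) \<in> span C" using Z(4) spanC by simp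
      then have "v - (\<Sum>y\<in>N. scale (\<phi> y v) (b y)) \<in> span (C \<union> b ` N)"
        using span_mono[of C "C \<union> b ` N"] by auto
      moreover have "(\<Sum>y\<in>N. scale (\<phi> y v) (b y)) \<in> span (C \<union> b ` N)"
        by (intro span_sum span_scale span_base) auto
      ultimately show "v \<in> span (C \<union> b ` N)" by (metis diff_add_cancel span_add)
    qed
  qed
  then have "dim Z = card C + card N" using dim_eq_card[OF _ ind] card by (metis span_span)
  moreover have "dim B = card C" using dim_eq_card[OF _ C(2)] spanC by (metis span_span)
  ultimately show ?thesis by simp
qed

lemma vector_space_pointwise: "vector_space (\<lambda>(c :: 'k::field) (v :: nat \<Rightarrow> 'k) j. c * v j)"
  by unfold_locales (auto simp: fun_eq_iff algebra_simps)

lemma sum_apply: "(sum f A) x = (\<Sum>a\<in>A. f a x :: 'k::comm_monoid_add)"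
  by (induction A rule: infinite_finite_induct) auto

context residue_ideal begin

definition cycles_mod :: "(nat \<Rightarrow> nat) \<Rightarrow> (nat \<Rightarrow> nat \<Rightarrow> nat \<Rightarrow> 'a) \<Rightarrow> nat \<Rightarrow> (nat \<Rightarrow> 'k) set" where
  "cycles_mod n d i = {v. (\<forall>j\<ge>n i. v j = 0) \<and>
     (i > 0 \<longrightarrow> (\<forall>y<n (i - 1). (\<Sum>x<n i. \<epsilon> (d i y x) * v x) = 0))}"

definition boundaries_mod :: "(nat \<Rightarrow> nat) \<Rightarrow> (nat \<Rightarrow> nat \<Rightarrow> nat \<Rightarrow> 'a) \<Rightarrow> nat \<Rightarrow> (nat \<Rightarrow> 'k) set" where
  "boundaries_mod n d i = {v. (\<forall>j\<ge>n i. v j = 0) \<and>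
     (\<exists>w. \<forall>x<n i. v x = (\<Sum>z<n (Suc i). \<epsilon> (d (Suc i) x z) * w z))}"

text \<open>
  Let \<open>f\<close> and \<open>k\<close> be comparison maps from \<open>M\<close> to \<open>N\<close> and back.  After reduction to the residue field
  the differential of \<open>N\<close> vanishes, so the homotopy between \<open>f k\<close> and the identity is zero and
  \<open>f k\<close> is the identity, whereas \<open>k f\<close> differs from the identity by boundaries on cycles.  Hence \<open>k\<close>
  maps the reduced module of \<open>N\<close> onto a complement of the boundaries among the cycles of \<open>M\<close>, and
  \<open>f\<close> supplies the coordinates on this complement.
\<close>

theorem homology_dim_eq_minimal_rank:
  assumes M: "is_resolution (\<lambda>i. {..<n i}) d g" and N: "is_resolution N e h"
    and minimal: "\<And>i y y'. y \<in> N i \<Longrightarrow> y' \<in> N (Suc i) \<Longrightarrow> \<epsilon> (e (Suc i) y y') = 0"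
  shows "vector_space.dim (\<lambda>c v j. c * v j) (cycles_mod n d i)
       = vector_space.dim (\<lambda>c v j. c * v j) (boundaries_mod n d i) + card (N i)"
proof -
  interpret vs: vector_space "\<lambda>(c :: 'k) (v :: nat \<Rightarrow> 'k) j. c * v j" by (rule vector_space_pointwise)
  define M' where "M' i = {..<n i}" for i
  have M: "is_resolution M' d g" using M by (simp add: M'_def[abs_def])
  have finN: "finite (N i)" and finM: "finite (M' i)" for i using N by (auto simp: is_resolution_def M'_def)
  obtain f where f: "chain_map M' d N e f" "lifts M' g N h f" using chain_map_exists[OF M N] by blast
  obtain k where k: "chain_map N e M' d k" "lifts N h M' g k" using chain_map_exists[OF N M] by blast
  have f_eq: "(\<Sum>x'\<in>M' i. \<epsilon> (f i y x') * \<epsilon> (d (Suc i) x' x)) = 0"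
    if "x \<in> M' (Suc i)" "y \<in> N i" for x y i
  proof -
    have "\<epsilon> (\<Sum>y'\<in>N (Suc i). e (Suc i) y y' * f (Suc i) y' x) = \<epsilon> (\<Sum>x'\<in>M' i. f i y x' * d (Suc i) x' x)"
      using f(1) that by (intro \<epsilon>_cong) (auto simp: chain_map_def)
    then show ?thesis using minimal that by (simp add: \<epsilon>_mult)
  qed
  have k_eq: "(\<Sum>x'\<in>M' (Suc i). \<epsilon> (d (Suc i) x x') * \<epsilon> (k (Suc i) x' y)) = 0"
    if "y \<in> N (Suc i)" "x \<in> M' i" for x y i
  proof -
    have "\<epsilon> (\<Sum>x'\<in>M' (Suc i). d (Suc i) x x' * k (Suc i) x' y) = \<epsilon> (\<Sum>y'\<in>N i. k i x y' * e (Suc i) y' y)"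
      using k(1) that by (intro \<epsilon>_cong) (auto simp: chain_map_def)
    then show ?thesis using minimal that by (simp add: \<epsilon>_mult)
  qed
  obtain s where s: "\<And>x y. x \<in> N 0 \<Longrightarrow> y \<in> N 0 \<Longrightarrow>
        (\<Sum>z\<in>M' 0. f 0 y z * k 0 z x) - (if y = x then 1 else 0) - (\<Sum>y'\<in>N 1. e 1 y y' * s 0 y' x) \<in> I"
      "\<And>i x y. x \<in> N (Suc i) \<Longrightarrow> y \<in> N (Suc i) \<Longrightarrow>
        (\<Sum>z\<in>M' (Suc i). f (Suc i) y z * k (Suc i) z x) - (if y = x then 1 else 0)
        - ((\<Sum>y'\<in>N (Suc (Suc i)). e (Suc (Suc i)) y y' * s (Suc i) y' x)
            + (\<Sum>x'\<in>N i. s i y x' * e (Suc i) x' x)) \<in> I"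
    using chain_homotopy_exists[OF N N chain_map_compose_minus_id[OF k f finN]] by blast
  have fk: "(\<Sum>z\<in>M' i. \<epsilon> (f i y z) * \<epsilon> (k i z x)) = (if y = x then 1 else 0)"
    if xy: "x \<in> N i" "y \<in> N i" for x y i
  proof (cases i)
    case 0
    then have xy: "x \<in> N 0" "y \<in> N 0" using xy by auto
    from \<epsilon>_I[OF s(1)[OF xy]] show ?thesis
      using minimal[of _ 0] xy 0 by (simp add: \<epsilon>_mult \<epsilon>_1 if_distrib[of \<epsilon>] cong: if_cong)
  next
    case (Suc j)
    then have xy: "x \<in> N (Suc j)" "y \<in> N (Suc j)" using xy by auto
    from \<epsilon>_I[OF s(2)[OF xy]] show ?thesis
      using minimal xy Suc by (simp add: \<epsilon>_mult \<epsilon>_1 \<epsilon>_add if_distrib[of \<epsilon>] cong: if_cong)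
  qed
  obtain t where t: "\<And>x y. x \<in> M' 0 \<Longrightarrow> y \<in> M' 0 \<Longrightarrow>
        (\<Sum>z\<in>N 0. k 0 y z * f 0 z x) - (if y = x then 1 else 0) - (\<Sum>y'\<in>M' 1. d 1 y y' * t 0 y' x) \<in> I"
      "\<And>i x y. x \<in> M' (Suc i) \<Longrightarrow> y \<in> M' (Suc i) \<Longrightarrow>
        (\<Sum>z\<in>N (Suc i). k (Suc i) y z * f (Suc i) z x) - (if y = x then 1 else 0)
        - ((\<Sum>y'\<in>M' (Suc (Suc i)). d (Suc (Suc i)) y y' * t (Suc i) y' x)
            + (\<Sum>x'\<in>M' i. t i y x' * d (Suc i) x' x)) \<in> I"
    using chain_homotopy_exists[OF M M chain_map_compose_minus_id[OF f k finM]] by blast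
  have homotopy: "(\<Sum>z\<in>N i. \<epsilon> (k i y z) * (\<Sum>x\<in>M' i. \<epsilon> (f i z x) * v x)) - v y
        = (\<Sum>y'\<in>M' (Suc i). \<epsilon> (d (Suc i) y y') * (\<Sum>x\<in>M' i. \<epsilon> (t i y' x) * v x))"
    if v: "v \<in> cycles_mod n d i" and y: "y \<in> M' i" for v y i
  proof -
    have delta: "(\<Sum>x\<in>M' i. (if y = x then 1 else 0) * v x) = v y"
      using y finM[of i] by (simp add: if_distrib[of "\<lambda>b. b * _"] sum.delta' cong: if_cong)
    show ?thesis
    proof (cases i)
      case 0
      have "(\<Sum>z\<in>N 0. \<epsilon> (k 0 y z) * \<epsilon> (f 0 z x)) - (if y = x then 1 else 0)
          = (\<Sum>y'\<in>M' 1. \<epsilon> (d 1 y y') * \<epsilon> (t 0 y' x))" if "x \<in> M' 0" for x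
        using \<epsilon>_I[OF t(1)[OF that, of y]] y 0 by (simp add: \<epsilon>_mult \<epsilon>_1 if_distrib[of \<epsilon>] cong: if_cong)
      then have "(\<Sum>x\<in>M' 0. ((\<Sum>z\<in>N 0. \<epsilon> (k 0 y z) * \<epsilon> (f 0 z x)) - (if y = x then 1 else 0)) * v x)
          = (\<Sum>x\<in>M' 0. (\<Sum>y'\<in>M' 1. \<epsilon> (d 1 y y') * \<epsilon> (t 0 y' x)) * v x)"
        by (intro sum.cong) auto
      then show ?thesis
        using delta 0 unfolding sum_mat_assoc by (simp add: left_diff_distrib sum_subtractf)
    next
      case (Suc j)
      have "(\<Sum>z\<in>N i. \<epsilon> (k i y z) * \<epsilon> (f i z x)) - (if y = x then 1 else 0)
          = (\<Sum>y'\<in>M' (Suc i). \<epsilon> (d (Suc i) y y') * \<epsilon> (t i y' x))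
          + (\<Sum>x'\<in>M' j. \<epsilon> (t j y x') * \<epsilon> (d (Suc j) x' x))" if "x \<in> M' i" for x
        using \<epsilon>_I[OF t(2)[of x j y]] that y Suc
        by (simp add: \<epsilon>_mult \<epsilon>_1 \<epsilon>_add if_distrib[of \<epsilon>] cong: if_cong)
      then have "(\<Sum>x\<in>M' i. ((\<Sum>z\<in>N i. \<epsilon> (k i y z) * \<epsilon> (f i z x)) - (if y = x then 1 else 0)) * v x)
          = (\<Sum>x\<in>M' i. ((\<Sum>y'\<in>M' (Suc i). \<epsilon> (d (Suc i) y y') * \<epsilon> (t i y' x))
          + (\<Sum>x'\<in>M' j. \<epsilon> (t j y x') * \<epsilon> (d (Suc j) x' x))) * v x)"
        by (intro sum.cong) auto
      also have "\<dots> = (\<Sum>y'\<in>M' (Suc i). \<epsilon> (d (Suc i) y y') * (\<Sum>x\<in>M' i. \<epsilon> (t i y' x) * v x))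
          + (\<Sum>x'\<in>M' j. \<epsilon> (t j y x') * (\<Sum>x\<in>M' i. \<epsilon> (d (Suc j) x' x) * v x))"
        unfolding sum_mat_assoc by (simp add: distrib_right sum.distrib)
      also have "(\<Sum>x'\<in>M' j. \<epsilon> (t j y x') * (\<Sum>x\<in>M' i. \<epsilon> (d (Suc j) x' x) * v x)) = 0"
        using v Suc by (intro sum.neutral) (auto simp: cycles_mod_def M'_def)
      finally show ?thesis
        using delta unfolding sum_mat_assoc by (simp add: left_diff_distrib sum_subtractf)
    qed
  qed
  define b where "b y = (\<lambda>x. if x < n i then \<epsilon> (k i x y) else 0)" for y
  define \<phi> where "\<phi> y v = (\<Sum>x\<in>M' i. \<epsilon> (f i y x) * v x)" for y and v :: "nat \<Rightarrow> 'k"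
  define S where "S = (\<lambda>a x. if x = a then 1 else 0 :: 'k) ` {..<n i}"
  have spanS: "v \<in> vs.span S" if v: "\<forall>j\<ge>n i. v j = 0" for v
  proof -
    have "v = (\<Sum>a<n i. (\<lambda>x. v a * (if x = a then 1 else 0)))"
    proof
      fix x
      have "(\<Sum>a<n i. (\<lambda>x. v a * (if x = a then 1 else 0))) x = (\<Sum>a<n i. v a * (if x = a then 1 else 0))"
        by (rule sum_apply)
      then show "v x = (\<Sum>a<n i. (\<lambda>x. v a * (if x = a then 1 else 0))) x"
        using v by (simp add: if_distrib[of "\<lambda>b. _ * b"] sum.delta cong: if_cong)
    qed
    also have "\<dots> \<in> vs.span S"
      by (intro vs.span_sum vs.span_scale[of "\<lambda>x. if x = _ then 1 else 0"] vs.span_base) (auto simp: S_def)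
    finally show ?thesis .
  qed
  have subB: "vs.subspace (boundaries_mod n d i)"
    unfolding vs.subspace_def
  proof (intro conjI allI ballI)
    show "0 \<in> boundaries_mod n d i" by (auto simp: boundaries_mod_def intro!: exI[of _ "\<lambda>_. 0"])
  next
    fix v w assume "v \<in> boundaries_mod n d i" "w \<in> boundaries_mod n d i"
    then obtain p q where "\<forall>j\<ge>n i. v j = 0" "\<forall>j\<ge>n i. w j = 0"
      "\<forall>x<n i. v x = (\<Sum>z<n (Suc i). \<epsilon> (d (Suc i) x z) * p z)"
      "\<forall>x<n i. w x = (\<Sum>z<n (Suc i). \<epsilon> (d (Suc i) x z) * q z)"
      by (auto simp: boundaries_mod_def)
    then show "v + w \<in> boundaries_mod n d i"
      by (auto simp: boundaries_mod_def distrib_left sum.distrib intro!: exI[of _ "\<lambda>z. p z + q z"])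
  next
    fix c v assume "v \<in> boundaries_mod n d i"
    then obtain p where "\<forall>j\<ge>n i. v j = 0"
      "\<forall>x<n i. v x = (\<Sum>z<n (Suc i). \<epsilon> (d (Suc i) x z) * p z)"
      by (auto simp: boundaries_mod_def)
    then show "(\<lambda>j. c * v j) \<in> boundaries_mod n d i"
      by (auto simp: boundaries_mod_def sum_distrib_left mult_ac intro!: exI[of _ "\<lambda>z. c * p z"])
  qed
  have subZ: "vs.subspace (cycles_mod n d i)"
    unfolding vs.subspace_def cycles_mod_def
    by (auto simp: distrib_left sum.distrib mult.left_commute[of _ "_ :: 'k"] simp flip: sum_distrib_left)
  show ?thesis
  proof (rule vs.dim_complement[where S = S and b = b and \<phi> = \<phi>])
    show "finite S" by (simp add: S_def)
    show "boundaries_mod n d i \<subseteq> vs.span S" using spanS by (auto simp: boundaries_mod_def)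
    show "vs.subspace (boundaries_mod n d i)" "vs.subspace (cycles_mod n d i)" "finite (N i)"
      by (rule subB subZ finN)+
    show "\<phi> y (v + w) = \<phi> y v + \<phi> y w" for y v w by (simp add: \<phi>_def distrib_left sum.distrib)
    show "\<phi> y (\<lambda>j. c * v j) = c * \<phi> y v" for y c v by (simp add: \<phi>_def sum_distrib_left mult_ac)
    show "\<phi> y v = 0" if y: "y \<in> N i" and v: "v \<in> boundaries_mod n d i" for y v
    proof -
      obtain w where w: "\<And>x. x < n i \<Longrightarrow> v x = (\<Sum>z\<in>M' (Suc i). \<epsilon> (d (Suc i) x z) * w z)"
        using v by (auto simp: boundaries_mod_def M'_def)
      have "\<phi> y v = (\<Sum>x\<in>M' i. \<epsilon> (f i y x) * (\<Sum>z\<in>M' (Suc i). \<epsilon> (d (Suc i) x z) * w z))"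
        unfolding \<phi>_def using w by (intro sum.cong) (auto simp: M'_def)
      also have "\<dots> = 0" unfolding sum_mat_assoc using f_eq y by simp
      finally show ?thesis .
    qed
    show "\<phi> y (b y') = (if y = y' then 1 else 0)" if "y \<in> N i" "y' \<in> N i" for y y'
      using fk[OF that(2,1)] unfolding \<phi>_def b_def M'_def by simp
    show "b y \<in> cycles_mod n d i" if "y \<in> N i" for y
      using that k_eq[of y "i - 1"] by (cases i) (auto simp: cycles_mod_def b_def M'_def)
    show "boundaries_mod n d i \<subseteq> cycles_mod n d i"
    proof
      fix v assume v: "v \<in> boundaries_mod n d i"
      then obtain w where w: "\<And>x. x < n i \<Longrightarrow> v x = (\<Sum>z\<in>M' (Suc i). \<epsilon> (d (Suc i) x z) * w z)"
        by (auto simp: boundaries_mod_def M'_def)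
      have "(\<Sum>x<n i. \<epsilon> (d i y x) * v x) = 0" if i: "i = Suc j" and y: "y < n j" for j y
      proof -
        have "\<epsilon> (\<Sum>x\<in>M' i. d i y x * d (Suc i) x z) = 0" if "z \<in> M' (Suc i)" for z
          using resolution_column_cyc[OF M that] i y by (intro \<epsilon>_I) (auto simp: cyc_def M'_def)
        then have dd: "(\<Sum>x\<in>M' i. \<epsilon> (d i y x) * \<epsilon> (d (Suc i) x z)) = 0" if "z \<in> M' (Suc i)" for z
          using that by (simp add: \<epsilon>_mult)
        have "(\<Sum>x<n i. \<epsilon> (d i y x) * v x) = (\<Sum>x\<in>M' i. \<epsilon> (d i y x) * (\<Sum>z\<in>M' (Suc i). \<epsilon> (d (Suc i) x z) * w z))"
          using w by (intro sum.cong) (auto simp: M'_def)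
        also have "\<dots> = 0" unfolding sum_mat_assoc using dd by simp
        finally show ?thesis .
      qed
      then show "v \<in> cycles_mod n d i" using v by (cases i) (auto simp: cycles_mod_def boundaries_mod_def)
    qed
    show "v - (\<Sum>y\<in>N i. (\<lambda>j. \<phi> y v * b y j)) \<in> boundaries_mod n d i" if v: "v \<in> cycles_mod n d i" for v
    proof -
      have app: "(\<Sum>y\<in>N i. (\<lambda>j. \<phi> y v * b y j)) x = (\<Sum>y\<in>N i. \<phi> y v * b y x)" for x
        by (rule sum_apply)
      define w where "w = (\<lambda>z. - (\<Sum>x\<in>M' i. \<epsilon> (t i z x) * v x))"
      have "v x - (\<Sum>y\<in>N i. \<phi> y v * b y x) = (\<Sum>z<n (Suc i). \<epsilon> (d (Suc i) x z) * w z)" if "x < n i" for x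
        using homotopy[OF v, of x] that
        by (simp add: w_def M'_def \<phi>_def b_def sum_negf mult.commute algebra_simps)
      moreover have "v x - (\<Sum>y\<in>N i. \<phi> y v * b y x) = 0" if "x \<ge> n i" for x
        using that v by (simp add: b_def cycles_mod_def)
      ultimately show ?thesis unfolding boundaries_mod_def by (auto simp: app)
    qed
  qed
qed

end

section \<open>Betti numbers as the ranks of a minimal resolution\<close>

locale mpoly_residue_ideal = residue_ideal I "const_coeff :: ('v, 'k::field) mpoly \<Rightarrow> 'k"
  for I :: "('v, 'k::field) mpoly set"
begin

abbreviation quot :: "('v, 'k) mpoly set ring" where "quot \<equiv> mpoly_ring Quot I"

abbreviation field_module :: "(('v, 'k) mpoly set, 'k) module" where "field_module \<equiv> residue_module"

definition proj :: "('v, 'k) mpoly \<Rightarrow> ('v, 'k) mpoly set" where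
  "proj p = I +>\<^bsub>mpoly_ring\<^esub> p"

lemma ideal_I: "ideal I mpoly_ring"
  by (rule ideal_mpoly_ringI) (auto intro: I_0 I_add I_mult)

lemma proj_eq: "proj p = (\<lambda>a. a + p) ` I"
  by (auto simp: proj_def a_r_coset_def r_coset_def ring_of_type_algebra_def)

lemma proj_eq_iff: "proj p = proj q \<longleftrightarrow> p - q \<in> I"
proof
  assume "proj p = proj q"
  then have "0 + p \<in> proj q" using I_0 unfolding proj_eq by blast
  then obtain a where "a \<in> I" "p = a + q" by (auto simp: proj_eq)
  then show "p - q \<in> I" by simp
next
  have sub: "proj p \<subseteq> proj q" if pq: "p - q \<in> I" for p q
  proof
    fix x assume "x \<in> proj p"
    then obtain a where "a \<in> I" "x = a + p" by (auto simp: proj_eq)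
    then have "a + (p - q) \<in> I" "x = (a + (p - q)) + q" using pq by (auto intro: I_add)
    then show "x \<in> proj q" unfolding proj_eq by blast
  qed
  assume "p - q \<in> I"
  then show "proj p = proj q" using sub I_sym by blast
qed

lemma proj_0: "proj 0 = I"
  by (simp add: proj_eq)

lemma carrier_quot: "carrier quot = range proj"
  by (auto simp: FactRing_def A_RCOSETS_def RCOSETS_def proj_def a_r_coset_def ring_of_type_algebra_def)

lemma quot_simps:
  "\<zero>\<^bsub>quot\<^esub> = I" "proj p \<otimes>\<^bsub>quot\<^esub> proj q = proj (p * q)" "proj p \<oplus>\<^bsub>quot\<^esub> proj q = proj (p + q)"
proof -
  interpret ideal I "mpoly_ring :: ('v, 'k) mpoly ring" by (rule ideal_I)
  show "\<zero>\<^bsub>quot\<^esub> = I" by (simp add: FactRing_def)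
  show "proj p \<otimes>\<^bsub>quot\<^esub> proj q = proj (p * q)"
    using ring_hom_mult[OF rcos_ring_hom, of p q] by (simp add: proj_def)
  show "proj p \<oplus>\<^bsub>quot\<^esub> proj q = proj (p + q)"
    using ring_hom_add[OF rcos_ring_hom, of p q] by (simp add: proj_def)
qed

lemma abelian_monoid_self_module: "abelian_monoid (self_module quot)"
proof -
  interpret Q: ring quot by (rule ideal.quotient_is_ring[OF ideal_I])
  show ?thesis
    by (rule abelian_monoidI) (simp_all add: self_module_def Q.a_assoc, metis Q.a_comm)
qed

lemma finsum_self_module:
  assumes "finite A"
  shows "finsum (self_module quot) (\<lambda>j. proj (f j)) A = proj (sum f A)"
  using assms
proof (induction A)
  interpret S: abelian_monoid "self_module quot" by (rule abelian_monoid_self_module)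
  case empty
  show ?case unfolding S.finsum_empty using quot_simps(1) by (simp add: proj_0 self_module_def)
next
  interpret S: abelian_monoid "self_module quot" by (rule abelian_monoid_self_module)
  case (insert x A)
  have "finsum (self_module quot) (\<lambda>j. proj (f j)) (insert x A)
      = proj (f x) \<oplus>\<^bsub>self_module quot\<^esub> finsum (self_module quot) (\<lambda>j. proj (f j)) A"
    using insert by (intro S.finsum_insert) (auto simp: carrier_quot self_module_def)
  then show ?case using insert quot_simps(3) by (simp add: self_module_def)
qed

lemma finsum_residue_module:
  assumes "finite A"
  shows "finsum field_module f A = sum f A"
proof -
  interpret R: abelian_monoid field_module
    by (rule abelian_monoidI) (simp_all add: residue_module_def algebra_simps)
  show ?thesis
    using assms
  proof (induction A)
    case empty
    show ?case using R.finsum_empty by (simp add: residue_module_def)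
  next
    case (insert x A)
    have "finsum field_module f (insert x A)
        = f x \<oplus>\<^bsub>field_module\<^esub> finsum field_module f A"
      using insert by (intro R.finsum_insert) (auto simp: residue_module_def)
    then show ?case using insert by (simp add: residue_module_def)
  qed
qed

text \<open>
  All members of a residue class have the same constant coefficient because \<open>I\<close> lies in the kernel
  of \<open>const_coeff\<close>.
\<close>

lemma residue_module_simps:
  "carrier field_module = UNIV" "\<zero>\<^bsub>field_module\<^esub> = 0"
  "proj p \<odot>\<^bsub>field_module\<^esub> c = const_coeff p * c"
proof -
  have "(\<lambda>f. Poly_Mapping.lookup f 0) ` proj p = {const_coeff p}"
    using I_0 \<epsilon>_I by (force simp: proj_eq const_coeff_def lookup_add)
  then show "proj p \<odot>\<^bsub>field_module\<^esub> c = const_coeff p * c"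
    by (simp add: residue_module_def)
qed (simp_all add: residue_module_def)

definition vec :: "nat \<Rightarrow> (nat \<Rightarrow> ('v, 'k) mpoly) \<Rightarrow> nat \<Rightarrow> ('v, 'k) mpoly set" where
  "vec n v = (\<lambda>j. if j < n then proj (v j) else I)"

lemma vec_eq_iff: "vec n v = vec n w \<longleftrightarrow> (\<forall>j<n. v j - w j \<in> I)"
  by (auto simp: vec_def fun_eq_iff proj_eq_iff)

lemma free_power_self_module: "free_power (self_module quot) n = range (vec n)"
proof (intro subset_antisym subsetI)
  fix u assume "u \<in> free_power (self_module quot) n"
  then have u: "\<And>j. j < n \<Longrightarrow> u j \<in> range proj" "\<And>j. j \<ge> n \<Longrightarrow> u j = I"
    using quot_simps(1) by (simp_all add: free_power_def self_module_def carrier_quot)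
  define v where "v j = (SOME p. u j = proj p)" for j
  have "u j = proj (v j)" if "j < n" for j
    unfolding v_def by (rule someI_ex) (use u(1)[OF that] in auto)
  then have "u = vec n v" using u(2) by (auto simp: vec_def fun_eq_iff)
  then show "u \<in> range (vec n)" by simp
next
  fix u assume "u \<in> range (vec n)"
  then obtain v where "u = vec n v" by blast
  then show "u \<in> free_power (self_module quot) n"
    by (simp add: free_power_def self_module_def carrier_quot vec_def quot_simps(1))
qed

context
  fixes F :: "(('v, 'k) mpoly set, 'k) free_cplx" and d :: "nat \<Rightarrow> nat \<Rightarrow> nat \<Rightarrow> ('v, 'k) mpoly"
  assumes d: "\<And>i a b. i > 0 \<Longrightarrow> a < rk F (i - 1) \<Longrightarrow> b < rk F i \<Longrightarrow> dmat F i a b = proj (d i a b)"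
begin

lemma differential_vec:
  assumes "i > 0"
  shows "differential (self_module quot) F i (vec (rk F i) v)
       = vec (rk F (i - 1)) (\<lambda>a. \<Sum>b<rk F i. d i a b * v b)"
proof
  fix a
  interpret S: abelian_monoid "self_module quot" by (rule abelian_monoid_self_module)
  show "differential (self_module quot) F i (vec (rk F i) v) a
       = vec (rk F (i - 1)) (\<lambda>a. \<Sum>b<rk F i. d i a b * v b) a"
  proof (cases "a < rk F (i - 1)")
    case True
    have "(\<Oplus>\<^bsub>self_module quot\<^esub>b\<in>{..<rk F i}. dmat F i a b \<odot>\<^bsub>self_module quot\<^esub> vec (rk F i) v b)
        = (\<Oplus>\<^bsub>self_module quot\<^esub>b\<in>{..<rk F i}. proj (d i a b * v b))"
    proof (rule S.finsum_cong')
      fix b assume "b \<in> {..<rk F i}"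
      then show "dmat F i a b \<odot>\<^bsub>self_module quot\<^esub> vec (rk F i) v b = proj (d i a b * v b)"
        using d[OF assms True, of b] quot_simps(2) by (simp add: self_module_def vec_def)
    qed (auto simp: self_module_def carrier_quot)
    then show ?thesis using True by (simp add: differential_def mat_app_def vec_def finsum_self_module)
  next
    case False
    then show ?thesis using quot_simps(1) by (simp add: differential_def mat_app_def vec_def self_module_def)
  qed
qed

lemma augmentation_vec:
  "augmentation field_module F (vec (rk F 0) v)
     = (\<Sum>j<rk F 0. const_coeff (v j) * augm F j)"
  by (simp add: augmentation_def finsum_residue_module vec_def residue_module_simps)

lemma vec_in_boundaries:
  "vec (rk F i) v \<in> boundaries (self_module quot) F i
     \<longleftrightarrow> (\<exists>w. \<forall>x<rk F i. v x - (\<Sum>z<rk F (Suc i). d (Suc i) x z * w z) \<in> I)"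
proof -
  have "boundaries (self_module quot) F i
      = range (\<lambda>w. vec (rk F i) (\<lambda>a. \<Sum>b<rk F (Suc i). d (Suc i) a b * w b))"
    by (simp add: boundaries_def free_power_self_module image_image differential_vec)
  then show ?thesis by (simp add: image_iff vec_eq_iff)
qed

lemma boundaries_subset: "boundaries (self_module quot) F i \<subseteq> range (vec (rk F i))"
  by (auto simp: boundaries_def free_power_self_module image_image differential_vec)

lemma vec_in_cycles:
  assumes "i > 0"
  shows "vec (rk F i) v \<in> cycles (self_module quot) F i
     \<longleftrightarrow> (\<forall>y<rk F (i - 1). (\<Sum>x<rk F i. d i y x * v x) \<in> I)"
proof -
  have zero: "(\<lambda>_. \<zero>\<^bsub>self_module quot\<^esub>) = vec (rk F (i - 1)) (\<lambda>_. 0)"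
    by (simp add: self_module_def vec_def fun_eq_iff proj_0 quot_simps(1))
  show ?thesis
    unfolding cycles_def zero using assms
    by (simp add: free_power_self_module differential_vec vec_eq_iff rangeI)
qed

lemma cycles_subset: "cycles (self_module quot) F i \<subseteq> range (vec (rk F i))"
  by (auto simp: cycles_def free_power_self_module)

lemma subsets_of_range_eq_iff:
  "A \<subseteq> range f \<Longrightarrow> B \<subseteq> range f \<Longrightarrow> A = B \<longleftrightarrow> (\<forall>v. f v \<in> A \<longleftrightarrow> f v \<in> B)"
  by blast

text \<open>
  Passing to representatives of the matrix entries translates a free resolution over the quotient
  ring into congruences in the polynomial ring.
\<close>

lemma free_resolution_iff:
  "free_resolution quot field_module F
     \<longleftrightarrow> is_resolution (\<lambda>i. {..<rk F i}) d (augm F)"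
proof -
  define aug where "aug v = (\<Sum>j<rk F 0. const_coeff (v j) * augm F j)" for v :: "nat \<Rightarrow> ('v, 'k) mpoly"
  have 1: "\<forall>i>0. \<forall>a<rk F (i - 1). \<forall>b<rk F i. dmat F i a b \<in> carrier quot"
    using d by (auto simp: carrier_quot)
  have 2: "augmentation field_module F ` free_power (self_module quot) (rk F 0) = carrier field_module
      \<longleftrightarrow> (\<forall>c. \<exists>v. aug v = c)"
  proof -
    have "augmentation field_module F ` free_power (self_module quot) (rk F 0) = range aug"
      by (simp add: free_power_self_module image_image augmentation_vec aug_def)
    then show ?thesis unfolding residue_module_simps(1) surj_def
      by (simp only: surj_def) (rule all_cong1, rule ex_cong1, rule eq_commute)
  qed
  have 3: "{v \<in> free_power (self_module quot) (rk F 0). augmentation field_module F v = \<zero>\<^bsub>field_module\<^esub>}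
       = boundaries (self_module quot) F 0
      \<longleftrightarrow> (\<forall>v. aug v = 0 \<longleftrightarrow> (\<exists>w. \<forall>x<rk F 0. v x - (\<Sum>z<rk F 1. d 1 x z * w z) \<in> I))"
  proof (subst subsets_of_range_eq_iff[OF _ boundaries_subset])
    show "{v \<in> free_power (self_module quot) (rk F 0). augmentation field_module F v = \<zero>\<^bsub>field_module\<^esub>}
       \<subseteq> range (vec (rk F 0))" unfolding free_power_self_module by (rule Collect_restrict)
  qed (simp add: free_power_self_module vec_in_boundaries augmentation_vec aug_def residue_module_simps rangeI)
  have 4: "cycles (self_module quot) F i = boundaries (self_module quot) F i
      \<longleftrightarrow> (\<forall>v. (\<forall>y<rk F (i - 1). (\<Sum>x<rk F i. d i y x * v x) \<in> I)
        \<longleftrightarrow> (\<exists>w. \<forall>x<rk F i. v x - (\<Sum>z<rk F (Suc i). d (Suc i) x z * w z) \<in> I))" if "i > 0" for i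
    by (subst subsets_of_range_eq_iff[OF cycles_subset boundaries_subset])
       (simp only: vec_in_boundaries vec_in_cycles[OF that])
  define bd where "bd i v \<longleftrightarrow> (\<exists>w. \<forall>x<rk F i. v x - (\<Sum>z<rk F (Suc i). d (Suc i) x z * w z) \<in> I)" for i v
  define c where "c i v \<longleftrightarrow> cyc (\<lambda>i. {..<rk F i}) d (augm F) i v" for i v
  have c0: "c 0 v \<longleftrightarrow> aug v = 0" for v by (simp add: c_def cyc_def aug_def)
  have cS: "c i v \<longleftrightarrow> (\<forall>y<rk F (i - 1). (\<Sum>x<rk F i. d i y x * v x) \<in> I)" if "i > 0" for i v
    using that by (cases i) (simp_all add: c_def cyc_def Ball_def)
  have "is_resolution (\<lambda>i. {..<rk F i}) d (augm F) \<longleftrightarrow> (\<forall>c. \<exists>v. aug v = c) \<and> (\<forall>i v. c i v \<longleftrightarrow> bd i v)"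
    by (simp add: is_resolution_def c_def[symmetric] aug_def bd_def Ball_def)
  also have "(\<forall>i v. c i v \<longleftrightarrow> bd i v) \<longleftrightarrow> (\<forall>v. c 0 v \<longleftrightarrow> bd 0 v) \<and> (\<forall>i>0. \<forall>v. c i v \<longleftrightarrow> bd i v)"
    by (metis gr0I)
  also have "(\<forall>v. c 0 v \<longleftrightarrow> bd 0 v) \<longleftrightarrow>
      {v \<in> free_power (self_module quot) (rk F 0). augmentation field_module F v = \<zero>\<^bsub>field_module\<^esub>}
       = boundaries (self_module quot) F 0"
    unfolding 3 c0 bd_def by simp
  also have "(\<forall>i>0. \<forall>v. c i v \<longleftrightarrow> bd i v)
      \<longleftrightarrow> (\<forall>i>0. cycles (self_module quot) F i = boundaries (self_module quot) F i)"
    using cS 4 by (simp add: bd_def)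
  finally show ?thesis
    unfolding free_resolution_def 2 using 1 residue_module_simps(1) by blast
qed

lemma cycles_residue_module:
  "cycles field_module F i = cycles_mod (rk F) d i"
proof -
  have "differential field_module F i v
      = (\<lambda>a. if a < rk F (i - 1) then \<Sum>b<rk F i. const_coeff (d i a b) * v b else 0)" if "i > 0" for v
    using d that by (auto simp: differential_def mat_app_def finsum_residue_module residue_module_simps fun_eq_iff
        intro!: sum.cong)
  then show ?thesis
    by (auto simp: cycles_def cycles_mod_def free_power_def residue_module_simps fun_eq_iff)
qed

lemma boundaries_residue_module:
  "boundaries field_module F i = boundaries_mod (rk F) d i"
proof -
  have diff: "differential field_module F (Suc i) v
      = (\<lambda>a. if a < rk F i then \<Sum>b<rk F (Suc i). const_coeff (d (Suc i) a b) * v b else 0)" for v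
    using d[of "Suc i"] by (auto simp: differential_def mat_app_def finsum_residue_module residue_module_simps fun_eq_iff
        intro!: sum.cong)
  show ?thesis
  proof (intro subset_antisym subsetI)
    fix v assume "v \<in> boundaries_mod (rk F) d i"
    then obtain w where v: "\<forall>j\<ge>rk F i. v j = 0" "\<forall>x<rk F i. v x = (\<Sum>z<rk F (Suc i). const_coeff (d (Suc i) x z) * w z)"
      by (auto simp: boundaries_mod_def)
    define w' where "w' = (\<lambda>j. if j < rk F (Suc i) then w j else 0)"
    have "v = differential field_module F (Suc i) w'"
      using v by (auto simp: diff w'_def fun_eq_iff)
    moreover have "w' \<in> free_power field_module (rk F (Suc i))"
      by (simp add: w'_def free_power_def residue_module_simps)
    ultimately show "v \<in> boundaries field_module F i" by (auto simp: boundaries_def)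
  qed (auto simp: boundaries_def boundaries_mod_def diff)
qed

end

lemma is_resolution_reindex:
  fixes N :: "nat \<Rightarrow> 'y set" and \<phi> :: "nat \<Rightarrow> nat \<Rightarrow> 'y" and n :: "nat \<Rightarrow> nat"
  assumes N: "is_resolution N e h" and \<phi>: "\<And>i. bij_betw (\<phi> i) {..<n i} (N i)"
  shows "is_resolution (\<lambda>i. {..<n i}) (\<lambda>i a b. e i (\<phi> (i - 1) a) (\<phi> i b)) (h \<circ> \<phi> 0)"
proof -
  define \<psi> where "\<psi> i = inv_into {..<n i} (\<phi> i)" for i
  have \<phi>N: "\<phi> i a \<in> N i" if "a < n i" for i a using \<phi>[of i] that by (auto simp: bij_betw_def)
  have \<psi>\<phi>: "\<psi> i (\<phi> i a) = a" if "a < n i" for i a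
    using \<phi>[of i] that by (auto simp: bij_betw_def \<psi>_def)
  have \<phi>\<psi>: "\<phi> i (\<psi> i y) = y" "\<psi> i y < n i" if "y \<in> N i" for i y
    using \<phi>[of i] that f_inv_into_f[of y "\<phi> i" "{..<n i}"] inv_into_into[of y "\<phi> i" "{..<n i}"]
    by (auto simp: bij_betw_def \<psi>_def)
  have reidx: "(\<Sum>a<n i. f (\<phi> i a)) = sum f (N i)" for f :: "'y \<Rightarrow> 'c::comm_monoid_add" and i
    using sum.reindex_bij_betw[OF \<phi>[of i], of f] by simp
  have reidx2: "(\<Sum>a<n i. f (\<phi> i a) (v a)) = (\<Sum>y\<in>N i. f y (v (\<psi> i y)))"
    for f :: "'y \<Rightarrow> 'd \<Rightarrow> 'c::comm_monoid_add" and v :: "nat \<Rightarrow> 'd" and i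
  proof -
    have "(\<Sum>a<n i. f (\<phi> i a) (v a)) = (\<Sum>a<n i. f (\<phi> i a) (v (\<psi> i (\<phi> i a))))"
      by (intro sum.cong) (simp_all add: \<psi>\<phi>)
    then show ?thesis using reidx[of "\<lambda>y. f y (v (\<psi> i y))" i] by simp
  qed
  have all: "(\<forall>a\<in>{..<n i}. P (\<phi> i a)) \<longleftrightarrow> (\<forall>y\<in>N i. P y)" for P i
    using \<phi>N \<phi>\<psi> by (metis lessThan_iff)
  have cyc: "cyc (\<lambda>i. {..<n i}) (\<lambda>i a b. e i (\<phi> (i - 1) a) (\<phi> i b)) (h \<circ> \<phi> 0) i v
      \<longleftrightarrow> cyc N e h i (v \<circ> \<psi> i)" for i v
  proof (cases i)
    case 0
    then show ?thesis using reidx2[of "\<lambda>y c. const_coeff c * h y" 0 v] by (simp add: cyc_def)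
  next
    case (Suc j)
    have "(\<Sum>b<n i. e i y (\<phi> i b) * v b) = (\<Sum>z\<in>N i. e i y z * v (\<psi> i z))" for y
      by (rule reidx2[of "\<lambda>z c. e i y z * c" i v])
    then show ?thesis using all[of j "\<lambda>y. (\<Sum>z\<in>N i. e i y z * v (\<psi> i z)) \<in> I"] Suc by (simp add: cyc_def)
  qed
  have bd: "(\<exists>w. \<forall>x<n i. v x - (\<Sum>z<n (Suc i). e (Suc i) (\<phi> i x) (\<phi> (Suc i) z) * w z) \<in> I)
      \<longleftrightarrow> (\<exists>w. \<forall>y\<in>N i. v (\<psi> i y) - (\<Sum>z\<in>N (Suc i). e (Suc i) y z * w z) \<in> I)" for i v
  proof
    assume "\<exists>w. \<forall>x<n i. v x - (\<Sum>z<n (Suc i). e (Suc i) (\<phi> i x) (\<phi> (Suc i) z) * w z) \<in> I"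
    then obtain w where w: "\<And>x. x < n i \<Longrightarrow> v x - (\<Sum>z<n (Suc i). e (Suc i) (\<phi> i x) (\<phi> (Suc i) z) * w z) \<in> I" by blast
    have "v (\<psi> i y) - (\<Sum>z\<in>N (Suc i). e (Suc i) y z * w (\<psi> (Suc i) z)) \<in> I" if "y \<in> N i" for y
      using w[of "\<psi> i y"] \<phi>\<psi>[OF that] reidx2[of "\<lambda>z c. e (Suc i) y z * c" "Suc i" w] by simp
    then show "\<exists>w. \<forall>y\<in>N i. v (\<psi> i y) - (\<Sum>z\<in>N (Suc i). e (Suc i) y z * w z) \<in> I"
      by (intro exI[of _ "w \<circ> \<psi> (Suc i)"]) simp
  next
    assume "\<exists>w. \<forall>y\<in>N i. v (\<psi> i y) - (\<Sum>z\<in>N (Suc i). e (Suc i) y z * w z) \<in> I"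
    then obtain w where w: "\<And>y. y \<in> N i \<Longrightarrow> v (\<psi> i y) - (\<Sum>z\<in>N (Suc i). e (Suc i) y z * w z) \<in> I" by blast
    have "v x - (\<Sum>z<n (Suc i). e (Suc i) (\<phi> i x) (\<phi> (Suc i) z) * w (\<phi> (Suc i) z)) \<in> I" if "x < n i" for x
      using w[OF \<phi>N[OF that]] \<psi>\<phi>[OF that] reidx[of "\<lambda>z. e (Suc i) (\<phi> i x) z * w z" "Suc i"] by simp
    then show "\<exists>w. \<forall>x<n i. v x - (\<Sum>z<n (Suc i). e (Suc i) (\<phi> i x) (\<phi> (Suc i) z) * w z) \<in> I"
      by (intro exI[of _ "w \<circ> \<phi> (Suc i)"]) simp
  qed
  have surj: "\<exists>v :: nat \<Rightarrow> ('v, 'k) mpoly. (\<Sum>x<n 0. const_coeff (v x) * (h \<circ> \<phi> 0) x) = c" for c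
  proof -
    have "\<exists>v :: 'y \<Rightarrow> ('v, 'k) mpoly. (\<Sum>y\<in>N 0. const_coeff (v y) * h y) = c" using N by (simp add: is_resolution_def)
    then obtain v :: "'y \<Rightarrow> ('v, 'k) mpoly" where "(\<Sum>y\<in>N 0. const_coeff (v y) * h y) = c" ..
    then show ?thesis using reidx[of "\<lambda>y. const_coeff (v y) * h y" 0] by (intro exI[of _ "v \<circ> \<phi> 0"]) simp
  qed
  show ?thesis
    unfolding is_resolution_def
  proof (intro conjI allI)
    show "\<exists>v :: nat \<Rightarrow> ('v, 'k) mpoly. (\<Sum>x\<in>{..<n 0}. const_coeff (v x) * (h \<circ> \<phi> 0) x) = c" for c by (rule surj)
    fix i v
    show "cyc (\<lambda>i. {..<n i}) (\<lambda>i a b. e i (\<phi> (i - 1) a) (\<phi> i b)) (h \<circ> \<phi> 0) i v \<longleftrightarrow>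
        (\<exists>w. \<forall>x\<in>{..<n i}. v x - (\<Sum>z<n (Suc i). e (Suc i) (\<phi> (Suc i - 1) x) (\<phi> (Suc i) z) * w z) \<in> I)"
      using N bd[of i v] unfolding cyc is_resolution_def by (simp add: Ball_def)
  qed simp
qed

text \<open>
  The minimal resolution, with its basis elements renumbered, shows that a resolution exists.  The one
  that is chosen in the definition of the Betti numbers need not be minimal, but its reduced
  homology has the ranks of the minimal one.
\<close>

theorem betti_eq_minimal_rank:
  assumes N: "is_resolution N e h"
    and minimal: "\<And>i y y'. y \<in> N i \<Longrightarrow> y' \<in> N (Suc i) \<Longrightarrow> const_coeff (e (Suc i) y y') = 0"
  shows "betti I i = card (N i)"
proof -
  define n where "n i = card (N i)" for i
  have "finite (N i)" for i using N by (simp add: is_resolution_def)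
  then have "\<exists>\<phi>. bij_betw \<phi> {..<n i} (N i)" for i
    unfolding n_def lessThan_atLeast0 by (rule ex_bij_betw_nat_finite)
  then obtain \<phi> where \<phi>: "\<And>i. bij_betw (\<phi> i) {..<n i} (N i)" by metis
  define d where "d = (\<lambda>i a b. e i (\<phi> (i - 1) a) (\<phi> i b))"
  define G where "G = \<lparr>rk = n, dmat = (\<lambda>i a b. proj (d i a b)), augm = h \<circ> \<phi> 0\<rparr>"
  have "free_resolution quot field_module G"
    using is_resolution_reindex[OF N \<phi>] free_resolution_iff[of G d] by (simp add: G_def d_def)
  note G = this
  define F where "F = (SOME F. free_resolution quot field_module F)"
  have F: "free_resolution quot field_module F"
    unfolding F_def using G by (rule someI)
  have "\<forall>i a b. \<exists>p. i > 0 \<longrightarrow> a < rk F (i - 1) \<longrightarrow> b < rk F i \<longrightarrow> dmat F i a b = proj p"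
  proof (intro allI)
    fix i a b
    have "i > 0 \<longrightarrow> a < rk F (i - 1) \<longrightarrow> b < rk F i \<longrightarrow> dmat F i a b \<in> range proj"
      using conjunct1[OF F[unfolded free_resolution_def]] unfolding carrier_quot by blast
    then show "\<exists>p. i > 0 \<longrightarrow> a < rk F (i - 1) \<longrightarrow> b < rk F i \<longrightarrow> dmat F i a b = proj p" by auto
  qed
  then obtain \<delta> where \<delta>: "\<And>i a b. i > 0 \<Longrightarrow> a < rk F (i - 1) \<Longrightarrow> b < rk F i \<Longrightarrow> dmat F i a b = proj (\<delta> i a b)"
    by metis
  have "is_resolution (\<lambda>i. {..<rk F i}) \<delta> (augm F)"
  proof (subst free_resolution_iff[symmetric])
    show "dmat F i a b = proj (\<delta> i a b)" if "i > 0" "a < rk F (i - 1)" "b < rk F i" for i a b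
      using that by (rule \<delta>)
  qed (rule F)
  then have "vector_space.dim (\<lambda>c v j. c * v j) (cycles_mod (rk F) \<delta> i)
      = vector_space.dim (\<lambda>c v j. c * v j) (boundaries_mod (rk F) \<delta> i) + card (N i)"
    by (rule homology_dim_eq_minimal_rank[OF _ N]) (rule minimal)
  moreover have "cycles field_module F i = cycles_mod (rk F) \<delta> i"
    by (rule cycles_residue_module) (rule \<delta>)
  moreover have "boundaries field_module F i = boundaries_mod (rk F) \<delta> i"
    by (rule boundaries_residue_module) (rule \<delta>)
  ultimately show ?thesis
    unfolding betti_def Let_def F_def[symmetric] by simp
qed

end

section \<open>A linear resolution of the residue field\<close>

lemma residue_ideal_edge_ideal:
  assumes "irreflp E"
  shows "residue_ideal (support_ideal (has_edge E)) (const_coeff :: ('v, 'k::field) mpoly \<Rightarrow> 'k)"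
  by unfold_locales
     (auto intro: support_ideal_add support_ideal_mult mono_has_edge const_coeff_edge_ideal)

text \<open>
  The numbering \<open>f\<close> of the vertices fixes the order in which variables are adjoined.  The last
  parameter only carries the type of the coefficients.
\<close>

locale ordered_graph =
  fixes E :: "'v::finite \<Rightarrow> 'v \<Rightarrow> bool" and f :: "'v \<Rightarrow> nat" and field_type :: "'k::field itself"
  assumes sym: "symp E" and irr: "irreflp E" and inj_f: "inj f" and f_less: "f v < CARD('v)"
begin

sublocale residue_ideal "support_ideal (has_edge E)" "const_coeff :: ('v, 'k) mpoly \<Rightarrow> 'k"
  by (rule residue_ideal_edge_ideal[OF irr])

abbreviation I :: "('v, 'k) mpoly set" where "I \<equiv> support_ideal (has_edge E)"

text \<open>
  In the quotient by the edge ideal, these variables generate the colon of the ideal generated by the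
  variables of \<open>A\<close> that precede \<open>u\<close> by the variable of \<open>u\<close>.
\<close>

definition next_vars :: "'v set \<Rightarrow> 'v \<Rightarrow> 'v set" where
  "next_vars A u = {x \<in> A. f x < f u} \<union> {w. E u w}"

text \<open>
  The word \<open>u # w\<close> stands for a syzygy whose leading term is the variable of \<open>u\<close> times the basis
  element \<open>w\<close>.  The variables in \<open>allowed w\<close> generate the ideal of those ring elements that multiply
  the generator belonging to \<open>w\<close> into the span of the smaller generators.
\<close>

primrec allowed :: "'v list \<Rightarrow> 'v set" where
  "allowed [] = UNIV"
| "allowed (u # w) = next_vars (allowed w) u"

text \<open>
  On words of equal length this is the lexicographic order that compares the oldest letters first;
  the latest letter is the head of the list.
\<close>

primrec code :: "'v list \<Rightarrow> nat" where
  "code [] = 0"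
| "code (u # w) = code w * CARD('v) + f u"

definition extend :: "'v list set \<Rightarrow> 'v list set" where
  "extend W = (\<lambda>(w, u). u # w) ` Sigma W allowed"

lemma Cons_in_extend: "u # w \<in> extend W \<longleftrightarrow> w \<in> W \<and> u \<in> allowed w"
  by (auto simp: extend_def)

lemma extendE:
  assumes "x \<in> extend W"
  obtains u w where "x = u # w" "w \<in> W" "u \<in> allowed w"
  using assms by (auto simp: extend_def)

lemma code_Cons_less_iff: "code (u # w) < code (u' # w') \<longleftrightarrow> code w < code w' \<or> code w = code w' \<and> f u < f u'"
proof -
  have "a * n + r < b * n + s \<longleftrightarrow> a < b \<or> a = b \<and> r < s" if "r < n" "s < n" for a b n r s :: nat
  proof -
    consider "a < b" | "a = b" | "b < a" by linarith
    then show ?thesis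
    proof cases
      case 1
      then have "Suc a * n \<le> b * n" by (intro mult_right_mono) auto
      then show ?thesis using 1 that by simp
    next
      case 3
      then have "Suc b * n \<le> a * n" by (intro mult_right_mono) auto
      then show ?thesis using 3 that by simp
    qed simp
  qed
  from this[OF f_less f_less] show ?thesis by simp
qed

text \<open>
  The relations between generators indexed by \<open>W\<close> are the coefficient vectors satisfying \<open>Z\<close>.  Ordered
  by \<open>code\<close>, each generator is multiplied into the span of the smaller ones exactly by the ideal
  generated by the variables \<open>allowed w\<close>, and no relation has a coefficient outside the maximal
  ideal, so the generators are minimal.
\<close>

definition linear_quotients :: "'v list set \<Rightarrow> (('v list \<Rightarrow> ('v, 'k) mpoly) \<Rightarrow> bool) \<Rightarrow> bool" where
  "linear_quotients W Z \<longleftrightarrow> finite W \<and> inj_on code W \<and>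
     (\<forall>v w. Z v \<longrightarrow> Z w \<longrightarrow> Z (\<lambda>x. v x + w x)) \<and> (\<forall>c v. Z v \<longrightarrow> Z (\<lambda>x. c * v x)) \<and>
     (\<forall>v. (\<forall>x\<in>W. v x \<in> I) \<longrightarrow> Z v) \<and>
     (\<forall>v. \<forall>w\<in>W. Z v \<longrightarrow> (\<forall>x\<in>W. code w < code x \<longrightarrow> v x \<in> I) \<longrightarrow> v w \<in> vars_ideal E (allowed w)) \<and>
     (\<forall>w\<in>W. \<forall>u\<in>allowed w. \<exists>v. Z v \<and> v w = mvar u \<and> (\<forall>x\<in>W. code w < code x \<longrightarrow> v x = 0)) \<and>
     (\<forall>v. \<forall>w\<in>W. Z v \<longrightarrow> const_coeff (v w) = 0)"

text \<open>
  The residue field is generated by \<open>1\<close>, and the relations are the elements of the maximal ideal.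
\<close>

lemma linear_quotients_base: "linear_quotients {[]} (\<lambda>v. const_coeff (v []) = 0)"
proof -
  have "\<exists>v :: 'v list \<Rightarrow> ('v, 'k) mpoly. const_coeff (v []) = 0 \<and> v [] = mvar u" for u
    by (rule exI[of _ "\<lambda>_. mvar u"]) simp
  then show ?thesis
    unfolding linear_quotients_def
    by (auto simp: const_coeff_edge_ideal const_coeff_eq_0_iff[of _ E, symmetric])
qed

text \<open>
  For every \<open>w\<close> and every allowed \<open>u\<close> choose a relation with leading term \<open>u\<close> times \<open>w\<close>.  These relations
  generate all others, since the leading coefficient of a relation is a combination of allowed
  variables and can be cancelled.  Suppose a multiple of the relation of \<open>u # w\<close> is a combination of
  smaller ones; its coordinate at \<open>w\<close> says that the multiplier, times the variable of \<open>u\<close>, lies in the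
  ideal of the variables before \<open>u\<close>, which is the colon ideal \<open>next_vars\<close>.  Conversely, for each of
  the variables \<open>t\<close> in \<open>next_vars\<close>, a two-term combination of the relations of \<open>u # w\<close> and \<open>t # w\<close>
  cancels at \<open>w\<close> and is therefore a combination of relations of smaller generators.
\<close>

lemma linear_quotients_step:
  assumes "linear_quotients W Z"
  obtains d where "\<And>x. x \<in> extend W \<Longrightarrow> Z (\<lambda>y. d y x)"
    "\<And>v. Z v \<Longrightarrow> \<exists>c. \<forall>y\<in>W. v y - (\<Sum>x\<in>extend W. d y x * c x) \<in> I"
    "\<And>y x. y \<in> W \<Longrightarrow> x \<in> extend W \<Longrightarrow> const_coeff (d y x) = 0"
    "linear_quotients (extend W) (\<lambda>c. \<forall>y\<in>W. (\<Sum>x\<in>extend W. d y x * c x) \<in> I)"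
proof -
  note lq = assms[unfolded linear_quotients_def]
  have fin: "finite W" using lq by (elim conjE)
  have inj: "inj_on code W" using lq by (elim conjE)
  have "\<forall>v w. Z v \<longrightarrow> Z w \<longrightarrow> Z (\<lambda>x. v x + w x)" using lq by (elim conjE)
  then have Z_add: "Z (\<lambda>x. v x + w x)" if "Z v" "Z w" for v w using that by simp
  have "\<forall>c v. Z v \<longrightarrow> Z (\<lambda>x. c * v x)" using lq by (elim conjE)
  then have Z_mult: "Z (\<lambda>x. c * v x)" if "Z v" for c v using that by simp
  have "\<forall>v. (\<forall>x\<in>W. v x \<in> I) \<longrightarrow> Z v" using lq by (elim conjE)
  then have Z_I: "Z v" if "\<And>x. x \<in> W \<Longrightarrow> v x \<in> I" for v using that by simp
  have "\<forall>v. \<forall>w\<in>W. Z v \<longrightarrow> (\<forall>x\<in>W. code w < code x \<longrightarrow> v x \<in> I) \<longrightarrow> v w \<in> vars_ideal E (allowed w)"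
    using lq by (elim conjE)
  then have fwd: "v w \<in> vars_ideal E (allowed w)"
    if "w \<in> W" "Z v" "\<And>x. x \<in> W \<Longrightarrow> code w < code x \<Longrightarrow> v x \<in> I" for v w using that by simp
  have bwd: "\<forall>w\<in>W. \<forall>u\<in>allowed w. \<exists>v. Z v \<and> v w = mvar u \<and> (\<forall>x\<in>W. code w < code x \<longrightarrow> v x = 0)"
    using lq by (elim conjE)
  have "\<forall>v. \<forall>w\<in>W. Z v \<longrightarrow> const_coeff (v w) = 0" using lq by (elim conjE)
  then have ind: "const_coeff (v w) = 0" if "w \<in> W" "Z v" for v w using that by simp
  have Z_diff: "Z (\<lambda>x. v x - w x)" if "Z v" "Z w" for v w
    using Z_add[OF that(1) Z_mult[OF that(2), of "-1"]] by simp
  have Z_sum: "Z (\<lambda>x. \<Sum>i\<in>A. r i * V i x)" if "\<And>i. i \<in> A \<Longrightarrow> Z (V i)" for A and r and V :: "'v \<Rightarrow> _"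
    using that
  proof (induction A rule: infinite_finite_induct)
    case (insert i A)
    then have "Z (\<lambda>x. r i * V i x + (\<Sum>i\<in>A. r i * V i x))" by (intro Z_add Z_mult) auto
    then show ?case using insert.hyps by simp
  qed (auto intro: Z_I I_0)
  have code_eq: "x = y" if "x \<in> W" "y \<in> W" "code x = code y" for x y
    using inj that by (auto dest: inj_onD)
  obtain V where V: "\<And>w u. w \<in> W \<Longrightarrow> u \<in> allowed w \<Longrightarrow> Z (V w u)"
    "\<And>w u. w \<in> W \<Longrightarrow> u \<in> allowed w \<Longrightarrow> V w u w = mvar u"
    "\<And>w u x. w \<in> W \<Longrightarrow> u \<in> allowed w \<Longrightarrow> x \<in> W \<Longrightarrow> code w < code x \<Longrightarrow> V w u x = 0"
  proof -
    define P where "P w u v \<longleftrightarrow> Z v \<and> v w = mvar u \<and> (\<forall>x\<in>W. code w < code x \<longrightarrow> v x = 0)" for w u v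
    define V where "V w u = (SOME v. P w u v)" for w u
    have "P w u (V w u)" if "w \<in> W" "u \<in> allowed w" for w u
      unfolding V_def using bwd that by (intro someI_ex[of "P w u"]) (simp add: P_def)
    then show ?thesis using that[of V] by (simp add: P_def)
  qed
  define d where "d y x = V (tl x) (hd x) y" for y x
  have finX: "finite (extend W)" using fin by (simp add: extend_def)
  have inj': "inj_on code (extend W)"
  proof (rule inj_onI)
    fix x y assume "x \<in> extend W" "y \<in> extend W" and c: "code x = code y"
    then obtain u w u' w' where xy: "x = u # w" "y = u' # w'" "w \<in> W" "w' \<in> W" by (auto elim!: extendE)
    have "code w = code w' \<and> f u = f u'"
      using code_Cons_less_iff[of u w u' w'] code_Cons_less_iff[of u' w' u w] c xy by auto
    then show "x = y" using xy code_eq inj_f by (auto dest: injD)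
  qed
  have sum_last: "(\<Sum>x\<in>extend W. d y x * (if tl x = w then r (hd x) else 0)) = (\<Sum>u\<in>allowed w. r u * V w u y)"
    if "w \<in> W" for w r y
  proof -
    have "(\<Sum>x\<in>extend W. d y x * (if tl x = w then r (hd x) else 0))
        = (\<Sum>x\<in>(\<lambda>u. u # w) ` allowed w. r (hd x) * V w (hd x) y)"
      using finX that by (intro sum.mono_neutral_cong_right) (auto simp: d_def extend_def mult.commute split: if_splits)
    also have "\<dots> = (\<Sum>u\<in>allowed w. r u * V w u y)"
      by (subst sum.reindex) (auto simp: inj_on_def)
    finally show ?thesis .
  qed
  \<comment> \<open>A relation that is supported on generators of code below \<open>n\<close> needs only the new relations with
      leading generator below \<open>n\<close>.\<close>
  have gen: "\<exists>c. (\<forall>x\<in>extend W. n \<le> code (tl x) \<longrightarrow> c x = 0) \<and> (\<forall>y\<in>W. v y - (\<Sum>x\<in>extend W. d y x * c x) \<in> I)"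
    if "Z v" "\<forall>x\<in>W. n \<le> code x \<longrightarrow> v x \<in> I" for n v
    using that
  proof (induction n arbitrary: v)
    case 0
    then show ?case by (intro exI[of _ "\<lambda>_. 0"]) auto
  next
    case (Suc n)
    show ?case
    proof (cases "\<exists>w\<in>W. code w = n")
      case False
      then have "\<forall>x\<in>W. n \<le> code x \<longrightarrow> v x \<in> I" using Suc.prems(2) by (metis Suc_leI le_neq_implies_less)
      from Suc.IH[OF Suc.prems(1) this] obtain c where
        "\<forall>x\<in>extend W. n \<le> code (tl x) \<longrightarrow> c x = 0" "\<forall>y\<in>W. v y - (\<Sum>x\<in>extend W. d y x * c x) \<in> I" by blast
      then show ?thesis by (intro exI[of _ c]) auto
    next
      case True
      then obtain w where w: "w \<in> W" "code w = n" by blast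
      have "v w \<in> vars_ideal E (allowed w)" using w Suc.prems by (intro fwd) auto
      then obtain r where r: "v w - (\<Sum>u\<in>allowed w. r u * mvar u) \<in> I"
        using vars_ideal_combination[of "allowed w" "v w" E] by auto
      define v' where "v' x = v x - (\<Sum>u\<in>allowed w. r u * V w u x)" for x
      have "Z v'" unfolding v'_def using w Suc.prems(1) V(1) by (intro Z_diff Z_sum) auto
      moreover have "v' x \<in> I" if x: "x \<in> W" "n \<le> code x" for x
      proof (cases "x = w")
        case True
        then show ?thesis using r V(2) w by (simp add: v'_def)
      next
        case False
        then have "code w < code x" using x w code_eq by (metis le_neq_implies_less)
        then show ?thesis using V(3) w x Suc.prems(2) by (simp add: v'_def)
      qed
      ultimately obtain c where c: "\<forall>x\<in>extend W. n \<le> code (tl x) \<longrightarrow> c x = 0"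
        "\<forall>y\<in>W. v' y - (\<Sum>x\<in>extend W. d y x * c x) \<in> I" using Suc.IH[of v'] by blast
      define c' where "c' x = c x + (if tl x = w then r (hd x) else 0)" for x
      have "\<forall>x\<in>extend W. Suc n \<le> code (tl x) \<longrightarrow> c' x = 0" using c(1) w by (auto simp: c'_def)
      moreover have "v y - (\<Sum>x\<in>extend W. d y x * c' x) \<in> I" if "y \<in> W" for y
      proof -
        have "v y - (\<Sum>x\<in>extend W. d y x * c' x) = v' y - (\<Sum>x\<in>extend W. d y x * c x)"
          unfolding c'_def distrib_left sum.distrib sum_last[OF w(1)] v'_def by simp
        then show ?thesis using c(2) that by simp
      qed
      ultimately show ?thesis by blast
    qed
  qed
  show ?thesis
  proof (rule that[of d])
    show Zd: "Z (\<lambda>y. d y x)" if "x \<in> extend W" for x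
      using that V(1) by (auto simp: d_def elim!: extendE)
    show "\<exists>c. \<forall>y\<in>W. v y - (\<Sum>x\<in>extend W. d y x * c x) \<in> I" if "Z v" for v
    proof -
      obtain n where "\<forall>x\<in>W. code x < n" using fin finite_nat_set_iff_bounded[of "code ` W"] by auto
      then have "\<forall>x\<in>W. n \<le> code x \<longrightarrow> v x \<in> I" by auto
      from gen[OF that this] show ?thesis by blast
    qed
    show dm: "const_coeff (d y x) = 0" if "y \<in> W" "x \<in> extend W" for y x
      using ind[OF that(1) Zd[OF that(2)]] .
    define Z' where "Z' c \<longleftrightarrow> (\<forall>y\<in>W. (\<Sum>x\<in>extend W. d y x * c x) \<in> I)" for c
    have low: "d w (u # w') = 0" if "w \<in> W" "w' \<in> W" "u \<in> allowed w'" "code w' < code w" for u w w'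
      using V(3)[OF that(2,3,1,4)] by (simp add: d_def)
    have fwd': "c (u # w) \<in> vars_ideal E (next_vars (allowed w) u)"
      if w: "w \<in> W" "u \<in> allowed w" and c: "Z' c"
        and high: "\<And>x. x \<in> extend W \<Longrightarrow> code (u # w) < code x \<Longrightarrow> c x \<in> I" for c u w
    proof -
      define A where "A = {x \<in> allowed w. f x < f u}"
      let ?J = "vars_ideal E A :: ('v, 'k) mpoly set"
      have IJ: "I \<subseteq> ?J" unfolding vars_ideal_def by (rule support_ideal_mono) simp
      have J_add: "a + b \<in> ?J" if "a \<in> ?J" "b \<in> ?J" for a b
        using that unfolding vars_ideal_def by (rule support_ideal_add)
      have J_mult: "a * b \<in> ?J" if "b \<in> ?J" for a b
        using that unfolding vars_ideal_def by (intro support_ideal_mult mono_vars)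
      have J_0: "0 \<in> ?J" by (simp add: vars_ideal_def)
      have J_sum: "sum g B \<in> ?J" if "\<And>x. x \<in> B \<Longrightarrow> g x \<in> ?J" for g and B :: "'v list set"
        using that by (induction B rule: infinite_finite_induct) (auto intro: J_add J_0)
      have summand: "d w x * c x \<in> ?J" if x: "x \<in> extend W" "x \<noteq> u # w" for x
      proof -
        obtain u' w' where x': "x = u' # w'" "w' \<in> W" "u' \<in> allowed w'" using x(1) by (rule extendE)
        consider "code w' < code w" | "code (u # w) < code x" | "w' = w" "f u' < f u"
          using code_Cons_less_iff[of u w u' w'] x x' w code_eq[of w' w] inj_f
          by (metis injD linorder_neqE_nat)
        then show ?thesis
        proof cases
          case 1
          then show ?thesis using low[of w w' u'] w x' by (simp add: vars_ideal_def)
        next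
          case 2
          then show ?thesis using high x(1) IJ by (intro J_mult) auto
        next
          case 3
          then have "mvar u' \<in> ?J" using x' by (auto simp: A_def vars_ideal_def support_ideal_def mvar_def split: if_splits)
          then have "c x * mvar u' \<in> ?J" by (rule J_mult)
          then show ?thesis using 3 x' V(2)[of w u'] by (simp add: d_def mult.commute)
        qed
      qed
      have mem: "u # w \<in> extend W" using w by (simp add: Cons_in_extend)
      have "d w (u # w) * c (u # w)
          = (\<Sum>x\<in>extend W. d w x * c x) + (- 1) * (\<Sum>x\<in>extend W - {u # w}. d w x * c x)"
        using sum.remove[OF finX mem, of "\<lambda>x. d w x * c x"] by simp
      also have "\<dots> \<in> ?J"
      proof (rule J_add)
        show "(\<Sum>x\<in>extend W. d w x * c x) \<in> ?J" using c w IJ by (auto simp: Z'_def)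
        show "(- 1) * (\<Sum>x\<in>extend W - {u # w}. d w x * c x) \<in> ?J"
          by (rule J_mult, rule J_sum, rule summand) auto
      qed
      finally have "mvar u * c (u # w) \<in> ?J" using V(2) w by (simp add: d_def)
      then show ?thesis
        unfolding next_vars_def A_def[symmetric] using sym irr
        by (intro vars_ideal_colon) (auto simp: A_def)
    qed
    have bwd': "\<exists>c. Z' c \<and> c (u # w) = mvar t \<and> (\<forall>x\<in>extend W. code (u # w) < code x \<longrightarrow> c x = 0)"
      if w: "w \<in> W" "u \<in> allowed w" and t: "t \<in> next_vars (allowed w) u" for t u w
    proof -
      \<comment> \<open>If \<open>t\<close> precedes \<open>u\<close>, the leading terms of the relations of \<open>u # w\<close> and \<open>t # w\<close> cancel crosswise.
          Otherwise \<open>t\<close> is adjacent to \<open>u\<close>, and the leading term of the first alone becomes zero.\<close>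
      define b where "b = (t \<in> allowed w \<and> f t < f u)"
      define r where "r = (\<lambda>u'. (if u' = u then mvar t else 0) - (if b \<and> u' = t then mvar u else 0) :: ('v, 'k) mpoly)"
      have tu: "t \<noteq> u" using t irr by (auto simp: next_vars_def irreflp_def)
      define v where "v y = (\<Sum>u'\<in>allowed w. r u' * V w u' y)" for y
      have "Z v" unfolding v_def using w V(1) by (intro Z_sum) auto
      moreover have "v y \<in> I" if y: "y \<in> W" "code w \<le> code y" for y
      proof (cases "y = w")
        case True
        have "v w = (\<Sum>u'\<in>allowed w. (if u' = u then mvar t * mvar u' else 0) - (if u' = t then if b then mvar u * mvar u' else 0 else 0))"
          unfolding v_def r_def using V(2) w by (intro sum.cong) (auto simp: left_diff_distrib)
        also have "\<dots> = mvar t * mvar u - (if b then mvar u * mvar t else 0)"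
          using w by (auto simp: sum_subtractf sum.delta b_def)
        also have "\<dots> \<in> I"
          using t sym mvar_mult_mvar_in_edge_ideal[of E t u]
          by (auto simp: b_def next_vars_def mult.commute I_0 dest: sympD)
        finally show ?thesis using True by simp
      next
        case False
        then have "code w < code y" using y w code_eq by (metis le_neq_implies_less)
        then show ?thesis using V(3) w y by (simp add: v_def I_0)
      qed
      ultimately obtain c where c: "\<forall>x\<in>extend W. code w \<le> code (tl x) \<longrightarrow> c x = 0"
        "\<forall>y\<in>W. v y - (\<Sum>x\<in>extend W. d y x * c x) \<in> I" using gen[of v "code w"] by blast
      define c' where "c' x = (if tl x = w then r (hd x) else 0) - c x" for x
      have "Z' c'"
        unfolding Z'_def c'_def right_diff_distrib sum_subtractf sum_last[OF w(1)]
        using c(2) by (simp add: v_def)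
      moreover have "c' (u # w) = mvar t"
        using c(1) w tu by (auto simp: c'_def r_def Cons_in_extend)
      moreover have "c' x = 0" if x: "x \<in> extend W" "code (u # w) < code x" for x
      proof -
        obtain u' w' where x': "x = u' # w'" "w' \<in> W" "u' \<in> allowed w'" using x(1) by (rule extendE)
        have lt: "code w < code w' \<or> code w = code w' \<and> f u < f u'"
          using x(2) code_Cons_less_iff[of u w u' w'] x' by simp
        then have "c x = 0" using c(1) x x' by auto
        moreover have "w' = w \<Longrightarrow> r u' = 0" using lt by (auto simp: r_def b_def)
        ultimately show ?thesis using x' by (simp add: c'_def)
      qed
      ultimately show ?thesis by blast
    qed
    have ind': "const_coeff (c x) = 0" if c: "Z' c" and "x \<in> extend W" for c x
    proof (rule ccontr)
      assume "const_coeff (c x) \<noteq> 0"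
      define S where "S = {x \<in> extend W. const_coeff (c x) \<noteq> 0}"
      \<comment> \<open>Among the coefficients with nonzero constant term take one with maximal leading generator \<open>w\<close>.
          At the coordinate \<open>w\<close>, the coefficient of the variable of \<open>u\<close> consists of this constant alone:
          smaller generators do not occur, and larger ones contribute only products of two elements of the
          maximal ideal.\<close>
      have "finite S" "S \<noteq> {}" using finX \<open>const_coeff (c x) \<noteq> 0\<close> \<open>x \<in> extend W\<close> by (auto simp: S_def)
      then obtain z where z: "z \<in> S" "\<And>x. x \<in> S \<Longrightarrow> code (tl x) \<le> code (tl z)"
        using obtains_MAX[of S "\<lambda>x. code (tl x)"] by (metis Max_ge finite_imageI imageI)
      then obtain u w where uw: "z = u # w" "w \<in> W" "u \<in> allowed w" by (auto simp: S_def elim!: extendE)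
      have "linear_coeff u (d w x * c x) = (if x = z then const_coeff (c z) else 0)" if x: "x \<in> extend W" for x
      proof -
        obtain u' w' where x': "x = u' # w'" "w' \<in> W" "u' \<in> allowed w'" using x by (rule extendE)
        have eq: "linear_coeff u (d w x * c x) = linear_coeff u (d w x) * const_coeff (c x)"
          using dm[OF uw(2) x] by simp
        consider "code w' < code w" | "code w < code w'" | "w' = w" using code_eq x' uw by (metis linorder_neqE_nat)
        then show ?thesis
        proof cases
          case 1
          then show ?thesis using eq low[of w w' u'] uw x' by auto
        next
          case 2
          then have "x \<notin> S" using z(2)[of x] x' uw by auto
          then show ?thesis using eq x z(1) by (auto simp: S_def)
        next
          case 3
          then show ?thesis using eq V(2)[of w u'] x' uw by (auto simp: d_def linear_coeff_mvar)
        qed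
      qed
      then have "linear_coeff u (\<Sum>x\<in>extend W. d w x * c x) = const_coeff (c z)"
        using finX z(1) by (simp add: S_def del: linear_coeff_mult)
      moreover have "linear_coeff u (\<Sum>x\<in>extend W. d w x * c x) = 0"
        using c uw(2) by (intro linear_coeff_edge_ideal[OF irr]) (auto simp: Z'_def)
      ultimately show False using z(1) by (simp add: S_def)
    qed
    show "linear_quotients (extend W) (\<lambda>c. \<forall>y\<in>W. (\<Sum>x\<in>extend W. d y x * c x) \<in> I)"
      unfolding Z'_def[symmetric] linear_quotients_def
    proof (intro conjI allI ballI impI)
      show "Z' (\<lambda>x. v x + w x)" if "Z' v" "Z' w" for v w
        using that by (auto simp: Z'_def distrib_left sum.distrib intro: I_add)
      show "Z' (\<lambda>x. c * v x)" if "Z' v" for c v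
        using that I_mult[of _ c] by (auto simp: Z'_def mult.left_commute[of _ c] simp flip: sum_distrib_left)
      show "Z' v" if "\<forall>x\<in>extend W. v x \<in> I" for v
        using that by (auto simp: Z'_def intro!: I_sum I_mult)
      show "v x \<in> vars_ideal E (allowed x)"
        if prems: "x \<in> extend W" "Z' v" "\<forall>y\<in>extend W. code x < code y \<longrightarrow> v y \<in> I" for v x
      proof -
        obtain u w where "x = u # w" "w \<in> W" "u \<in> allowed w" using prems(1) by (rule extendE)
        then show ?thesis using fwd'[of w u v] prems by simp
      qed
      show "\<exists>v. Z' v \<and> v x = mvar t \<and> (\<forall>y\<in>extend W. code x < code y \<longrightarrow> v y = 0)"
        if prems: "x \<in> extend W" "t \<in> allowed x" for x t
      proof -
        obtain u w where "x = u # w" "w \<in> W" "u \<in> allowed w" using prems(1) by (rule extendE)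
        then show ?thesis using bwd'[of w u t] prems by simp
      qed
      show "const_coeff (v x) = 0" if "x \<in> extend W" "Z' v" for v x using ind' that by blast
    qed (rule finX inj')+
  qed
qed

primrec words :: "nat \<Rightarrow> 'v list set" where
  "words 0 = {[]}"
| "words (Suc i) = extend (words i)"

text \<open>
  Iterating the previous step gives the differentials; the relations of each stage are the cycles
  of the resolution.
\<close>

theorem minimal_resolution_exists:
  "\<exists>e. is_resolution words e (\<lambda>_. 1) \<and>
     (\<forall>i. \<forall>y\<in>words i. \<forall>x\<in>words (Suc i). const_coeff (e (Suc i) y x) = 0)"
proof -
  define good where "good i Z d Z' \<longleftrightarrow>
      (\<forall>x\<in>words (Suc i). Z (\<lambda>y. d y x)) \<and>
      (\<forall>v. Z v \<longrightarrow> (\<exists>c. \<forall>y\<in>words i. v y - (\<Sum>x\<in>words (Suc i). d y x * c x) \<in> I)) \<and>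
      (\<forall>y\<in>words i. \<forall>x\<in>words (Suc i). const_coeff (d y x) = 0) \<and>
      Z' = (\<lambda>c. \<forall>y\<in>words i. (\<Sum>x\<in>words (Suc i). d y x * c x) \<in> I)"
    for i Z Z' and d :: "'v list \<Rightarrow> 'v list \<Rightarrow> ('v, 'k) mpoly"
  have "\<exists>Z. \<forall>i. (linear_quotients (words i) (Z i) \<and> (i = 0 \<longrightarrow> Z i = (\<lambda>v. const_coeff (v []) = 0)))
      \<and> (\<exists>d. good i (Z i) d (Z (Suc i)))"
  proof (rule dependent_nat_choice)
    show "\<exists>Z. linear_quotients (words 0) Z \<and> (0 = 0 \<longrightarrow> Z = (\<lambda>v. const_coeff (v []) = (0 :: 'k)))"
      using linear_quotients_base by auto
    fix i Z assume "linear_quotients (words i) Z \<and> (i = 0 \<longrightarrow> Z = (\<lambda>v. const_coeff (v []) = 0))"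
    then have lq: "linear_quotients (words i) Z" ..
    obtain d where d: "\<And>x. x \<in> extend (words i) \<Longrightarrow> Z (\<lambda>y. d y x)"
      "\<And>v. Z v \<Longrightarrow> \<exists>c. \<forall>y\<in>words i. v y - (\<Sum>x\<in>extend (words i). d y x * c x) \<in> I"
      "\<And>y x. y \<in> words i \<Longrightarrow> x \<in> extend (words i) \<Longrightarrow> const_coeff (d y x) = 0"
      "linear_quotients (extend (words i)) (\<lambda>c. \<forall>y\<in>words i. (\<Sum>x\<in>extend (words i). d y x * c x) \<in> I)"
      using linear_quotients_step[OF lq] by blast
    then have "good i Z d (\<lambda>c. \<forall>y\<in>words i. (\<Sum>x\<in>extend (words i). d y x * c x) \<in> I)"
      by (simp add: good_def)
    then show "\<exists>Z'. (linear_quotients (words (Suc i)) Z' \<and> (Suc i = 0 \<longrightarrow> Z' = (\<lambda>v. const_coeff (v []) = 0)))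
        \<and> (\<exists>d. good i Z d Z')"
      using d(4) by auto
  qed
  then obtain Z where lq: "\<And>i. linear_quotients (words i) (Z i)"
    and Z0: "Z 0 = (\<lambda>v. const_coeff (v []) = 0)" and "\<And>i. \<exists>d. good i (Z i) d (Z (Suc i))" by blast
  then obtain D where D: "\<And>i. good i (Z i) (D i) (Z (Suc i))" by metis
  define e where "e i = D (i - 1)" for i
  have cyc: "cyc words e (\<lambda>_. 1) i v \<longleftrightarrow> Z i v" for i v
  proof (cases i)
    case 0
    then show ?thesis by (simp add: cyc_def Z0)
  next
    case (Suc j)
    have "Z (Suc j) = (\<lambda>c. \<forall>y\<in>words j. (\<Sum>x\<in>words (Suc j). D j y x * c x) \<in> I)"
      using D[of j] by (simp add: good_def)
    then show ?thesis unfolding Suc by (simp add: cyc_def e_def)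
  qed
  have "is_resolution words e (\<lambda>_. 1)"
    unfolding is_resolution_def cyc
  proof (intro conjI allI iffI)
    fix i show "finite (words i)" using lq[of i] by (simp add: linear_quotients_def)
  next
    fix c :: 'k
    have "const_coeff (Poly_Mapping.single 0 c :: ('v, 'k) mpoly) = c" by (simp add: const_coeff_def)
    then show "\<exists>v :: 'v list \<Rightarrow> ('v, 'k) mpoly. (\<Sum>x\<in>words 0. const_coeff (v x) * 1) = c"
      by (intro exI[of _ "\<lambda>_. Poly_Mapping.single 0 c"]) simp
  next
    fix i v assume "Z i v"
    then show "\<exists>w. \<forall>x\<in>words i. v x - (\<Sum>z\<in>words (Suc i). e (Suc i) x z * w z) \<in> I"
      using D[of i] by (simp add: good_def e_def)
  next
    fix i v assume "\<exists>w. \<forall>x\<in>words i. v x - (\<Sum>z\<in>words (Suc i). e (Suc i) x z * w z) \<in> I"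
    then obtain w where w: "\<And>x. x \<in> words i \<Longrightarrow> v x - (\<Sum>z\<in>words (Suc i). D i x z * w z) \<in> I"
      by (auto simp: e_def)
    have Z_I: "\<And>v. \<forall>x\<in>words i. v x \<in> I \<Longrightarrow> Z i v" and Z_add: "\<And>v w. Z i v \<Longrightarrow> Z i w \<Longrightarrow> Z i (\<lambda>x. v x + w x)"
      and Z_mult: "\<And>c v. Z i v \<Longrightarrow> Z i (\<lambda>x. c * v x)"
      using lq[of i] by (simp_all add: linear_quotients_def)
    have "Z i (\<lambda>x. \<Sum>z\<in>A. w z * D i x z)" if "finite A" "A \<subseteq> words (Suc i)" for A
      using that
    proof (induction A)
      case empty
      show ?case by (rule Z_I) (simp add: I_0)
    next
      case (insert z A)
      have "Z i (\<lambda>x. D i x z)" using D[of i] insert.prems by (simp add: good_def)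
      then show ?case using insert by (simp add: Z_add Z_mult)
    qed
    moreover have "finite (words (Suc i))" using lq[of "Suc i"] by (simp add: linear_quotients_def)
    ultimately have "Z i (\<lambda>x. \<Sum>z\<in>words (Suc i). w z * D i x z)" by blast
    from Z_add[OF Z_I this, of "\<lambda>x. v x - (\<Sum>z\<in>words (Suc i). w z * D i x z)"]
    show "Z i v" using w by (simp add: mult.commute)
  qed
  moreover have "\<forall>i. \<forall>y\<in>words i. \<forall>x\<in>words (Suc i). const_coeff (e (Suc i) y x) = 0"
    using D by (simp add: good_def e_def)
  ultimately show ?thesis by blast
qed

end

section \<open>The Poincare series and the asymptotics of the deviations\<close>

context ordered_graph begin

text \<open>
  The number of ways to prolong a word \<open>w\<close> with \<open>allowed w = A\<close> by \<open>j\<close> letters.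
\<close>

primrec word_count :: "nat \<Rightarrow> 'v set \<Rightarrow> nat" where
  "word_count 0 A = 1"
| "word_count (Suc j) A = (\<Sum>u\<in>A. word_count j (next_vars A u))"

lemma finite_words: "finite (words i)"
  by (induction i) (auto simp: extend_def)

lemma sum_word_count: "(\<Sum>w\<in>words i. word_count j (allowed w)) = card (words (i + j))"
proof (induction j arbitrary: i)
  case (Suc j)
  have inj: "inj_on (\<lambda>(w, u). u # w) (Sigma (words i) allowed)" by (auto simp: inj_on_def)
  have "(\<Sum>w\<in>words i. word_count (Suc j) (allowed w))
      = (\<Sum>w\<in>words i. \<Sum>u\<in>allowed w. word_count j (allowed (u # w)))" by simp
  also have "\<dots> = (\<Sum>(w, u)\<in>Sigma (words i) allowed. word_count j (allowed (u # w)))"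
    by (rule sum.Sigma) (auto simp: finite_words)
  also have "\<dots> = (\<Sum>x\<in>words (Suc i). word_count j (allowed x))"
    unfolding words.simps extend_def sum.reindex[OF inj] by (simp add: o_def case_prod_unfold)
  also have "\<dots> = card (words (Suc i + j))" by (rule Suc.IH)
  finally show ?case by simp
qed simp

lemma card_words: "card (words i) = word_count i UNIV"
  using sum_word_count[of i 0] by simp

text \<open>
  The Hilbert series at \<open>-z\<close> of the quotient of \<open>R\<close> by the variables of \<open>A\<close>, whose nonzero monomials
  have independent supports outside \<open>A\<close>.
\<close>

definition hilbert_dual :: "'v set \<Rightarrow> real fps" where
  "hilbert_dual A = indep_poly E (- A) (- fps_X * inverse (1 + fps_X))"

text \<open>
  Numerically this is the exact sequence in which multiplication by the variable of \<open>m\<close> embeds the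
  quotient by the colon ideal, which is generated by the variables of \<open>A\<close> and of the neighbours of
  \<open>m\<close>, into the quotient by \<open>A\<close>.
\<close>

lemma hilbert_dual_insert:
  assumes m: "m \<notin> A"
  shows "hilbert_dual (insert m A) = hilbert_dual A + fps_X * hilbert_dual (A \<union> {w. E m w})"
proof -
  define x :: "real fps" where "x = - fps_X * inverse (1 + fps_X)"
  define g where "g = indep_poly E (- A - closed_nbhd E {m}) x"
  have loop: "\<not> E m m" using irr by (simp add: irreflp_def)
  have "inverse (1 + fps_X) * (1 + fps_X) = (1 :: real fps)" by (rule inverse_mult_eq_1) simp
  then have x1: "1 + x = inverse (1 + fps_X)"
    by (simp add: x_def distrib_left) (metis add_diff_cancel_left' diff_add_cancel mult.commute)
  have "indep_poly E (- A) x = indep_poly E (- A - {m}) x + x * g"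
    unfolding g_def using m by (intro indep_poly_remove sym irr) auto
  moreover have "- A - {m} = - insert m A" by auto
  moreover have "indep_poly E (- (A \<union> {w. E m w})) x = (1 + x) * g"
  \<comment> \<open>In the graph without \<open>A\<close> and without the neighbours of \<open>m\<close>, the vertex \<open>m\<close> is isolated.\<close>
  proof -
    have sets: "- (A \<union> {w. E m w}) - {m} = - A - closed_nbhd E {m}"
      "- (A \<union> {w. E m w}) - closed_nbhd E {m} = - A - closed_nbhd E {m}"
      by (auto simp: closed_nbhd_def)
    have "m \<in> - (A \<union> {w. E m w})" using m loop by simp
    from indep_poly_remove[OF sym irr this, of x] show ?thesis
      unfolding sets g_def by (simp add: algebra_simps)
  qed
  ultimately show ?thesis
    unfolding hilbert_dual_def x_def[symmetric] x1 by (simp add: x_def mult_ac)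
qed

text \<open>
  The vertices of \<open>A\<close> are adjoined in increasing order.
\<close>

lemma hilbert_dual_recursion:
  "hilbert_dual A = hilbert_dual {} + fps_X * (\<Sum>u\<in>A. hilbert_dual (next_vars A u))"
proof (induction "card A" arbitrary: A)
  case 0
  then show ?case by simp
next
  case (Suc n)
  then have "A \<noteq> {}" by auto
  define m where "m = inv_into UNIV f (Max (f ` A))"
  have "Max (f ` A) \<in> f ` A" using \<open>A \<noteq> {}\<close> by (intro Max_in) auto
  then have m: "m \<in> A" "f m = Max (f ` A)" using inj_f by (auto simp: m_def)
  have less: "f x < f m" if "x \<in> A" "x \<noteq> m" for x
    using that m inj_f by (metis Max_ge finite finite_imageI imageI injD le_neq_implies_less)
  define B where "B = A - {m}"
  have A: "A = insert m B" "m \<notin> B" using m by (auto simp: B_def)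
  have "n = card B" using Suc.hyps(2) A by simp
  then have "hilbert_dual B = hilbert_dual {} + fps_X * (\<Sum>u\<in>B. hilbert_dual (next_vars B u))"
    by (rule Suc.hyps(1))
  moreover have "next_vars B u = next_vars A u" if "u \<in> B" for u
    using less[of u] that by (auto simp: B_def next_vars_def)
  moreover have "next_vars A m = B \<union> {w. E m w}"
    using less by (auto simp: B_def next_vars_def)
  ultimately show ?case
    using hilbert_dual_insert[OF A(2)] A by (simp add: algebra_simps)
qed

definition word_series :: "'v set \<Rightarrow> real fps" where
  "word_series A = Abs_fps (\<lambda>n. real (word_count n A))"

text \<open>
  Both sides satisfy the same recursion, whose right-hand side involves only lower coefficients.
\<close>

lemma word_series_mult_hilbert_dual: "word_series A * hilbert_dual {} = hilbert_dual A"
proof (rule fps_ext)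
  fix n
  have rec: "word_series A = 1 + fps_X * (\<Sum>u\<in>A. word_series (next_vars A u))" for A
    by (rule fps_ext) (auto simp: word_series_def fps_sum_nth gr0_conv_Suc)
  show "fps_nth (word_series A * hilbert_dual {}) n = fps_nth (hilbert_dual A) n"
  proof (induction n arbitrary: A)
    case 0
    have "fps_nth (hilbert_dual A) 0 = fps_nth (hilbert_dual {}) 0"
      by (subst hilbert_dual_recursion) simp
    then show ?case by (simp add: word_series_def)
  next
    case (Suc n)
    have "word_series A * hilbert_dual {}
        = hilbert_dual {} + fps_X * (\<Sum>u\<in>A. word_series (next_vars A u) * hilbert_dual {})"
      by (subst rec) (simp add: distrib_right sum_distrib_right mult.assoc)
    then have "fps_nth (word_series A * hilbert_dual {}) (Suc n)
        = fps_nth (hilbert_dual {}) (Suc n) + (\<Sum>u\<in>A. fps_nth (hilbert_dual (next_vars A u)) n)"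
      by (simp add: fps_sum_nth Suc.IH)
    also have "\<dots> = fps_nth (hilbert_dual A) (Suc n)"
      by (subst (3) hilbert_dual_recursion) (simp add: fps_sum_nth)
    finally show ?case .
  qed
qed

text \<open>
  The quotient of \<open>R\<close> by all variables is the residue field, with Hilbert series \<open>1\<close>.
\<close>

theorem poincare_series_edge_ideal:
  "poincare_series (edge_ideal E :: ('v, 'k) mpoly set)
     * indep_poly E UNIV (- fps_X * inverse (1 + fps_X)) = 1"
proof -
  interpret mpoly_residue_ideal I by (rule mpoly_residue_ideal.intro) (rule residue_ideal_axioms)
  obtain e where "is_resolution words e (\<lambda>_. 1)"
    "\<And>i y x. y \<in> words i \<Longrightarrow> x \<in> words (Suc i) \<Longrightarrow> const_coeff (e (Suc i) y x) = 0"
    using minimal_resolution_exists by blast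
  then have "betti I i = card (words i)" for i by (rule betti_eq_minimal_rank)
  then have "poincare_series (edge_ideal E :: ('v, 'k) mpoly set) = word_series UNIV"
    by (simp add: poincare_series_def word_series_def card_words edge_ideal_eq[OF irr])
  then show ?thesis
    using word_series_mult_hilbert_dual[of UNIV] by (simp add: hilbert_dual_def)
qed

end

theorem theorem4p4:
  fixes E :: "'v::finite \<Rightarrow> 'v \<Rightarrow> bool"
  assumes "symp E" and "irreflp E"
    and "\<not> complete_intersection (edge_ideal E :: ('v, 'k::field) mpoly set)"
    and "claw_free E"
  shows "\<exists>(b::nat) (\<rho>::real). b > 0 \<and> \<rho> > 1 \<and>
    (\<lambda>i. real_of_int (deviation (edge_ideal E :: ('v, 'k) mpoly set) i) / (real b * \<rho> ^ i / real i))
      \<longlonglongrightarrow> 1"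
proof -
  obtain f :: "'v \<Rightarrow> nat" where f: "inj f" "\<forall>v. f v < CARD('v)" using finite_type_injection by blast
  interpret ordered_graph E f "TYPE('k)"
    by unfold_locales (use assms f in auto)
  obtain u v w where uvw: "E u v" "E u w" "v \<noteq> w"
    using matching_complete_intersection[OF assms(1,2)] assms(3) by blast
  obtain as where as: "\<forall>a\<in>set as. a > 0"
    "indep_poly E UNIV [:0, 1:] = (\<Prod>a\<leftarrow>as. [:1, a :: real:])"
    using claw_free_factorization[OF assms(1,2,4)] by blast
  define h where "h = indep_poly E UNIV (- fps_X * inverse (1 + fps_X) :: real fps)"
  have h: "h * (1 + fps_X) ^ length as = (\<Prod>a\<leftarrow>as. 1 - fps_const (a - 1) * fps_X)"
    unfolding h_def by (rule indep_poly_fps_factorization[OF as(2)])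
  define cs where "cs = map (\<lambda>a. a - 1) as"
  have "poincare_series (edge_ideal E :: ('v, 'k) mpoly set) * (\<Prod>c\<leftarrow>cs. 1 - fps_const c * fps_X)
      = (poincare_series (edge_ideal E :: ('v, 'k) mpoly set) * h) * (1 + fps_X) ^ length as"
    by (simp add: cs_def o_def h[symmetric] mult.assoc)
  also have "\<dots> = (1 + fps_X) ^ length as"
    using poincare_series_edge_ideal by (simp add: h_def)
  finally show ?thesis
  proof (rule deviation_asymptotics)
    show "c > -1" if "c \<in> set cs" for c using that as(1) by (auto simp: cs_def)
    obtain a where "a \<in> set as" "a \<ge> 5/2"
      using large_root_of_two_neighbours[OF assms(1,2) as(2) uvw] by blast
    then show "\<exists>c\<in>set cs. c \<ge> 3/2" by (intro bexI[of _ "a - 1"]) (auto simp: cs_def)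
  qed
qed

end
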